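(* For the cyclic $(2,7)$-curve $y^2=x^7+\lambda_6x^6+\lambda_5x^5+\lambda_4x^4+\lambda_3x^3+\lambda_2x^2+\lambda_1x+\lambda_0$, the following $24$ bilinear relations hold identically in $\boldsymbol u$, and every bilinear relation associated with the curve may be given as a linear combination of them: 1. $0=\wp_{233}\wp_{33}+\wp_{223}-\wp_{333}\wp_{23}-\wp_{133}$ 2. $0=\wp_{133}\wp_{33}+\wp_{123}-\wp_{333}\wp_{13}$ 3. $0=-2\wp_{33}\wp_{223}+\wp_{22}\wp_{333}+\wp_{23}\wp_{233}+\lambda_5\wp_{233}-4\wp_{123}+2\lambda_6\wp_{133}+\wp_{222}-2\lambda_6\wp_{223}$ 4. $0=-\wp_{133}\wp_{23}-\wp_{113}+\wp_{233}\wp_{13}$ 5. $0=\wp_{33}\wp_{222}-2\wp_{22}\wp_{233}+\wp_{23}\wp_{223}+\lambda_5\wp_{223}-\wp_{122}+2\lambda_6\wp_{123}+3\wp_{113}-2\lambda_5\wp_{133}+\wp_{333}\lambda_3-2\wp_{233}\lambda_4$ 6. $0=-\wp_{133}\wp_{23}-2\wp_{33}\wp_{123}-3\wp_{113}+\wp_{122}-2\lambda_6\wp_{123}+\wp_{12}\wp_{333}+2\wp_{233}\wp_{13}+\lambda_5\wp_{133}$ 7. $0=\wp_{112}-\wp_{222}\wp_{23}+\wp_{22}\wp_{223}+\wp_{233}\lambda_3+2\wp_{133}\wp_{13}-2\wp_{22}\wp_{133}+2\wp_{12}\wp_{233}-2\wp_{11}\wp_{333}-2\wp_{333}\lambda_2-2\lambda_6\wp_{113}$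 8. $0=-\wp_{123}\wp_{23}-\wp_{133}\wp_{13}+\wp_{13}\wp_{223}+\wp_{33}\wp_{113}$ 9. $0=-\wp_{22}\wp_{133}-2\wp_{123}\wp_{23}+\wp_{112}-2\lambda_6\wp_{113}+\wp_{12}\wp_{233}+2\wp_{13}\wp_{223}$ 10. $0=\wp_{122}\wp_{33}-2\wp_{22}\wp_{133}+\lambda_5\wp_{123}+\wp_{133}\wp_{13}+\wp_{13}\wp_{223}-\wp_{11}\wp_{333}-2\wp_{133}\lambda_4$ 11. $0=-\lambda_5\wp_{113}+2\wp_{133}\lambda_3+2\wp_{12}\wp_{223}+\wp_{22}\wp_{123}-3\wp_{333}\lambda_1+2\wp_{123}\wp_{13}-2\wp_{222}\wp_{13}-\wp_{122}\wp_{23}-\wp_{112}\wp_{33}-\wp_{11}\wp_{233}$ 12. $0=-\lambda_5\wp_{113}+\wp_{133}\lambda_3+\wp_{12}\wp_{223}-\wp_{333}\lambda_1+\wp_{111}-\wp_{122}\wp_{23}$ 13. $0=-\wp_{133}\lambda_3+4\wp_{123}\wp_{13}-2\wp_{12}\wp_{133}-\wp_{11}\wp_{233}-\wp_{23}\wp_{113}+\wp_{122}\wp_{23}+\wp_{12}\wp_{223}-\wp_{222}\wp_{13}-\wp_{22}\wp_{123}$ 14. $0=\wp_{133}\lambda_3+\wp_{12}\wp_{133}+\wp_{11}\wp_{233}-\wp_{23}\wp_{113}-\wp_{112}\wp_{33}-\lambda_5\wp_{113}$ 15. $0=-\lambda_5\wp_{112}+\wp_{12}\wp_{222}-\wp_{22}\wp_{122}-\wp_{233}\lambda_1-4\wp_{13}\wp_{113}+2\wp_{13}\wp_{122}+2\wp_{22}\wp_{113}-2\wp_{23}\wp_{112}-2\wp_{12}\wp_{123}+2\wp_{33}\wp_{111}+2\wp_{11}\wp_{133}+2\wp_{133}\lambda_2+2\lambda_6\wp_{111}$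 16. $0=-\wp_{22}\wp_{113}+\wp_{11}\wp_{223}+3\wp_{12}\wp_{123}-\wp_{233}\lambda_1+2\wp_{133}\lambda_2-4\wp_{333}\lambda_0+\wp_{123}\lambda_3+2\wp_{13}\wp_{113}-2\wp_{13}\wp_{122}-\wp_{23}\wp_{112}-\wp_{33}\wp_{111}-\wp_{11}\wp_{133}-2\wp_{113}\lambda_4$ 17. $0=\wp_{22}\wp_{113}+2\wp_{12}\wp_{123}-\wp_{233}\lambda_1+2\wp_{133}\lambda_2-4\wp_{333}\lambda_0-2\wp_{13}\wp_{122}-\wp_{23}\wp_{112}$ 18. $0=-\wp_{233}\lambda_1-3\wp_{13}\wp_{113}+3\wp_{11}\wp_{133}+2\wp_{133}\lambda_2+2\wp_{333}\lambda_0-\wp_{23}\wp_{112}-\wp_{12}\wp_{123}+\wp_{13}\wp_{122}+\wp_{22}\wp_{113}$ 19. $0=-2\wp_{22}\wp_{112}+\wp_{11}\wp_{222}+\wp_{12}\wp_{122}-\lambda_1\wp_{223}+2\lambda_2\wp_{123}-4\wp_{233}\lambda_0+\wp_{122}\lambda_3+\lambda_5\wp_{111}-2\lambda_4\wp_{112}-2\wp_{113}\lambda_3+3\wp_{133}\lambda_1$ 20. $0=\wp_{133}\lambda_1+\wp_{12}\wp_{113}-2\wp_{233}\lambda_0-\wp_{13}\wp_{112}$ 21. $0=-3\wp_{133}\lambda_1+\lambda_1\wp_{223}-\wp_{12}\wp_{113}-2\wp_{11}\wp_{123}-2\lambda_2\wp_{123}+4\wp_{233}\lambda_0+\wp_{113}\lambda_3+2\wp_{13}\wp_{112}+\wp_{23}\wp_{111}$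 22. $0=-4\lambda_1\wp_{123}+\lambda_1\wp_{222}+\wp_{12}\wp_{112}-2\wp_{11}\wp_{122}-2\wp_{122}\lambda_2+4\wp_{223}\lambda_0+\wp_{22}\wp_{111}+2\lambda_2\wp_{113}-4\wp_{133}\lambda_0+\wp_{112}\lambda_3$ 23. $0=-\wp_{11}\wp_{113}-\lambda_1\wp_{123}-2\wp_{133}\lambda_0+2\wp_{223}\lambda_0+\wp_{13}\wp_{111}$ 24. $0=-\wp_{11}\wp_{112}-\wp_{122}\lambda_1-4\lambda_0\wp_{123}+2\lambda_0\wp_{222}+\lambda_1\wp_{113}+\wp_{12}\wp_{111}$
   Context: Let $C$ be the compact Riemann surface (genus $3$, one point $\infty$ at infinity) of the cyclic $(2,7)$-curve $y^2=x^7+\lambda_6x^6+\dots+\lambda_1x+\lambda_0$, assumed non-singular, $\lambda_j\in\mathbb C$, $\lambda_7:=1$. Put $\boldsymbol{du}=\big(\frac{dx}{2y},\frac{x\,dx}{2y},\frac{x^2dx}{2y}\big)$. $\Lambda\subset\mathbb C^3$ is the lattice of all periods of $\boldsymbol{du}$ over $H_1(C,\mathbb Z)$, $J=\mathbb C^3/\Lambda$, $\kappa:\mathbb C^3\to J$ the projection, $W^{[2]}\subset J$ the image of $(P_1,P_2)\mapsto\int_\infty^{P_1}\boldsymbol{du}+\int_\infty^{P_2}\boldsymbol{du}$, and $\Theta^{[2]}=W^{[2]}\cup(-W^{[2]})$. The Kleinian sigma function $\sigma(\boldsymbol u)$, $\boldsymbol u=(u_1,u_2,u_3)\in\mathbb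 C^3$, is classically $c\exp(\frac12\boldsymbol u\eta'(\omega')^{-1}\boldsymbol u^T)$ times the Riemann theta function whose characteristic gives the Riemann constant with base point $\infty$. It is uniquely determined by: (i) $\sigma$ is entire, with zeros of order one along $\kappa^{-1}(\Theta^{[2]})$ and no other zeros; (ii) for each $\boldsymbol\ell\in\Lambda$, $\sigma(\boldsymbol u+\boldsymbol\ell)=\chi(\boldsymbol\ell)\exp(L(\boldsymbol u+\frac12\boldsymbol\ell,\boldsymbol\ell))\sigma(\boldsymbol u)$ with $\chi(\boldsymbol\ell)\in\{\pm1\}$ and $L(\cdot,\boldsymbol\ell)$ a $\mathbb C$-linear form; (iii) $\sigma(-\boldsymbol u)=\sigma(\boldsymbol u)$; (iv) giving $u_1,u_2,u_3$ weights $5,3,1$, the lowest-weight part of the Taylor expansion of $\sigma$ at $0$ is $\frac1{45}u_3^6-\frac13u_3^3u_2-u_2^2+u_3u_1$; (v) (normalisation of the quadratic exponential factor, corresponding to the standard choice of second kind differentials) with $\wp_{ij}=-\partial_{u_i}\partial_{u_j}\log\sigma$, for generic $P_k=(x_k,y_k)$ ($k=1,2,3$), $\boldsymbol u=\sum_k\int_\infty^{P_k}\boldsymbol{du}$ and $P=(x,y)$, one has for each $k$: $\sum_{i,j=1}^3\wp_{ij}\big(\int_\infty^P\boldsymbol{du}-\boldsymbol u\big)x^{i-1}x_k^{j-1}=\frac{\mathcal F(x,x_k)+2yy_k}{(x-x_k)^2}$, where $\mathcal F(x,z)=\sum_{j=0}^3x^jz^j\big(2\lambda_{2j}+\lambda_{2j+1}(x+z)\big)$.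 For $m\ge2$, $\wp_{i_1\dots i_m}=-\frac{\partial}{\partial u_{i_1}}\cdots\frac{\partial}{\partial u_{i_m}}\log\sigma$. A bilinear relation is an identity, valid for all $\boldsymbol u$, stating that a linear combination, with coefficients independent of $\boldsymbol u$, of the 3-index functions $\wp_{ijk}$ and the products $\wp_{ij}\wp_{klm}$ of a 2-index and a 3-index function vanishes. Linear combinations are taken with coefficients independent of $\boldsymbol u$. *)

theory Defs
  imports "HOL-Analysis.Analysis" "HOL-Computational_Algebra.Polynomial"
begin

section \<open>The curve and its periods\<close>

text \<open>The coefficients are given by \<open>lam :: nat \<Rightarrow> complex\<close>, of which only \<open>lam 0, \<dots>, lam 7\<close>
  matter; the curve is monic, i.e. \<open>lam 7 = 1\<close> is assumed wherever it is used.\<close>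

definition curve_poly :: "(nat \<Rightarrow> complex) \<Rightarrow> complex poly" where
  "curve_poly lam = (\<Sum>j\<le>7. monom (lam j) j)"

text \<open>The second affine chart, around the point at infinity: with \<open>s = 1/x\<close>, \<open>w = y/x^4\<close> the
  equation becomes \<open>w^2 = s^8 f(1/s)\<close>, and the point at infinity is \<open>(s,w) = (0,0)\<close>.\<close>

definition curve_poly_inf :: "(nat \<Rightarrow> complex) \<Rightarrow> complex poly" where
  "curve_poly_inf lam = (\<Sum>j\<le>7. monom (lam j) (8 - j))"

definition plane_curve :: "complex poly \<Rightarrow> (complex \<times> complex) set" where
  "plane_curve p = {(x, y). y\<^sup>2 = poly p x}"

text \<open>Jacobian criterion for \<open>y^2 - f(x)\<close>; the point at infinity is always smooth.\<close>

definition nonsingular_curve :: "(nat \<Rightarrow> complex) \<Rightarrow> bool" where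
  "nonsingular_curve lam \<longleftrightarrow>
     (\<forall>(x, y) \<in> plane_curve (curve_poly lam). poly (pderiv (curve_poly lam)) x \<noteq> 0 \<or> 2 * y \<noteq> 0)"

text \<open>Points of the compact Riemann surface: \<open>None\<close> is the point at infinity.\<close>

type_synonym cpoint = "(complex \<times> complex) option"

fun point_of_inf_chart :: "complex \<times> complex \<Rightarrow> cpoint" where
  "point_of_inf_chart (s, w) = (if s = 0 then None else Some (1 / s, w / s ^ 4))"

text \<open>Pull-back along \<open>g\<close> of the holomorphic form \<open>dx/(2y) = dy/p'(x)\<close> on \<open>y^2 = p(x)\<close>; the
  second expression is the one to use at the branch points \<open>y = 0\<close>.\<close>

definition pullback_form :: "complex poly \<Rightarrow> (real \<Rightarrow> complex \<times> complex) \<Rightarrow> real \<Rightarrow> complex" where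
  "pullback_form p g t =
     (let (x, y) = g t; (x', y') = vector_derivative g (at t within {0..1})
      in if y \<noteq> 0 then x' / (2 * y) else y' / poly (pderiv p) x)"

definition integral_affine :: "(nat \<Rightarrow> complex) \<Rightarrow> (real \<Rightarrow> complex \<times> complex) \<Rightarrow> complex ^ 3" where
  "integral_affine lam g =
     integral {0..1} (\<lambda>t. pullback_form (curve_poly lam) g t *s
                          vector [1, fst (g t), (fst (g t))\<^sup>2])"

text \<open>In the chart at infinity, \<open>x^(i-1) dx/(2y) = - s^(3-i) ds/(2w)\<close>.\<close>

definition integral_inf :: "(nat \<Rightarrow> complex) \<Rightarrow> (real \<Rightarrow> complex \<times> complex) \<Rightarrow> complex ^ 3" where
  "integral_inf lam g =
     - integral {0..1} (\<lambda>t. pullback_form (curve_poly_inf lam) g t *s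
                            vector [(fst (g t))\<^sup>2, fst (g t), 1])"

text \<open>\<open>abelian_integral lam P Q u\<close>: \<open>u\<close> is the value of the integral of
  \<open>(dx/2y, x dx/2y, x^2 dx/2y)\<close> from \<open>P\<close> to \<open>Q\<close> along some piecewise \<open>C^1\<close> path on the compact
  surface. Any such path is a concatenation of paths each contained in one of the two charts.\<close>

inductive abelian_integral :: "(nat \<Rightarrow> complex) \<Rightarrow> cpoint \<Rightarrow> cpoint \<Rightarrow> complex ^ 3 \<Rightarrow> bool"
  for lam where
  affine: "valid_path g \<Longrightarrow> path_image g \<subseteq> plane_curve (curve_poly lam) \<Longrightarrow>
     abelian_integral lam (Some (pathstart g)) (Some (pathfinish g)) (integral_affine lam g)"
| at_inf: "valid_path g \<Longrightarrow> path_image g \<subseteq> plane_curve (curve_poly_inf lam) \<Longrightarrow>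
     abelian_integral lam (point_of_inf_chart (pathstart g)) (point_of_inf_chart (pathfinish g))
       (integral_inf lam g)"
| join: "abelian_integral lam P Q u \<Longrightarrow> abelian_integral lam Q R v \<Longrightarrow>
     abelian_integral lam P R (u + v)"

text \<open>As the surface is path connected, every class in \<open>H\<^sub>1(C, \<int>)\<close> is represented by a single
  closed path, so the integrals over closed paths are all the periods.\<close>

definition period_lattice :: "(nat \<Rightarrow> complex) \<Rightarrow> (complex ^ 3) set" where
  "period_lattice lam = {l. \<exists>P. abelian_integral lam P P l}"

text \<open>The inverse images in \<open>\<complex>\<^sup>3\<close> of \<open>W\<^sup>[\<^sup>2\<^sup>]\<close> and of the theta divisor.\<close>

definition W2_preimage :: "(nat \<Rightarrow> complex) \<Rightarrow> (complex ^ 3) set" where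
  "W2_preimage lam = {a + b + l | a b l P Q.
     abelian_integral lam None P a \<and> abelian_integral lam None Q b \<and> l \<in> period_lattice lam}"

definition Theta2_preimage :: "(nat \<Rightarrow> complex) \<Rightarrow> (complex ^ 3) set" where
  "Theta2_preimage lam = W2_preimage lam \<union> uminus ` W2_preimage lam"

section \<open>The sigma function\<close>

definition entire :: "(complex ^ 3 \<Rightarrow> complex) \<Rightarrow> bool" where
  "entire f \<longleftrightarrow> (\<forall>u. \<exists>D. (f has_derivative D) (at u) \<and> Vector_Spaces.linear (*s) (*) D)"

definition pd :: "3 \<Rightarrow> (complex ^ 3 \<Rightarrow> complex) \<Rightarrow> complex ^ 3 \<Rightarrow> complex" where
  "pd i f u = deriv (\<lambda>z. f (u + axis i z)) 0"

text \<open>\<open>wp \<sigma> [i\<^sub>1, \<dots>, i\<^sub>m] = - \<partial>\<^sub>i\<^sub>1 \<dots> \<partial>\<^sub>i\<^sub>m log \<sigma>\<close>, where the derivative \<open>\<partial>\<^sub>i log \<sigma>\<close> of the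
  multivalued logarithm is \<open>\<partial>\<^sub>i \<sigma> / \<sigma>\<close>. Meaningful for \<open>m \<ge> 1\<close> and at points with \<open>\<sigma> u \<noteq> 0\<close>.
  Note that the index \<open>3 :: 3\<close> coincides with \<open>0 :: 3\<close>.\<close>

definition wp :: "(complex ^ 3 \<Rightarrow> complex) \<Rightarrow> 3 list \<Rightarrow> complex ^ 3 \<Rightarrow> complex" where
  "wp \<sigma> is u = - foldr pd (butlast is) (\<lambda>v. pd (last is) \<sigma> v / \<sigma> v) u"

definition taylor_coeff :: "(complex ^ 3 \<Rightarrow> complex) \<Rightarrow> nat \<Rightarrow> nat \<Rightarrow> nat \<Rightarrow> complex" where
  "taylor_coeff f a b c = ((pd 1 ^^ a) ((pd 2 ^^ b) ((pd 3 ^^ c) f))) 0 / (fact a * fact b * fact c)"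

definition klein_F :: "(nat \<Rightarrow> complex) \<Rightarrow> complex \<Rightarrow> complex \<Rightarrow> complex" where
  "klein_F lam x z = (\<Sum>j\<le>3. x ^ j * z ^ j * (2 * lam (2 * j) + lam (2 * j + 1) * (x + z)))"

text \<open>Zeros of order one along the divisor: the zero divisor is reduced, i.e. the zeros with
  nonvanishing gradient are dense in the zero set (the gradient does vanish at singular points
  of the divisor such as \<open>0\<close>).\<close>

definition sigma_zeros :: "(nat \<Rightarrow> complex) \<Rightarrow> (complex ^ 3 \<Rightarrow> complex) \<Rightarrow> bool" where
  "sigma_zeros lam \<sigma> \<longleftrightarrow>
     {u. \<sigma> u = 0} = Theta2_preimage lam \<and>
     Theta2_preimage lam \<subseteq> closure {u \<in> Theta2_preimage lam. \<exists>i. pd i \<sigma> u \<noteq> 0}"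

definition sigma_quasiperiodic :: "(nat \<Rightarrow> complex) \<Rightarrow> (complex ^ 3 \<Rightarrow> complex) \<Rightarrow> bool" where
  "sigma_quasiperiodic lam \<sigma> \<longleftrightarrow>
     (\<forall>l \<in> period_lattice lam. \<exists>s \<in> {1, -1}. \<exists>L. Vector_Spaces.linear (*s) (*) L \<and>
        (\<forall>u. \<sigma> (u + l) = s * exp (L (u + (1 / 2) *s l)) * \<sigma> u))"

text \<open>The weights of \<open>u\<^sub>1, u\<^sub>2, u\<^sub>3\<close> are \<open>5, 3, 1\<close>.\<close>

definition sigma_leading_part :: "(complex ^ 3 \<Rightarrow> complex) \<Rightarrow> bool" where
  "sigma_leading_part \<sigma> \<longleftrightarrow>
     (\<forall>a b c. 5 * a + 3 * b + c < 6 \<longrightarrow> taylor_coeff \<sigma> a b c = 0) \<and>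
     (\<forall>u :: complex ^ 3. (\<Sum>(a, b, c) \<in> {(a, b, c). 5 * a + 3 * b + c = 6}.
              taylor_coeff \<sigma> a b c * (u $ 1) ^ a * (u $ 2) ^ b * (u $ 3) ^ c)
          = 1 / 45 * (u $ 3) ^ 6 - 1 / 3 * (u $ 3) ^ 3 * u $ 2 - (u $ 2)\<^sup>2 + u $ 3 * u $ 1)"

text \<open>Klein's formula. Here \<open>a k\<close> and \<open>b\<close> are values of the integrals from infinity to \<open>P k\<close> and to
  \<open>(x, y)\<close>, and the genericity condition is that both sides are defined.\<close>

definition sigma_klein_formula :: "(nat \<Rightarrow> complex) \<Rightarrow> (complex ^ 3 \<Rightarrow> complex) \<Rightarrow> bool" where
  "sigma_klein_formula lam \<sigma> \<longleftrightarrow>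
     (\<forall>(P :: 3 \<Rightarrow> complex \<times> complex) a x y b k.
        (\<forall>m. abelian_integral lam None (Some (P m)) (a m)) \<longrightarrow>
        abelian_integral lam None (Some (x, y)) b \<longrightarrow>
        \<sigma> (b - (\<Sum>m\<in>UNIV. a m)) \<noteq> 0 \<longrightarrow> x \<noteq> fst (P k) \<longrightarrow>
        (\<Sum>i\<in>UNIV. \<Sum>j\<in>UNIV. wp \<sigma> [i, j] (b - (\<Sum>m\<in>UNIV. a m)) *
            (vector [1, x, x\<^sup>2] :: complex ^ 3) $ i *
            (vector [1, fst (P k), (fst (P k))\<^sup>2] :: complex ^ 3) $ j)
        = (klein_F lam x (fst (P k)) + 2 * y * snd (P k)) / (x - fst (P k))\<^sup>2)"

definition kleinian_sigma :: "(nat \<Rightarrow> complex) \<Rightarrow> (complex ^ 3 \<Rightarrow> complex) \<Rightarrow> bool" where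
  "kleinian_sigma lam \<sigma> \<longleftrightarrow>
     entire \<sigma> \<and> sigma_zeros lam \<sigma> \<and> sigma_quasiperiodic lam \<sigma> \<and>
     (\<forall>u. \<sigma> (- u) = \<sigma> u) \<and> sigma_leading_part \<sigma> \<and> sigma_klein_formula lam \<sigma>"

section \<open>Bilinear relations\<close>

text \<open>The 2- and 3-index functions up to permutation of the indices.\<close>

definition idx2 :: "3 list set" where
  "idx2 = {[1,1], [1,2], [1,3], [2,2], [2,3], [3,3]}"

definition idx3 :: "3 list set" where
  "idx3 = {[1,1,1], [1,1,2], [1,1,3], [1,2,2], [1,2,3], [1,3,3], [2,2,2], [2,2,3], [2,3,3], [3,3,3]}"

text \<open>The formal linear combination with constant coefficients \<open>c\<close> of the 3-index symbols and \<open>d\<close>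
  of the products of a 2- and a 3-index symbol, as a polynomial in the symbols \<open>w I\<close>. Substituting
  \<open>w I = wp \<sigma> I u\<close> gives a function of \<open>u\<close>; the formal expression itself is determined by its
  values for arbitrary complex \<open>w I\<close>.\<close>

definition bilinear_expr ::
  "(3 list \<Rightarrow> complex) \<Rightarrow> (3 list \<Rightarrow> 3 list \<Rightarrow> complex) \<Rightarrow> (3 list \<Rightarrow> complex) \<Rightarrow> complex" where
  "bilinear_expr c d w =
     (\<Sum>K\<in>idx3. c K * w K) + (\<Sum>I\<in>idx2. \<Sum>K\<in>idx3. d I K * (w I * w K))"

definition is_bilinear_relation ::
  "(complex ^ 3 \<Rightarrow> complex) \<Rightarrow> (3 list \<Rightarrow> complex) \<Rightarrow> (3 list \<Rightarrow> 3 list \<Rightarrow> complex) \<Rightarrow> bool" where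
  "is_bilinear_relation \<sigma> c d \<longleftrightarrow>
     (\<forall>u. \<sigma> u \<noteq> 0 \<longrightarrow> bilinear_expr c d (\<lambda>I. wp \<sigma> I u) = 0)"

definition listed_relations :: "(nat \<Rightarrow> complex) \<Rightarrow> (3 list \<Rightarrow> complex) \<Rightarrow> complex list" where
  "listed_relations lam w =
   [ w [2,3,3] * w [3,3] + w [2,2,3] - w [3,3,3] * w [2,3] - w [1,3,3],
     w [1,3,3] * w [3,3] + w [1,2,3] - w [3,3,3] * w [1,3],
     - 2 * w [3,3] * w [2,2,3] + w [2,2] * w [3,3,3] + w [2,3] * w [2,3,3] +
      lam 5 * w [2,3,3] - 4 * w [1,2,3] + 2 * lam 6 * w [1,3,3] + w [2,2,2] -
      2 * lam 6 * w [2,2,3],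
     - w [1,3,3] * w [2,3] - w [1,1,3] + w [2,3,3] * w [1,3],
     w [3,3] * w [2,2,2] - 2 * w [2,2] * w [2,3,3] + w [2,3] * w [2,2,3] + lam 5 * w [2,2,3]
      - w [1,2,2] + 2 * lam 6 * w [1,2,3] + 3 * w [1,1,3] - 2 * lam 5 * w [1,3,3] +
      w [3,3,3] * lam 3 - 2 * w [2,3,3] * lam 4,
     - w [1,3,3] * w [2,3] - 2 * w [3,3] * w [1,2,3] - 3 * w [1,1,3] + w [1,2,2] -
      2 * lam 6 * w [1,2,3] + w [1,2] * w [3,3,3] + 2 * w [2,3,3] * w [1,3] +
      lam 5 * w [1,3,3],
     w [1,1,2] - w [2,2,2] * w [2,3] + w [2,2] * w [2,2,3] + w [2,3,3] * lam 3 +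
      2 * w [1,3,3] * w [1,3] - 2 * w [2,2] * w [1,3,3] + 2 * w [1,2] * w [2,3,3] -
      2 * w [1,1] * w [3,3,3] - 2 * w [3,3,3] * lam 2 - 2 * lam 6 * w [1,1,3],
     - w [1,2,3] * w [2,3] - w [1,3,3] * w [1,3] + w [1,3] * w [2,2,3] + w [3,3] * w [1,1,3],
     - w [2,2] * w [1,3,3] - 2 * w [1,2,3] * w [2,3] + w [1,1,2] - 2 * lam 6 * w [1,1,3] +
      w [1,2] * w [2,3,3] + 2 * w [1,3] * w [2,2,3],
     w [1,2,2] * w [3,3] - 2 * w [2,2] * w [1,3,3] + lam 5 * w [1,2,3] + w [1,3,3] * w [1,3]
      + w [1,3] * w [2,2,3] - w [1,1] * w [3,3,3] - 2 * w [1,3,3] * lam 4,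
     - lam 5 * w [1,1,3] + 2 * w [1,3,3] * lam 3 + 2 * w [1,2] * w [2,2,3] +
      w [2,2] * w [1,2,3] - 3 * w [3,3,3] * lam 1 + 2 * w [1,2,3] * w [1,3] -
      2 * w [2,2,2] * w [1,3] - w [1,2,2] * w [2,3] - w [1,1,2] * w [3,3] -
      w [1,1] * w [2,3,3],
     - lam 5 * w [1,1,3] + w [1,3,3] * lam 3 + w [1,2] * w [2,2,3] - w [3,3,3] * lam 1 +
      w [1,1,1] - w [1,2,2] * w [2,3],
     - w [1,3,3] * lam 3 + 4 * w [1,2,3] * w [1,3] - 2 * w [1,2] * w [1,3,3] -
      w [1,1] * w [2,3,3] - w [2,3] * w [1,1,3] + w [1,2,2] * w [2,3] + w [1,2] * w [2,2,3] -
      w [2,2,2] * w [1,3] - w [2,2] * w [1,2,3],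
     w [1,3,3] * lam 3 + w [1,2] * w [1,3,3] + w [1,1] * w [2,3,3] - w [2,3] * w [1,1,3] -
      w [1,1,2] * w [3,3] - lam 5 * w [1,1,3],
     - lam 5 * w [1,1,2] + w [1,2] * w [2,2,2] - w [2,2] * w [1,2,2] - w [2,3,3] * lam 1 -
      4 * w [1,3] * w [1,1,3] + 2 * w [1,3] * w [1,2,2] + 2 * w [2,2] * w [1,1,3] -
      2 * w [2,3] * w [1,1,2] - 2 * w [1,2] * w [1,2,3] + 2 * w [3,3] * w [1,1,1] +
      2 * w [1,1] * w [1,3,3] + 2 * w [1,3,3] * lam 2 + 2 * lam 6 * w [1,1,1],
     - w [2,2] * w [1,1,3] + w [1,1] * w [2,2,3] + 3 * w [1,2] * w [1,2,3] -
      w [2,3,3] * lam 1 + 2 * w [1,3,3] * lam 2 - 4 * w [3,3,3] * lam 0 + w [1,2,3] * lam 3 +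
      2 * w [1,3] * w [1,1,3] - 2 * w [1,3] * w [1,2,2] - w [2,3] * w [1,1,2] -
      w [3,3] * w [1,1,1] - w [1,1] * w [1,3,3] - 2 * w [1,1,3] * lam 4,
     w [2,2] * w [1,1,3] + 2 * w [1,2] * w [1,2,3] - w [2,3,3] * lam 1 +
      2 * w [1,3,3] * lam 2 - 4 * w [3,3,3] * lam 0 - 2 * w [1,3] * w [1,2,2] -
      w [2,3] * w [1,1,2],
     - w [2,3,3] * lam 1 - 3 * w [1,3] * w [1,1,3] + 3 * w [1,1] * w [1,3,3] +
      2 * w [1,3,3] * lam 2 + 2 * w [3,3,3] * lam 0 - w [2,3] * w [1,1,2] -
      w [1,2] * w [1,2,3] + w [1,3] * w [1,2,2] + w [2,2] * w [1,1,3],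
     - 2 * w [2,2] * w [1,1,2] + w [1,1] * w [2,2,2] + w [1,2] * w [1,2,2] -
      lam 1 * w [2,2,3] + 2 * lam 2 * w [1,2,3] - 4 * w [2,3,3] * lam 0 + w [1,2,2] * lam 3 +
      lam 5 * w [1,1,1] - 2 * lam 4 * w [1,1,2] - 2 * w [1,1,3] * lam 3 +
      3 * w [1,3,3] * lam 1,
     w [1,3,3] * lam 1 + w [1,2] * w [1,1,3] - 2 * w [2,3,3] * lam 0 - w [1,3] * w [1,1,2],
     - 3 * w [1,3,3] * lam 1 + lam 1 * w [2,2,3] - w [1,2] * w [1,1,3] -
      2 * w [1,1] * w [1,2,3] - 2 * lam 2 * w [1,2,3] + 4 * w [2,3,3] * lam 0 +
      w [1,1,3] * lam 3 + 2 * w [1,3] * w [1,1,2] + w [2,3] * w [1,1,1],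
     - 4 * lam 1 * w [1,2,3] + lam 1 * w [2,2,2] + w [1,2] * w [1,1,2] -
      2 * w [1,1] * w [1,2,2] - 2 * w [1,2,2] * lam 2 + 4 * w [2,2,3] * lam 0 +
      w [2,2] * w [1,1,1] + 2 * lam 2 * w [1,1,3] - 4 * w [1,3,3] * lam 0 + w [1,1,2] * lam 3,
     - w [1,1] * w [1,1,3] - lam 1 * w [1,2,3] - 2 * w [1,3,3] * lam 0 +
      2 * w [2,2,3] * lam 0 + w [1,3] * w [1,1,1],
     - w [1,1] * w [1,1,2] - w [1,2,2] * lam 1 - 4 * lam 0 * w [1,2,3] +
      2 * lam 0 * w [2,2,2] + lam 1 * w [1,1,3] + w [1,2] * w [1,1,1] ]"

end

theory Submission
  imports Defs "HOL-Complex_Analysis.Conformal_Mappings"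
begin

text \<open>
  Let \<open>u\<close> be the sum of the Abelian integrals to three points \<open>(x\<^sub>k, y\<^sub>k)\<close> of the curve near infinity.
  Klein's formula and its derivatives along the curve determine all \<open>\<wp>\<^sub>i\<^sub>j(u)\<close> and \<open>\<wp>\<^sub>i\<^sub>j\<^sub>k(u)\<close> as polynomials
  in Mumford's coordinates, the coefficients of the polynomials in \<open>f = V\<^sup>2 + U W\<close> with
  \<open>U = \<Prod>(x - x\<^sub>k)\<close>. The coefficients of \<open>f\<close> are polynomials in these free coordinates as well, so each
  listed relation becomes a polynomial identity. It extends to all \<open>u\<close> because the Abel map is open and
  functions of \<open>u\<close> obey the identity theorem.

  Conversely, by means of the listed relations 24 of the 60 products can be removed from a bilinear relation.
  When the three points tend to infinity, the part of highest weight of what remains yields a linear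
  relation between the \<open>\<wp>\<close> functions of the cuspidal curve \<open>y\<^sup>2 = x\<^sup>7\<close>, which evaluation at
  finitely many points shows to be trivial.\<close>

section \<open>Holomorphic functions of three variables\<close>

text \<open>Klein's formula evaluates the functions at a sum of four points, the triple and
  \<open>P\<close>. One of the four has to be sent to infinity to return to three. Sending
  \<open>P\<close> there gives a cubic equation for the x_k, hence the functions with an index 3.
  Sending a point of the triple there, with \<open>P\<close> put in its old place, gives the values
  of the quadratic form at pairs of different points. Values at equal points are out of reach,
  because the formula requires x different from x_k; symmetry and the known entries with an index 3
  make up for them. The same happens one derivative higher. Near infinity x = 1/t^2 and y = h(t)/t^7
  with h even, so t -> -t is the hyperelliptic involution and turns the difference in Klein's
  formula into a sum. Scaling t by epsilon amounts to replacing lam j by epsilon^(14 - 2j) lam j,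
  which explains both the weights and the limit curve. Only odd weights from 3 to 25 occur, and
  after the reduction at most seven coefficients share a weight; hence the seven sample
  triples.\<close>

definition has_grad :: "(complex ^ 3 \<Rightarrow> complex) \<Rightarrow> (3 \<Rightarrow> complex) \<Rightarrow> complex ^ 3 \<Rightarrow> bool" where
  "has_grad f D u \<longleftrightarrow> (f has_derivative (\<lambda>h. \<Sum>i\<in>UNIV. D i * h $ i)) (at u)"

text \<open>The gradient is fixed to be \<open>pd\<close>, so that differentiability and the
  iterated derivatives inside \<open>wp\<close> speak of the same functions; by
  \<open>cdiff_onI\<close> any other gradient does as well.\<close>

definition cdiff_on :: "(complex ^ 3 \<Rightarrow> complex) \<Rightarrow> (complex ^ 3) set \<Rightarrow> bool" where
  "cdiff_on f S \<longleftrightarrow> (\<forall>u\<in>S. has_grad f (\<lambda>i. pd i f u) u)"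

lemma bounded_linear_vector_scale: "bounded_linear (\<lambda>z :: complex. z *s (d :: complex ^ 3))"
proof -
  have "linear (\<lambda>z :: complex. z *s d)"
    by (intro linearI) (simp_all add: vec_eq_iff algebra_simps)
  then show ?thesis by (rule linear_conv_bounded_linear[THEN iffD1])
qed

lemma has_grad_chain:
  assumes "has_grad f D (g a)" "(g has_derivative (\<lambda>z. z *s d)) (at a)"
  shows "((\<lambda>z. f (g z)) has_field_derivative (\<Sum>i\<in>UNIV. D i * d $ i)) (at a)"
proof -
  have "((\<lambda>z. f (g z)) has_derivative (\<lambda>z. \<Sum>i\<in>UNIV. D i * (z *s d) $ i)) (at a)"
    using has_derivative_compose[OF assms(2), of f "\<lambda>h. \<Sum>i\<in>UNIV. D i * h $ i"] assms(1)
    by (simp add: has_grad_def)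
  moreover have "(\<lambda>z. \<Sum>i\<in>UNIV. D i * (z *s d) $ i) = (*) (\<Sum>i\<in>UNIV. D i * d $ i)"
    by (simp add: fun_eq_iff sum_3 algebra_simps)
  ultimately show ?thesis by (simp add: has_field_derivative_def)
qed

lemma has_derivative_line: "((\<lambda>z. u + z *s (d :: complex ^ 3)) has_derivative (\<lambda>z. z *s d)) (at a)"
  using bounded_linear_imp_has_derivative[OF bounded_linear_vector_scale, of d]
  by (auto intro!: derivative_eq_intros)

lemma has_grad_line:
  assumes "has_grad f D (u + a *s d)"
  shows "((\<lambda>z. f (u + z *s d)) has_field_derivative (\<Sum>i\<in>UNIV. D i * d $ i)) (at a)"
  by (rule has_grad_chain[OF assms has_derivative_line])

lemma axis_scale: "axis i z = z *s (axis i 1 :: complex ^ 3)"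
  by (simp add: vec_eq_iff axis_def)

lemma has_grad_axis:
  assumes "has_grad f D (u + axis i a)"
  shows "((\<lambda>z. f (u + axis i z)) has_field_derivative D i) (at a)"
proof -
  have "(\<Sum>j\<in>UNIV. D j * (axis i 1 :: complex ^ 3) $ j) = D i"
    by (simp add: axis_def if_distrib cong: if_cong)
  with has_grad_line[of f D u a "axis i 1"] assms show ?thesis
    by (simp add: axis_scale[symmetric])
qed

lemma pd_eqI: "has_grad f D u \<Longrightarrow> pd i f u = D i"
  unfolding pd_def using has_grad_axis[of f D u i 0]
  by (simp add: DERIV_imp_deriv axis_def[of i 0] vec_eq_iff[of _ u] zero_vec_def[symmetric])

lemma cdiff_onI:
  assumes "\<And>u. u \<in> S \<Longrightarrow> has_grad f (D u) u"
  shows "cdiff_on f S"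
  unfolding cdiff_on_def
proof
  fix u assume "u \<in> S"
  then have "has_grad f (D u) u" by (rule assms)
  moreover from this have "(\<lambda>i. pd i f u) = D u" by (intro ext pd_eqI)
  ultimately show "has_grad f (\<lambda>i. pd i f u) u" by simp
qed

lemma cdiff_on_continuous: "cdiff_on f S \<Longrightarrow> continuous_on S f"
  unfolding cdiff_on_def has_grad_def
  by (meson continuous_at_imp_continuous_on has_derivative_continuous)

lemma entire_imp_cdiff_on:
  assumes "entire f"
  shows "cdiff_on f UNIV"
  unfolding cdiff_on_def
proof (intro ballI)
  fix u
  obtain D where D: "(f has_derivative D) (at u)" "Vector_Spaces.linear (*s) (*) D"
    using assms unfolding entire_def by blast
  interpret Vector_Spaces.linear "(*s)" "(*)" D by (rule D(2))
  have "D h = (\<Sum>i\<in>UNIV. D (axis i 1) * h $ i)" for h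
  proof -
    have "D h = D (\<Sum>i\<in>UNIV. (h $ i) *s axis i 1)" by (simp add: basis_expansion)
    also have "\<dots> = (\<Sum>i\<in>UNIV. D (axis i 1) * h $ i)"
      by (simp add: sum scale mult.commute)
    finally show ?thesis .
  qed
  then have "D = (\<lambda>h. \<Sum>i\<in>UNIV. D (axis i 1) * h $ i)" by blast
  then have "has_grad f (\<lambda>i. D (axis i 1)) u" using D(1) unfolding has_grad_def by simp
  then show "has_grad f (\<lambda>i. pd i f u) u" by (simp add: pd_eqI)
qed

lemma has_grad_mult:
  assumes "has_grad f D u" "has_grad g E u"
  shows "has_grad (\<lambda>u. f u * g u) (\<lambda>i. D i * g u + f u * E i) u"
  using has_derivative_mult[OF assms[unfolded has_grad_def]]
  unfolding has_grad_def
  by (simp add: sum_distrib_left sum_distrib_right sum.distrib algebra_simps)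

lemma has_grad_divide:
  assumes "has_grad f D u" "has_grad g E u" "g u \<noteq> 0"
  shows "has_grad (\<lambda>u. f u / g u) (\<lambda>i. (D i * g u - f u * E i) / (g u)\<^sup>2) u"
proof -
  have "((\<lambda>u. f u / g u) has_derivative
     (\<lambda>h. ((\<Sum>i\<in>UNIV. D i * h $ i) * g u - f u * (\<Sum>i\<in>UNIV. E i * h $ i)) / (g u * g u))) (at u)"
    by (rule has_derivative_divide'[OF assms[unfolded has_grad_def]])
  moreover have "((\<Sum>i\<in>UNIV. D i * h $ i) * g u - f u * (\<Sum>i\<in>UNIV. E i * h $ i)) / (g u * g u)
      = (\<Sum>i\<in>UNIV. (D i * g u - f u * E i) / (g u)\<^sup>2 * h $ i)" for h
    using assms(3) by (simp add: sum_3 power2_eq_square field_simps)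
  ultimately show ?thesis unfolding has_grad_def by simp
qed

lemma has_grad_uminus: "has_grad f D u \<Longrightarrow> has_grad (\<lambda>u. - f u) (\<lambda>i. - D i) u"
  unfolding has_grad_def sum_negf minus_mult_left[symmetric] by (rule has_derivative_minus)

lemma has_grad_const: "has_grad (\<lambda>u. c) (\<lambda>i. 0) u"
  by (simp add: has_grad_def)

lemma has_grad_add:
  "has_grad f D u \<Longrightarrow> has_grad g E u \<Longrightarrow> has_grad (\<lambda>u. f u + g u) (\<lambda>i. D i + E i) u"
  unfolding has_grad_def sum.distrib distrib_right by (rule has_derivative_add)

lemma cdiff_onD: "cdiff_on f S \<Longrightarrow> u \<in> S \<Longrightarrow> has_grad f (\<lambda>i. pd i f u) u"
  by (simp add: cdiff_on_def)

lemma cdiff_on_divide: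
  assumes "cdiff_on f S" "cdiff_on g S" "\<And>u. u \<in> S \<Longrightarrow> g u \<noteq> 0"
  shows "cdiff_on (\<lambda>u. f u / g u) S"
  by (rule cdiff_onI, rule has_grad_divide[OF cdiff_onD[OF assms(1)] cdiff_onD[OF assms(2)] assms(3)])

lemma cdiff_on_mult:
  assumes "cdiff_on f S" "cdiff_on g S"
  shows "cdiff_on (\<lambda>u. f u * g u) S"
  by (rule cdiff_onI, rule has_grad_mult[OF cdiff_onD[OF assms(1)] cdiff_onD[OF assms(2)]])

lemma cdiff_on_add:
  assumes "cdiff_on f S" "cdiff_on g S"
  shows "cdiff_on (\<lambda>u. f u + g u) S"
  by (rule cdiff_onI, rule has_grad_add[OF cdiff_onD[OF assms(1)] cdiff_onD[OF assms(2)]])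

lemma cdiff_on_const: "cdiff_on (\<lambda>u. c) S"
  by (rule cdiff_onI, rule has_grad_const)

lemma cdiff_on_uminus:
  assumes "cdiff_on f S"
  shows "cdiff_on (\<lambda>u. - f u) S"
  by (rule cdiff_onI, rule has_grad_uminus[OF cdiff_onD[OF assms]])

lemma cdiff_on_subset: "cdiff_on f T \<Longrightarrow> S \<subseteq> T \<Longrightarrow> cdiff_on f S"
  by (auto simp: cdiff_on_def)

lemma has_grad_cong:
  assumes "has_grad f D u" "open S" "u \<in> S" "\<And>v. v \<in> S \<Longrightarrow> g v = f v"
  shows "has_grad g D u"
  using assms has_derivative_transform_within_open[of f _ u UNIV S g]
  unfolding has_grad_def by simp

lemma pd_uminus: "cdiff_on f S \<Longrightarrow> u \<in> S \<Longrightarrow> pd i (\<lambda>v. - f v) u = - pd i f u"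
  by (rule pd_eqI[OF has_grad_uminus[OF cdiff_onD]])

section \<open>Cauchy's formula on circles and its consequences for partial derivatives\<close>

lemma norm_axis_complex: "norm (axis i z :: complex ^ 3) = norm z"
  by (simp add: norm_vec_def axis_def L2_set_def if_distrib[of norm] if_distrib[of "\<lambda>x. x ^ 2"]
      cong: if_cong)

definition circ :: "real \<Rightarrow> real \<Rightarrow> complex" where
  "circ r s = of_real r * exp (2 * of_real pi * \<i> * of_real s)"

lemma norm_circ [simp]: "r > 0 \<Longrightarrow> norm (circ r s) = r"
  by (simp add: circ_def norm_mult)

lemma circ_nonzero [simp]: "r > 0 \<Longrightarrow> circ r s \<noteq> 0"
  by (simp add: circ_def)

lemma deriv_eq_circle_mean:
  assumes "continuous_on (cball 0 r) g" "g holomorphic_on ball 0 r" "r > 0"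
  shows "deriv g 0 = integral {0..1} (\<lambda>s. g (circ r s) / circ r s)"
proof -
  have "2 * of_real pi * \<i> * deriv g 0 = contour_integral (circlepath 0 r) (\<lambda>u. g u / (u - 0)\<^sup>2)"
    using Cauchy_contour_integral_circlepath_2[OF assms(1,2), of 0] assms(3) by simp
  also have "\<dots> = integral {0..1} (\<lambda>s. 2 * of_real pi * \<i> * (g (circ r s) / circ r s))"
    unfolding contour_integral_integral
    unfolding vector_derivative_circlepath
    by (intro integral_cong) (simp add: circlepath circ_def power2_eq_square field_simps)
  also have "\<dots> = 2 * of_real pi * \<i> * integral {0..1} (\<lambda>s. g (circ r s) / circ r s)"
    by (simp only: integral_mult_right)
  finally show ?thesis by simp
qed

lemma cball_axis_subset:
  fixes u :: "complex ^ 3"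
  assumes "r > 0" "cball u r \<subseteq> S" "z \<in> cball 0 r"
  shows "u + axis i z \<in> S"
proof (rule subsetD[OF assms(2)])
  have "dist u (u + axis i z) = norm z"
    by (metis add_diff_cancel_left' dist_commute dist_norm norm_axis_complex)
  then show "u + axis i z \<in> cball u r" using assms(3) by simp
qed

text \<open>Cauchy's formula in the single variable \<open>u $ i\<close> expresses the derivative as
  an integral of \<open>f\<close> itself. Continuity and differentiability of \<open>pd i f\<close>
  can then be read off from the integral.\<close>

lemma pd_eq_circle_mean:
  assumes "cdiff_on f S" "cball u r \<subseteq> S" "r > 0"
  shows "pd i f u = integral {0..1} (\<lambda>s. f (u + axis i (circ r s)) / circ r s)"
proof -
  have deriv: "((\<lambda>z. f (u + axis i z)) has_field_derivative pd i f (u + axis i z)) (at z)"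
    if "z \<in> cball 0 r" for z
    by (rule has_grad_axis[OF cdiff_onD[OF assms(1) cball_axis_subset[OF assms(3,2) that]]])
  show ?thesis
    unfolding pd_def
  proof (rule deriv_eq_circle_mean[OF _ _ assms(3)])
    show "continuous_on (cball 0 r) (\<lambda>z. f (u + axis i z))"
      using deriv by (meson DERIV_isCont continuous_at_imp_continuous_on)
    show "(\<lambda>z. f (u + axis i z)) holomorphic_on ball 0 r"
      unfolding holomorphic_on_def using deriv
      by (meson ball_subset_cball field_differentiable_at_within field_differentiable_def subsetD)
  qed
qed

lemma continuous_axis: "continuous_on UNIV (\<lambda>z. axis i z :: complex ^ 3)"
proof -
  have "linear (\<lambda>z. axis i z :: complex ^ 3)"
    by (intro linearI) (simp_all add: vec_eq_iff axis_def)
  then show ?thesis by (simp add: linear_continuous_on linear_conv_bounded_linear)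
qed

lemma continuous_circle_mean_integrand:
  fixes f :: "complex ^ 3 \<Rightarrow> complex"
  assumes "continuous_on S f" "\<And>u. u \<in> U \<Longrightarrow> cball u r \<subseteq> S" "r > 0"
  shows "continuous_on (U \<times> cbox 0 1) (\<lambda>(u, s). f (u + axis i (circ r s)) / circ r s)"
proof -
  have circ: "continuous_on T (\<lambda>x. circ r (snd x))" for T :: "((complex ^ 3) \<times> real) set"
    unfolding circ_def by (intro continuous_intros)
  have axis: "continuous_on T (\<lambda>x. axis i (circ r (snd x)) :: complex ^ 3)" for T :: "((complex ^ 3) \<times>
      real) set"
    by (rule continuous_on_compose2[OF continuous_axis circ subset_UNIV])
  show ?thesis
    unfolding case_prod_beta
  proof (intro continuous_on_divide circ)
    show "continuous_on (U \<times> cbox 0 1) (\<lambda>x. f (fst x + axis i (circ r (snd x))))"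
    proof (rule continuous_on_compose2[OF assms(1)])
      show "continuous_on (U \<times> cbox 0 1) (\<lambda>x. fst x + axis i (circ r (snd x)))"
        by (intro continuous_on_add continuous_on_fst continuous_on_id axis)
    qed (use assms(2,3) cball_axis_subset[OF assms(3)] in auto)
  qed (use assms(3) in auto)
qed

text \<open>One radius serves all centres near \<open>u\<close>, as is needed to vary the centre
  under the integral sign.\<close>

lemma open_contains_uniform_cball:
  fixes u :: "complex ^ 3"
  assumes "open S" "u \<in> S"
  obtains r where "r > 0" "\<And>v. v \<in> ball u r \<Longrightarrow> cball v r \<subseteq> S"
proof -
  obtain e where e: "e > 0" "ball u e \<subseteq> S"
    using assms open_contains_ball by blast
  have "cball v (e / 2) \<subseteq> S" if "v \<in> ball u (e / 2)" for v
  proof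
    fix x assume "x \<in> cball v (e / 2)"
    then have "dist u x < e" using that dist_triangle[of u x v] by simp
    then show "x \<in> S" using e by auto
  qed
  then show ?thesis using that[of "e / 2"] e by simp
qed

lemma continuous_on_pd:
  assumes "cdiff_on f S" "open S"
  shows "continuous_on S (pd i f)"
  unfolding continuous_on_eq_continuous_at[OF assms(2)]
proof
  fix u assume "u \<in> S"
  then obtain r where r: "r > 0" "\<And>v. v \<in> ball u r \<Longrightarrow> cball v r \<subseteq> S"
    using open_contains_uniform_cball[OF assms(2)] by blast
  have cont: "continuous_on (ball u r) (\<lambda>v. integral (cbox 0 1) (\<lambda>s. f (v + axis i (circ r s)) / circ r s))"
    by (rule integral_continuous_on_param)
      (rule continuous_circle_mean_integrand[OF cdiff_on_continuous[OF assms(1)] r(2,1)])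
  have "continuous_on (ball u r) (pd i f)"
    by (rule continuous_on_eq[OF cont]) (use pd_eq_circle_mean[OF assms(1) r(2) r(1)] in simp)
  then show "isCont (pd i f) u"
    using r(1) by (simp add: continuous_on_eq_continuous_at)
qed

text \<open>Differentiation of Cauchy's formula under the integral sign.\<close>

lemma has_grad_pd_circle_mean:
  assumes "cdiff_on f S" "open S" "r > 0" "\<And>v. v \<in> ball u r \<Longrightarrow> cball v r \<subseteq> S"
  shows "has_grad (pd i f) (\<lambda>j. integral {0..1} (\<lambda>s. pd j f (u + axis i (circ r s)) / circ r s)) u"
proof -
  note r = assms(3,4)
  \<comment> \<open>\<open>leibniz_rule\<close> wants the derivative of the integrand as an element
    of the space of bounded linear maps that depends continuously on the centre and on the parameter
    of the circle.\<close>
  define L where "L v s = Blinfun (\<lambda>h. \<Sum>j\<in>UNIV. pd j f (v + axis i (circ r s)) / circ r s * h $ j)" for v s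
  have bl: "bounded_linear (\<lambda>h :: complex ^ 3. \<Sum>j\<in>UNIV. c j * h $ j)" for c :: "3 \<Rightarrow> complex"
    by (intro bounded_linear_sum bounded_linear_const_mult bounded_linear_vec_nth)
  have L: "blinfun_apply (L v s) h = (\<Sum>j\<in>UNIV. pd j f (v + axis i (circ r s)) / circ r s * h $ j)" for v s h
    unfolding L_def by (rule bounded_linear_Blinfun_apply[OF bl, THEN fun_cong])
  have cont: "continuous_on (ball u r \<times> cbox 0 1) (\<lambda>(v, s). pd j f (v + axis i (circ r s)) / circ r s)" for j
    by (rule continuous_circle_mean_integrand[OF continuous_on_pd[OF assms(1,2)] r(2,1)])
  have sec: "continuous_on {0..1} (\<lambda>s. g (v + axis i (circ r s)) / circ r s)"
    if "v \<in> ball u r" "continuous_on S g" for v and g :: "complex ^ 3 \<Rightarrow> complex"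
  proof -
    have "continuous_on {0..1} (\<lambda>s. case (v, s) of (u, s) \<Rightarrow> g (u + axis i (circ r s)) / circ r s)"
      by (rule continuous_on_compose2[OF continuous_circle_mean_integrand
            [where U = "ball u r", OF that(2) r(2) r(1)]])
        (use that(1) in \<open>auto intro!: continuous_intros\<close>)
    then show ?thesis by simp
  qed
  have contL: "continuous_on (ball u r \<times> cbox 0 1) (\<lambda>(v, s). L v s)"
  proof (rule continuous_on_blinfun_componentwise)
    fix b :: "complex ^ 3"
    have "continuous_on (ball u r \<times> cbox 0 1)
        (\<lambda>x. \<Sum>j\<in>UNIV. (case x of (v, s) \<Rightarrow> pd j f (v + axis i (circ r s)) / circ r s) * b $ j)"
      by (intro continuous_intros cont)
    then show "continuous_on (ball u r \<times> cbox 0 1) (\<lambda>x. blinfun_apply (case x of (v, s) \<Rightarrow> L v s) b)"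
      by (simp add: case_prod_beta L)
  qed
  have "((\<lambda>v. integral (cbox 0 1) (\<lambda>s. f (v + axis i (circ r s)) / circ r s)) has_derivative
      integral (cbox 0 1) (L u)) (at u within ball u r)"
  proof (rule leibniz_rule)
    fix v and s :: real assume v: "v \<in> ball u r" "s \<in> cbox 0 1"
    have "has_grad f (\<lambda>j. pd j f (v + axis i (circ r s))) (v + axis i (circ r s))"
      using r by (intro cdiff_onD[OF assms(1)] cball_axis_subset[OF r(1) r(2)[OF v(1)]]) simp
    then have "((\<lambda>x. f (x + axis i (circ r s))) has_derivative
        (\<lambda>h. \<Sum>j\<in>UNIV. pd j f (v + axis i (circ r s)) * h $ j)) (at v)"
      unfolding has_grad_def
      by (rule has_derivative_compose[rotated]) (auto intro!: derivative_eq_intros)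
    then have "((\<lambda>x. f (x + axis i (circ r s)) / circ r s) has_derivative blinfun_apply (L v s)) (at v)"
      using r(1) by (auto simp: L fun_eq_iff sum_divide_distrib intro!: derivative_eq_intros)
    then show "((\<lambda>x. f (x + axis i (circ r s)) / circ r s) has_derivative blinfun_apply (L v s))
        (at v within ball u r)"
      by (rule has_derivative_at_withinI)
  next
    fix v assume "v \<in> ball u r"
    then show "(\<lambda>s. f (v + axis i (circ r s)) / circ r s) integrable_on cbox 0 1"
      using sec[OF _ cdiff_on_continuous[OF assms(1)]] by (intro integrable_continuous) simp
  next
    show "continuous_on (ball u r \<times> cbox 0 1) (\<lambda>(v, s). L v s)" by (rule contL)
  qed (use r(1) in auto)
  then have "((\<lambda>v. integral (cbox 0 1) (\<lambda>s. f (v + axis i (circ r s)) / circ r s)) has_derivative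
      integral (cbox 0 1) (L u)) (at u)"
    using r(1) by (simp add: at_within_open[of _ "ball u r"])
  then have der: "(pd i f has_derivative integral (cbox 0 1) (L u)) (at u)"
  proof (rule has_derivative_transform_within_open)
    show "integral (cbox 0 1) (\<lambda>s. f (v + axis i (circ r s)) / circ r s) = pd i f v"
      if "v \<in> ball u r" for v
      using pd_eq_circle_mean[OF assms(1) r(2)[OF that] r(1)] by simp
  qed (use r(1) in auto)
  have eq: "blinfun_apply (integral (cbox 0 1) (L u)) h =
      (\<Sum>j\<in>UNIV. integral {0..1} (\<lambda>s. pd j f (u + axis i (circ r s)) / circ r s) * h $ j)" for h
  proof -
    have "continuous_on (cbox 0 1) (L u)"
    proof -
      have "continuous_on (cbox 0 1) (\<lambda>s. case (u, s) of (v, s) \<Rightarrow> L v s)"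
        by (rule continuous_on_compose2[OF contL]) (use r(1) in \<open>auto intro!: continuous_intros\<close>)
      then show ?thesis by simp
    qed
    then have "blinfun_apply (integral (cbox 0 1) (L u)) h = integral {0..1} (\<lambda>s. blinfun_apply (L u s) h)"
      using blinfun_apply_integral[OF integrable_continuous] by fastforce
    also have "\<dots> = (\<Sum>j\<in>UNIV. integral {0..1} (\<lambda>s. pd j f (u + axis i (circ r s)) / circ r s * h $ j))"
      unfolding L using r(1)
      by (intro integral_sum integrable_continuous_interval continuous_intros
          sec[OF _ continuous_on_pd[OF assms(1,2)]]) auto
    finally show ?thesis by (simp only: integral_mult_left)
  qed
  from der show ?thesis unfolding has_grad_def eq[abs_def] .
qed

lemma cdiff_on_pd:
  assumes "cdiff_on f S" "open S"
  shows "cdiff_on (pd i f) S"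
  unfolding cdiff_on_def
proof
  fix u assume "u \<in> S"
  then obtain r where r: "r > 0" "\<And>v. v \<in> ball u r \<Longrightarrow> cball v r \<subseteq> S"
    using open_contains_uniform_cball[OF assms(2)] by blast
  have "has_grad (pd i f) (\<lambda>j. integral {0..1} (\<lambda>s. pd j f (u + axis i (circ r s)) / circ r s)) u"
    by (rule has_grad_pd_circle_mean[OF assms r])
  then show "has_grad (pd i f) (\<lambda>j. pd j (pd i f) u) u" by (simp add: pd_eqI)
qed

text \<open>Both orders equal the mean of \<open>pd j f\<close> over a circle in direction
  \<open>i\<close>: one by differentiation under the integral sign, the other by Cauchy's formula
  for \<open>pd j f\<close>.\<close>

lemma pd_commute:
  assumes "cdiff_on f S" "open S" "u \<in> S"
  shows "pd i (pd j f) u = pd j (pd i f) u"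
proof -
  obtain r where r: "r > 0" "\<And>v. v \<in> ball u r \<Longrightarrow> cball v r \<subseteq> S"
    using open_contains_uniform_cball[OF assms(2,3)] by blast
  have "pd j (pd i f) u = integral {0..1} (\<lambda>s. pd j f (u + axis i (circ r s)) / circ r s)"
    by (rule pd_eqI[OF has_grad_pd_circle_mean[OF assms(1,2) r]])
  also have "\<dots> = pd i (pd j f) u"
    using r by (intro pd_eq_circle_mean[symmetric, OF cdiff_on_pd[OF assms(1,2)]]) auto
  finally show ?thesis by simp
qed

lemma cdiff_on_line_holomorphic:
  assumes "cdiff_on f S"
  shows "(\<lambda>z. f (u + z *s d)) holomorphic_on {z. u + z *s d \<in> S}"
  unfolding holomorphic_on_def field_differentiable_def
  using has_grad_line[OF cdiff_onD[OF assms]] has_field_derivative_at_within by blast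

lemma continuous_line: "continuous_on T (\<lambda>z. u + z *s (d :: complex ^ 3))"
  by (rule has_derivative_continuous_on) (rule has_derivative_at_withinI[OF has_derivative_line])

text \<open>On the complex line from a point of \<open>B\<close> to \<open>u\<close> the zeros of
  \<sigma> are countable. Their complement is therefore connected, and continuation in one variable
  carries \<open>f = 0\<close> from \<open>B\<close> to \<open>u\<close>.\<close>

lemma identity_theorem_nonzero_set:
  assumes \<sigma>: "cdiff_on \<sigma> UNIV" and f: "cdiff_on f {u. \<sigma> u \<noteq> 0}"
    and B: "open B" "B \<noteq> {}" "B \<subseteq> {u. \<sigma> u \<noteq> 0}" "\<And>u. u \<in> B \<Longrightarrow> f u = 0"
    and u: "\<sigma> u \<noteq> 0"
  shows "f u = 0"
proof -
  obtain b where b: "b \<in> B" using B(2) by blast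
  define d where "d = u - b"
  define g where "g z = \<sigma> (b + z *s d)" for z
  have g: "g holomorphic_on UNIV"
    using cdiff_on_line_holomorphic[OF \<sigma>, of b d] by (simp add: g_def[abs_def])
  have g0: "g 0 \<noteq> 0" using b B(3) by (auto simp: g_def)
  define T where "T = {z. g z = 0}"
  have "countable T"
  proof (cases "g constant_on UNIV")
    case True
    then have "g z = g 0" for z unfolding constant_on_def by (metis UNIV_I)
    then have "T = {}" using g0 by (metis (mono_tags, lifting) T_def empty_Collect_eq)
    then show ?thesis by simp
  next
    case False
    then show ?thesis
      using holomorphic_countable_zeros[OF g open_UNIV connected_UNIV] by (simp add: T_def)
  qed
  then have conn: "connected (UNIV - T)"
    by (intro connected_open_diff_countable) auto
  have "closed T" unfolding T_def
    by (intro closed_Collect_eq continuous_intros holomorphic_on_imp_continuous_on[OF g])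
  then have "open (UNIV - T)" by (intro open_Diff open_UNIV)
  define V where "V = {z. b + z *s d \<in> B}"
  have V: "open V"
    using open_vimage[OF B(1) continuous_line[of UNIV b d]] by (simp add: V_def vimage_def)
  have "f (b + 1 *s d) = 0"
  proof (rule analytic_continuation_open[OF V \<open>open (UNIV - T)\<close> _ conn, where f = "\<lambda>z. f (b + z *s d)"
      and g = "\<lambda>_. 0"])
    show "V \<noteq> {}" using b by (auto simp: V_def intro: exI[of _ 0])
    show "V \<subseteq> UNIV - T" using B(3) by (auto simp: V_def T_def g_def)
    show "(\<lambda>z. f (b + z *s d)) holomorphic_on UNIV - T"
      using cdiff_on_line_holomorphic[OF f, of b d]
      by (rule holomorphic_on_subset) (auto simp: T_def g_def)
    show "1 \<in> UNIV - T" using u by (simp add: T_def g_def d_def)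
  qed (use B(4) in \<open>auto simp: V_def\<close>)
  then show ?thesis by (simp add: d_def)
qed

section \<open>Symmetry and derivatives of the 2- and 3-index functions\<close>

lemma wp2_eq: "wp \<sigma> [i, j] = (\<lambda>u. - pd i (\<lambda>v. pd j \<sigma> v / \<sigma> v) u)"
  and wp3_eq: "wp \<sigma> [i, j, k] = (\<lambda>u. - pd i (pd j (\<lambda>v. pd k \<sigma> v / \<sigma> v)) u)"
  by (simp_all add: wp_def fun_eq_iff)

lemma open_nonzero_set: "cdiff_on \<sigma> UNIV \<Longrightarrow> open {u. \<sigma> u \<noteq> 0}"
  using open_Collect_neq[of \<sigma> "\<lambda>_. 0"] cdiff_on_continuous[of \<sigma> UNIV] by simp

lemma cdiff_on_logderiv:
  assumes "cdiff_on \<sigma> UNIV"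
  shows "cdiff_on (\<lambda>v. pd j \<sigma> v / \<sigma> v) {u. \<sigma> u \<noteq> 0}"
  by (rule cdiff_on_divide)
    (auto intro: cdiff_on_subset[OF assms] cdiff_on_subset[OF cdiff_on_pd[OF assms open_UNIV]])

lemma cdiff_on_wp2:
  assumes "cdiff_on \<sigma> UNIV"
  shows "cdiff_on (wp \<sigma> [i, j]) {u. \<sigma> u \<noteq> 0}"
  unfolding wp2_eq
  by (intro cdiff_on_uminus cdiff_on_pd cdiff_on_logderiv open_nonzero_set assms)

lemma cdiff_on_wp3:
  assumes "cdiff_on \<sigma> UNIV"
  shows "cdiff_on (wp \<sigma> [i, j, k]) {u. \<sigma> u \<noteq> 0}"
  unfolding wp3_eq
  by (intro cdiff_on_uminus cdiff_on_pd cdiff_on_logderiv open_nonzero_set assms)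

lemma pd_wp2:
  assumes "cdiff_on \<sigma> UNIV" "\<sigma> u \<noteq> 0"
  shows "pd k (wp \<sigma> [i, j]) u = wp \<sigma> [k, i, j] u"
  unfolding wp2_eq wp3_eq
  by (rule pd_uminus[OF cdiff_on_pd[OF cdiff_on_logderiv[OF assms(1)] open_nonzero_set[OF assms(1)]]])
    (use assms(2) in simp)

lemma has_grad_wp2:
  assumes "cdiff_on \<sigma> UNIV" "\<sigma> u \<noteq> 0"
  shows "has_grad (wp \<sigma> [i, j]) (\<lambda>k. wp \<sigma> [k, i, j] u) u"
  using cdiff_onD[OF cdiff_on_wp2[OF assms(1)], of u i j] assms by (simp add: pd_wp2)

lemma wp2_commute:
  assumes "cdiff_on \<sigma> UNIV" "\<sigma> u \<noteq> 0"
  shows "wp \<sigma> [i, j] u = wp \<sigma> [j, i] u"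
proof -
  have "has_grad (\<lambda>v. pd j \<sigma> v / \<sigma> v)
      (\<lambda>i. (pd i (pd j \<sigma>) u * \<sigma> u - pd j \<sigma> u * pd i \<sigma> u) / (\<sigma> u)\<^sup>2) u" for j
    by (intro has_grad_divide cdiff_onD[of _ UNIV] cdiff_on_pd assms open_UNIV UNIV_I)
  from pd_eqI[OF this] have "wp \<sigma> [i, j] u = - ((pd i (pd j \<sigma>) u * \<sigma> u - pd j \<sigma> u * pd i \<sigma> u) / (\<sigma>
      u)\<^sup>2)" for i j
    by (simp add: wp2_eq)
  then show ?thesis
    using pd_commute[OF assms(1), of u i j] by (simp add: mult.commute)
qed

lemma wp3_commute12:
  assumes "cdiff_on \<sigma> UNIV" "\<sigma> u \<noteq> 0"
  shows "wp \<sigma> [i, j, k] u = wp \<sigma> [j, i, k] u"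
  unfolding wp3_eq
  using pd_commute[OF cdiff_on_logderiv[OF assms(1)] open_nonzero_set[OF assms(1)], of u i j] assms(2)
  by simp

text \<open>This is the gradient of the identity \<open>wp2_commute\<close>, which holds on the open
  set where \<sigma> does not vanish.\<close>

lemma wp3_commute23:
  assumes "cdiff_on \<sigma> UNIV" "\<sigma> u \<noteq> 0"
  shows "wp \<sigma> [i, j, k] u = wp \<sigma> [i, k, j] u"
proof -
  have "has_grad (wp \<sigma> [k, j]) (\<lambda>i. wp \<sigma> [i, j, k] u) u"
    by (rule has_grad_cong[OF has_grad_wp2[OF assms] open_nonzero_set[OF assms(1)]])
      (use assms in \<open>auto intro: wp2_commute\<close>)
  from pd_eqI[OF this, of i] show ?thesis by (simp add: pd_wp2[OF assms])
qed

section \<open>The curve near infinity\<close>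

lemma has_derivative_vecI:
  fixes f :: "'a :: real_normed_vector \<Rightarrow> complex ^ 3"
  assumes "\<And>i. ((\<lambda>x. f x $ i) has_derivative (\<lambda>h. f' h $ i)) (at a within S)"
  shows "(f has_derivative f') (at a within S)"
proof -
  have bl: "bounded_linear (axis i :: complex \<Rightarrow> complex ^ 3)" for i
  proof -
    have "linear (axis i :: complex \<Rightarrow> complex ^ 3)"
      by (intro linearI) (simp_all add: vec_eq_iff axis_def)
    then show ?thesis by (simp add: linear_conv_bounded_linear)
  qed
  have expand: "v = (\<Sum>i\<in>UNIV. axis i (v $ i))" for v :: "complex ^ 3"
    by (simp add: vec_eq_iff axis_def)
  have "((\<lambda>x. \<Sum>i\<in>UNIV. axis i (f x $ i)) has_derivative (\<lambda>h. \<Sum>i\<in>UNIV. axis i (f' h $ i))) (at a within S)"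
    by (intro has_derivative_sum bounded_linear.has_derivative[OF bl] assms)
  then show ?thesis by (simp flip: expand)
qed

text \<open>In the coordinates \<open>s = t\<^sup>2\<close>, \<open>w = t * h t\<close> the curve near infinity is parametrised by \<open>t\<close>, with
  \<open>h\<close> even and \<open>(h t)\<^sup>2 = inf_radicand lam t\<close>.\<close>

definition inf_radicand :: "(nat \<Rightarrow> complex) \<Rightarrow> complex \<Rightarrow> complex" where
  "inf_radicand lam t = (\<Sum>j\<le>7. lam j * (t\<^sup>2) ^ (7 - j))"

lemma poly_curve_poly_inf: "poly (curve_poly_inf lam) (t\<^sup>2) = t\<^sup>2 * inf_radicand lam t"
proof -
  have "poly (curve_poly_inf lam) (t\<^sup>2) = (\<Sum>j\<le>7. lam j * (t\<^sup>2) ^ (8 - j))"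
    by (simp add: curve_poly_inf_def poly_sum poly_monom)
  also have "\<dots> = (\<Sum>j\<le>7. t\<^sup>2 * (lam j * (t\<^sup>2) ^ (7 - j)))"
  proof (intro sum.cong refl)
    fix j :: nat assume "j \<in> {..7}"
    then have "8 - j = Suc (7 - j)" by auto
    then show "lam j * (t\<^sup>2) ^ (8 - j) = t\<^sup>2 * (lam j * (t\<^sup>2) ^ (7 - j))" by simp
  qed
  finally show ?thesis by (simp add: inf_radicand_def sum_distrib_left)
qed

text \<open>The radicand is 1 at 0, so near 0 its values stay in the right half-plane, where the
  principal root is holomorphic. The root is even because the radicand depends on
  \<open>t\<^sup>2\<close> only.\<close>

lemma inf_sqrt_exists:
  assumes "lam 7 = 1"
  obtains \<rho> h where "\<rho> > 0" "h holomorphic_on ball 0 \<rho>" "h 0 = 1"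
    "\<And>t. t \<in> ball 0 \<rho> \<Longrightarrow> h t \<noteq> 0" "\<And>t. h (- t) = h t"
    "\<And>t. (h t)\<^sup>2 = inf_radicand lam t"
proof -
  let ?Q = "inf_radicand lam"
  have Q0: "?Q 0 = 1"
    by (simp add: inf_radicand_def power_0_left if_distrib[of "(*) _"] assms cong: if_cong)
  have hol: "?Q holomorphic_on UNIV"
    unfolding inf_radicand_def by (intro holomorphic_intros)
  then have "isCont ?Q 0"
    by (intro continuous_on_interior[of UNIV] holomorphic_on_imp_continuous_on) simp_all
  then obtain \<rho> where \<rho>: "\<rho> > 0" "\<And>t. dist t 0 < \<rho> \<Longrightarrow> dist (?Q t) (?Q 0) < 1"
    unfolding continuous_at_eps_delta by (metis zero_less_one)
  have pos: "?Q t \<notin> \<real>\<^sub>\<le>\<^sub>0" if "t \<in> ball 0 \<rho>" for t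
  proof
    assume "?Q t \<in> \<real>\<^sub>\<le>\<^sub>0"
    then have "Re (?Q t - 1) \<le> -1" by (simp add: complex_nonpos_Reals_iff)
    moreover have "\<bar>Re (?Q t - 1)\<bar> < 1"
      using \<rho>(2)[of t] that abs_Re_le_cmod[of "?Q t - 1"] by (simp add: Q0 dist_norm)
    ultimately show False by linarith
  qed
  show ?thesis
  proof (rule that[of \<rho> "\<lambda>t. csqrt (?Q t)"])
    show "(\<lambda>t. csqrt (?Q t)) holomorphic_on ball 0 \<rho>"
      by (intro holomorphic_on_csqrt' holomorphic_on_subset[OF hol] pos) auto
    show "csqrt (?Q t) \<noteq> 0" if "t \<in> ball 0 \<rho>" for t
      using pos[OF that] by auto
    show "csqrt (?Q (- t)) = csqrt (?Q t)" for t by (simp add: inf_radicand_def)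
  qed (simp_all add: \<rho>(1) Q0)
qed

text \<open>The constant of integration matters: only the odd primitive makes the Abelian integral
  change sign under the hyperelliptic involution t -> -t.\<close>

lemma even_primitive_odd:
  assumes "\<rho> > 0" "f holomorphic_on ball 0 \<rho>" "\<And>t. f (- t) = f t"
  obtains F where "\<And>t. t \<in> ball 0 \<rho> \<Longrightarrow> (F has_field_derivative f t) (at t)"
    "\<And>t. t \<in> ball 0 \<rho> \<Longrightarrow> F (- t) = - F t"
proof -
  obtain G where G': "\<And>t. t \<in> ball 0 \<rho> \<Longrightarrow> (G has_field_derivative f t) (at t within ball 0 \<rho>)"
    using holomorphic_convex_primitive'[OF convex_ball open_ball assms(2)] by blast
  have G: "(G has_field_derivative f t) (at t)" if "t \<in> ball 0 \<rho>" for t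
    using G'[OF that] that by (simp add: at_within_open[of _ "ball 0 \<rho>"])
  have "((\<lambda>t. G t + G (- t)) has_field_derivative 0) (at t)" if "t \<in> ball 0 \<rho>" for t
  proof -
    have "((\<lambda>t. G (- t)) has_field_derivative f (- t) * (- 1)) (at t)"
      by (rule DERIV_chain2[OF G]) (use that in \<open>auto intro!: derivative_eq_intros\<close>)
    from DERIV_add[OF G[OF that] this] show ?thesis by (simp add: assms(3))
  qed
  then have "\<exists>c. \<forall>t\<in>ball 0 \<rho>. G t + G (- t) = c"
    by (intro has_field_derivative_zero_constant) (auto intro: has_field_derivative_at_within)
  then obtain c where c: "\<And>t. t \<in> ball 0 \<rho> \<Longrightarrow> G t + G (- t) = c" by blast
  then have "c = 2 * G 0" using c[of 0] assms(1) by simp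
  show ?thesis
  proof (rule that[of "\<lambda>t. G t - G 0"])
    show "((\<lambda>t. G t - G 0) has_field_derivative f t) (at t)" if "t \<in> ball 0 \<rho>" for t
      using DERIV_diff[OF G[OF that] DERIV_const[of "G 0"]] by simp
    show "G (- t) - G 0 = - (G t - G 0)" if "t \<in> ball 0 \<rho>" for t
      using c[OF that] \<open>c = 2 * G 0\<close> by (simp add: algebra_simps)
  qed
qed

text \<open>Along the image of the segment from 0 to \<open>t\<close>, the form ds/(2w) with s = t^2
  and w = t h(t) becomes dt/h(t), so the primitive \<open>A\<close> computes the integral.\<close>

lemma abelian_integral_near_inf:
  assumes "lam 7 = 1" "h holomorphic_on ball 0 \<rho>"
    and hnz: "\<And>t. t \<in> ball 0 \<rho> \<Longrightarrow> h t \<noteq> 0" and h2: "\<And>t. (h t)\<^sup>2 = inf_radicand lam t"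
    and A: "\<And>t i. t \<in> ball 0 \<rho> \<Longrightarrow>
      ((\<lambda>t. A t $ i) has_field_derivative (- 1 / h t * (vector [t ^ 4, t\<^sup>2, 1] :: complex ^ 3) $ i)) (at t)"
    and "A 0 = 0" and t: "t \<in> ball 0 \<rho>" "t \<noteq> 0"
  shows "abelian_integral lam None (Some (1 / t\<^sup>2, h t / t ^ 7)) (A t)"
proof -
  define g where "g r = ((of_real r * t)\<^sup>2, of_real r * t * h (of_real r * t))" for r :: real
  define D where "D r = (2 * of_real r * t\<^sup>2, t * h (of_real r * t) + of_real r * t\<^sup>2 * deriv h (of_real
      r * t))"
    for r :: real
  have in_ball: "of_real r * t \<in> ball 0 \<rho>" if "r \<in> {0..1}" for r :: real
  proof -
    have "norm (of_real r * t) \<le> norm t"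
      using that by (simp add: norm_mult mult_left_le_one_le)
    then show ?thesis using t by simp
  qed
  have dh: "(h has_field_derivative deriv h z) (at z)" if "z \<in> ball 0 \<rho>" for z
    using assms(2) that by (simp add: holomorphic_derivI)
  have dg: "(g has_vector_derivative D r) (at r)" if "r \<in> {0..1}" for r
  proof -
    have "((\<lambda>z. h (z * t)) has_field_derivative deriv h (of_real r * t) * t) (at (of_real r))"
      by (rule DERIV_chain2[where f = h]) (use dh[OF in_ball[OF that]] in \<open>auto intro!: derivative_eq_intros\<close>)
    then have "((\<lambda>z. z * t * h (z * t)) has_field_derivative snd (D r)) (at (of_real r))"
      unfolding D_def by (auto intro!: derivative_eq_intros simp: power2_eq_square algebra_simps)
    moreover have "((\<lambda>z. (z * t)\<^sup>2) has_field_derivative fst (D r)) (at (of_real r))"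
      unfolding D_def by (auto intro!: derivative_eq_intros simp: power2_eq_square algebra_simps)
    ultimately show ?thesis
      unfolding g_def by (subst prod.collapse[symmetric])
        (intro has_vector_derivative_Pair has_vector_derivative_real_field)
  qed
  have contD: "continuous_on {0..1} D"
  proof -
    have "continuous_on {0..1} (\<lambda>r. h (of_real r * t))" "continuous_on {0..1} (\<lambda>r. deriv h (of_real r * t))"
      using in_ball
      by (auto intro!: continuous_intros holomorphic_on_imp_continuous_on holomorphic_deriv assms(2)
          continuous_on_compose2[of "ball 0 \<rho>" _ _ "\<lambda>r. of_real r * t"] simp del: mem_ball)
    then show ?thesis unfolding D_def by (intro continuous_intros)
  qed
  have vp: "valid_path g"
    unfolding valid_path_def
    using dg contD by (intro C1_differentiable_imp_piecewise) (metis C1_differentiable_on_def)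
  have image: "path_image g \<subseteq> plane_curve (curve_poly_inf lam)"
  proof -
    have "(z * h z)\<^sup>2 = poly (curve_poly_inf lam) (z\<^sup>2)" for z
      by (simp add: poly_curve_poly_inf power_mult_distrib h2)
    then show ?thesis by (auto simp: path_image_def plane_curve_def g_def)
  qed
  have integrand: "((\<lambda>r. (t / h (of_real r * t)) *s vector [(of_real r * t) ^ 4, (of_real r * t)\<^sup>2, 1])
      has_integral - A t) {0..1}"
  proof -
    have deriv: "((\<lambda>r. - A (of_real r * t)) has_vector_derivative
        (t / h (of_real r * t)) *s vector [(of_real r * t) ^ 4, (of_real r * t)\<^sup>2, 1]) (at r)"
      if "r \<in> {0..1}" for r
      unfolding has_vector_derivative_def
    proof (rule has_derivative_vecI)
      fix i :: 3
      have "((\<lambda>z. A (z * t) $ i) has_field_derivative (- 1 / h (of_real r * t) *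
          (vector [(of_real r * t) ^ 4, (of_real r * t)\<^sup>2, 1] :: complex ^ 3) $ i) * t) (at (of_real r))"
        by (rule DERIV_chain2[where f = "\<lambda>z. A z $ i"])
          (use A[OF in_ball[OF that]] in \<open>auto intro!: derivative_eq_intros\<close>)
      from has_vector_derivative_real_field[OF DERIV_minus[OF this]]
      show "((\<lambda>r. (- A (of_real r * t)) $ i) has_derivative
          (\<lambda>x. (x *\<^sub>R ((t / h (of_real r * t)) *s vector [(of_real r * t) ^ 4, (of_real r * t)\<^sup>2, 1])) $
              i)) (at r)"
        by (simp add: has_vector_derivative_def mult.commute)
    qed
    have "((\<lambda>r. (t / h (of_real r * t)) *s vector [(of_real r * t) ^ 4, (of_real r * t)\<^sup>2, 1])
        has_integral - A (of_real 1 * t) - - A (of_real 0 * t)) {0..1}"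
      by (rule fundamental_theorem_of_calculus[OF zero_le_one has_vector_derivative_at_within[OF deriv]])
    then show ?thesis using \<open>A 0 = 0\<close> by simp
  qed
  have "((\<lambda>r. pullback_form (curve_poly_inf lam) g r *s vector [(fst (g r))\<^sup>2, fst (g r), 1])
      has_integral - A t) {0..1}"
  \<comment> \<open>At \<open>r = 0\<close> the path starts in the branch point w = 0, where
    \<open>pullback_form\<close> switches to its other expression. A single point does not affect
    the integral.\<close>
  proof (rule has_integral_spike_finite[OF _ _ integrand])
    show "finite {0 :: real}" by simp
    fix r :: real assume r: "r \<in> {0..1} - {0}"
    have "vector_derivative g (at r within {0..1}) = D r"
      by (rule vector_derivative_at_within_ivl[OF dg]) (use r in auto)
    moreover have "h (of_real r * t) \<noteq> 0" using hnz[OF in_ball] r by auto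
    ultimately have "pullback_form (curve_poly_inf lam) g r = t / h (of_real r * t)"
      using r t(2) by (simp add: pullback_form_def g_def D_def power2_eq_square)
    then show "pullback_form (curve_poly_inf lam) g r *s vector [(fst (g r))\<^sup>2, fst (g r), 1] =
        (t / h (of_real r * t)) *s vector [(of_real r * t) ^ 4, (of_real r * t)\<^sup>2, 1]"
      by (simp add: g_def flip: power_mult)
  qed
  then have int: "integral_inf lam g = A t"
    by (simp add: integral_inf_def integral_unique)
  have "point_of_inf_chart (pathstart g) = None"
    by (simp add: pathstart_def g_def)
  moreover have "point_of_inf_chart (pathfinish g) = Some (1 / t\<^sup>2, h t / t ^ 7)"
    using t(2) by (simp add: pathfinish_def g_def power_numeral_reduce)
  ultimately show ?thesis
    using abelian_integral.at_inf[OF vp image] by (simp add: int)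
qed

lemma abelian_chart_at_inf:
  assumes "lam 7 = 1"
  obtains \<rho> h A where "\<rho> > 0" "h holomorphic_on ball 0 \<rho>" "h 0 = 1"
    "\<And>t. t \<in> ball 0 \<rho> \<Longrightarrow> h t \<noteq> 0" "\<And>t. h (- t) = h t" "\<And>t. (h t)\<^sup>2 = inf_radicand lam t"
    "\<And>t i. t \<in> ball 0 \<rho> \<Longrightarrow>
      ((\<lambda>t. A t $ i) has_field_derivative (- 1 / h t * (vector [t ^ 4, t\<^sup>2, 1] :: complex ^ 3) $ i)) (at t)"
    "\<And>t. t \<in> ball 0 \<rho> \<Longrightarrow> A (- t) = - A t"
    "\<And>t. t \<in> ball 0 \<rho> \<Longrightarrow> t \<noteq> 0 \<Longrightarrow> abelian_integral lam None (Some (1 / t\<^sup>2, h t / t ^ 7)) (A t)"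
proof -
  obtain \<rho> h where h: "\<rho> > 0" "h holomorphic_on ball 0 \<rho>" "h 0 = 1"
    "\<And>t. t \<in> ball 0 \<rho> \<Longrightarrow> h t \<noteq> 0" "\<And>t. h (- t) = h t" "\<And>t. (h t)\<^sup>2 = inf_radicand lam t"
    using inf_sqrt_exists[of lam] assms by blast
  have "\<exists>F. (\<forall>t\<in>ball 0 \<rho>. (F has_field_derivative - 1 / h t * (vector [t ^ 4, t\<^sup>2, 1] :: complex ^ 3) $
      i) (at t)) \<and>
      (\<forall>t\<in>ball 0 \<rho>. F (- t) = - F t)" for i
  proof -
    have "(\<lambda>t. (vector [t ^ 4, t\<^sup>2, 1] :: complex ^ 3) $ i) holomorphic_on ball 0 \<rho>"
      using exhaust_3[of i] by (auto intro!: holomorphic_intros)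
    then have hol: "(\<lambda>t. - 1 / h t * (vector [t ^ 4, t\<^sup>2, 1] :: complex ^ 3) $ i) holomorphic_on ball 0 \<rho>"
      using h(2,4) by (intro holomorphic_intros) auto
    have "- 1 / h (- t) * (vector [(- t) ^ 4, (- t)\<^sup>2, 1] :: complex ^ 3) $ i =
        - 1 / h t * (vector [t ^ 4, t\<^sup>2, 1] :: complex ^ 3) $ i" for t
      by (simp add: h(5))
    from even_primitive_odd[OF h(1) hol this] show ?thesis by metis
  qed
  then obtain F where F: "\<And>i t. t \<in> ball 0 \<rho> \<Longrightarrow>
        (F i has_field_derivative - 1 / h t * (vector [t ^ 4, t\<^sup>2, 1] :: complex ^ 3) $ i) (at t)"
      "\<And>i t. t \<in> ball 0 \<rho> \<Longrightarrow> F i (- t) = - F i t"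
    by metis
  define A :: "complex \<Rightarrow> complex ^ 3" where "A t = (\<chi> i. F i t)" for t
  have A: "((\<lambda>t. A t $ i) has_field_derivative - 1 / h t * (vector [t ^ 4, t\<^sup>2, 1] :: complex ^ 3) $ i) (at t)"
    if "t \<in> ball 0 \<rho>" for t i
    using F(1)[OF that] by (simp add: A_def)
  have odd: "A (- t) = - A t" if "t \<in> ball 0 \<rho>" for t
    using F(2)[OF that] by (simp add: A_def vec_eq_iff)
  have "A 0 = 0" using odd[of 0] h(1) by (simp add: eq_neg_iff_add_eq_0 vec_eq_iff)
  show ?thesis
    by (rule that[of \<rho> h A, OF h A odd abelian_integral_near_inf[OF assms h(2,4,6) A \<open>A 0 = 0\<close>]])
qed

section \<open>Mumford coordinates\<close>

definition quad :: "(3 \<Rightarrow> complex) \<Rightarrow> complex \<Rightarrow> complex" where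
  "quad c x = c 1 + c 2 * x + c 3 * x\<^sup>2"

lemma quad_diff: "quad c a - quad c b = (c 2 + c 3 * (a + b)) * (a - b)"
  by (simp add: quad_def power2_eq_square algebra_simps)

lemma quad_zero_two:
  assumes "a \<noteq> b" "quad c a = 0" "quad c b = 0" "c 3 = 0"
  shows "c i = 0"
proof -
  have "c 2 * (a - b) = 0" using quad_diff[of c a b] assms(2-4) by simp
  then have "c 2 = 0" using assms(1) by simp
  then show ?thesis using assms(2,4) exhaust_3[of i] by (auto simp: quad_def)
qed

lemma quad_zero_three:
  assumes "inj x" "\<And>k :: 3. quad c (x k) = 0"
  shows "c i = 0"
proof -
  have ne: "x 1 \<noteq> x 2" "x 1 \<noteq> x 3" "x 2 \<noteq> x 3" using assms(1) by (auto simp: inj_eq)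
  have "(c 2 + c 3 * (x 1 + x 2)) * (x 1 - x 2) = 0" "(c 2 + c 3 * (x 1 + x 3)) * (x 1 - x 3) = 0"
    using quad_diff[of c "x 1" "x 2"] quad_diff[of c "x 1" "x 3"] assms(2) by simp_all
  then have *: "c 2 + c 3 * (x 1 + x 2) = 0" "c 2 + c 3 * (x 1 + x 3) = 0" using ne by simp_all
  then have "c 3 * (x 2 - x 3) = 0" by algebra
  then have "c 3 = 0" using ne by simp
  then show ?thesis using quad_zero_two[OF ne(1), of c i] assms(2) by blast
qed

definition quad2 :: "(3 \<Rightarrow> 3 \<Rightarrow> complex) \<Rightarrow> complex \<Rightarrow> complex \<Rightarrow> complex" where
  "quad2 B x z = quad (\<lambda>i. quad (B i) z) x"

definition quad3 :: "(3 \<Rightarrow> 3 \<Rightarrow> 3 \<Rightarrow> complex) \<Rightarrow> complex \<Rightarrow> complex \<Rightarrow> complex \<Rightarrow> complex" where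
  "quad3 T x z s = quad (\<lambda>i. quad2 (T i) z s) x"

lemma quad_swap: "quad (\<lambda>i. quad (B i) z) x = quad (\<lambda>j. quad (\<lambda>i. B i j) x) z"
  by (simp add: quad_def algebra_simps)

lemma quad2_zero:
  assumes "inj x" "\<And>r s :: 3. quad2 B (x r) (x s) = 0"
  shows "B i j = 0"
proof -
  have "quad (\<lambda>i. quad (B i) (x s)) (x r) = 0" for r s using assms(2) by (simp add: quad2_def)
  from quad_zero_three[OF assms(1) this] have "quad (B i) (x s) = 0" for i s .
  from quad_zero_three[OF assms(1) this] show ?thesis .
qed

text \<open>Nothing is assumed at \<open>r = s\<close>. For fixed \<open>s\<close> the polynomial
  with coefficients \<open>quad (B i) (x s)\<close> has zeros at the two other points, and the third
  condition is its leading coefficient, which vanishes by the assumption on row 3.\<close>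

lemma symmetric_quad2_zero:
  assumes "inj x" "\<And>i j. B i j = B j i" "\<And>s :: 3. quad (B 3) (x s) = 0"
    and "\<And>r s. r \<noteq> s \<Longrightarrow> quad2 B (x r) (x s) = 0"
  shows "B i j = 0"
proof -
  have "quad (B j) (x s) = 0" for j s
  proof -
    obtain a b :: 3 where "a \<noteq> b" "a \<noteq> s" "b \<noteq> s"
      using exhaust_3[of s] that[of 2 3] that[of 1 3] that[of 1 2] by auto
    then show ?thesis
      using quad_zero_two[of "x a" "x b" "\<lambda>i. quad (B i) (x s)" j] assms(3,4) inj_eq[OF assms(1)]
      by (simp add: quad2_def)
  qed
  from quad_zero_three[OF assms(1) this] show ?thesis .
qed

text \<open>By symmetry only the values at three equal points are left open. With the last two
  arguments fixed at \<open>x s\<close>, the polynomial in the first one vanishes at the two other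
  points, and \<open>e3\<close> removes its leading coefficient.\<close>

lemma symmetric_quad3_zero:
  assumes inj: "inj x" and sym: "\<And>i j k. T i j k = T j i k" "\<And>i j k. T i j k = T i k j"
    and e3: "\<And>s :: 3. quad2 (T 3) (x s) (x s) = 0"
    and T0: "\<And>k r s. k \<noteq> r \<Longrightarrow> k \<noteq> s \<Longrightarrow> r \<noteq> s \<Longrightarrow> quad3 T (x k) (x r) (x s) = 0"
    and T1: "\<And>r s. r \<noteq> s \<Longrightarrow> quad3 T (x r) (x r) (x s) = 0"
  shows "T i j k = 0"
proof -
  have swap1: "quad3 T a b c = quad3 T b a c" for a b c
  proof -
    have "quad3 T a b c = quad (\<lambda>j. quad (\<lambda>i. quad (T i j) c) a) b"
      unfolding quad3_def quad2_def by (rule quad_swap)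
    also have "(\<lambda>i. quad (T i j) c) = (\<lambda>i. quad (T j i) c)" for j
      by (rule ext, rule arg_cong[of _ _ "\<lambda>c'. quad c' c"], rule ext, rule sym(1))
    then have "quad (\<lambda>j. quad (\<lambda>i. quad (T i j) c) a) b = quad3 T b a c"
      unfolding quad3_def quad2_def by simp
    finally show ?thesis .
  qed
  have swap2: "quad3 T a b c = quad3 T a c b" for a b c
  proof -
    have "quad (\<lambda>j. quad (T i j) c) b = quad (\<lambda>j. quad (T i j) b) c" for i
      by (subst quad_swap) (simp add: sym(2)[of i])
    then show ?thesis unfolding quad3_def quad2_def by simp
  qed
  have off: "quad3 T (x k) (x r) (x s) = 0" if "r \<noteq> s" for k r s
    using T0[of k r s] T1 that swap1 swap2 by metis
  have diag: "quad2 (T i) (x s) (x s) = 0" for i s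
  proof -
    obtain a b :: 3 where "a \<noteq> b" "a \<noteq> s" "b \<noteq> s"
      using exhaust_3[of s] that[of 2 3] that[of 1 3] that[of 1 2] by auto
    have "quad3 T (x c) (x s) (x s) = 0" if "c \<noteq> s" for c
      using off[OF that, of s] by (simp only: swap1[of "x c" "x s" "x s"])
    with \<open>a \<noteq> s\<close> \<open>b \<noteq> s\<close> have "quad (\<lambda>i. quad2 (T i) (x s) (x s)) (x a) = 0"
        "quad (\<lambda>i. quad2 (T i) (x s) (x s)) (x b) = 0"
      by (simp_all add: quad3_def)
    from quad_zero_two[OF _ this e3] show ?thesis using \<open>a \<noteq> b\<close> by (simp add: inj_eq[OF inj])
  qed
  have "quad2 (T i) (x r) (x s) = 0" for i r s
  proof (cases "r = s")
    case False
    then have "quad (\<lambda>i. quad2 (T i) (x r) (x s)) (x k) = 0" for k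
      using off by (simp add: quad3_def)
    from quad_zero_three[OF inj this] show ?thesis .
  qed (simp add: diag)
  from quad2_zero[OF inj this] show ?thesis .
qed

text \<open>For points \<open>(x\<^sub>k, y\<^sub>k)\<close> put \<open>U(x) = x\<^sup>3 - u\<^sub>3 x\<^sup>2 - u\<^sub>2 x - u\<^sub>1 = \<Prod>(x - x\<^sub>k)\<close>, let
  \<open>V(x) = v\<^sub>3 x\<^sup>2 + v\<^sub>2 x + v\<^sub>1\<close> interpolate \<open>y\<^sub>k\<close> at \<open>x\<^sub>k\<close>, and let \<open>W(x) = x\<^sup>4 + w\<^sub>3 x\<^sup>3 + \<dots> + w\<^sub>0\<close> be the
  cofactor in \<open>f = V\<^sup>2 + U W\<close>. The formulas below are the coefficients of
  \<open>\<Sum> \<wp>\<^sub>i\<^sub>j x\<^bsup>i-1\<^esup> z\<^bsup>j-1\<^esup> = (F(x,z) - 2 V(x) V(z) - U(x) W(z) - U(z) W(x)) / (x - z)\<^sup>2\<close> and of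
  \<open>\<Sum> \<wp>\<^sub>i\<^sub>j\<^sub>k x\<^bsup>i-1\<^esup> z\<^bsup>j-1\<^esup> s\<^bsup>k-1\<^esup> = 2 det / ((x - z) (x - s) (z - s))\<close>, where \<open>det\<close> is the determinant
  with rows \<open>(U, V, W)\<close> at \<open>x\<close>, \<open>z\<close>, \<open>s\<close>.\<close>

definition wp_coord :: "complex ^ 3 \<Rightarrow> complex ^ 3 \<Rightarrow> (nat \<Rightarrow> complex) \<Rightarrow> 3 list \<Rightarrow> complex" where
  "wp_coord u v w I = the (map_of
     [([3,3], u $ 3), ([2,3], u $ 2), ([1,3], u $ 1),
      ([2,2], 2 * u $ 1 - w 1 + u $ 2 * w 3),
      ([1,2], u $ 1 * w 3 - w 0),
      ([1,1], u $ 3 * w 0 + u $ 1 * w 2 - 2 * v $ 1 * v $ 3),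
      ([3,3,3], 2 * v $ 3), ([2,3,3], 2 * v $ 2), ([1,3,3], 2 * v $ 1),
      ([2,2,3], 2 * v $ 1 - 2 * u $ 3 * v $ 2 + 2 * u $ 2 * v $ 3),
      ([1,2,3], 2 * u $ 1 * v $ 3 - 2 * u $ 3 * v $ 1),
      ([1,1,3], 2 * u $ 1 * v $ 2 - 2 * u $ 2 * v $ 1),
      ([2,2,2], 2 * v $ 3 * w 1 - 2 * v $ 2 * w 2 - 4 * u $ 3 * v $ 1 + 4 * u $ 1 * v $ 3
         - 2 * u $ 3 * v $ 2 * w 3 + 2 * u $ 2 * v $ 3 * w 3),
      ([1,2,2], 2 * v $ 3 * w 0 - 2 * v $ 1 * w 2 - 2 * u $ 2 * v $ 1 + 2 * u $ 1 * v $ 2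
         - 2 * u $ 3 * v $ 1 * w 3 + 2 * u $ 1 * v $ 3 * w 3),
      ([1,1,2], 2 * v $ 2 * w 0 - 2 * v $ 1 * w 1 - 2 * u $ 2 * v $ 1 * w 3 + 2 * u $ 1 * v $ 2 * w 3),
      ([1,1,1], 2 * u $ 3 * v $ 1 * w 1 - 2 * u $ 3 * v $ 2 * w 0 - 2 * u $ 2 * v $ 1 * w 2
         + 2 * u $ 2 * v $ 3 * w 0 + 2 * u $ 1 * v $ 2 * w 2 - 2 * u $ 1 * v $ 3 * w 1)] I)"

lemma wp_coord_simps:
  "wp_coord u v w [3,3] = u $ 3"
  "wp_coord u v w [2,3] = u $ 2"
  "wp_coord u v w [1,3] = u $ 1"
  "wp_coord u v w [2,2] = 2 * u $ 1 - w 1 + u $ 2 * w 3"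
  "wp_coord u v w [1,2] = u $ 1 * w 3 - w 0"
  "wp_coord u v w [1,1] = u $ 3 * w 0 + u $ 1 * w 2 - 2 * v $ 1 * v $ 3"
  "wp_coord u v w [3,3,3] = 2 * v $ 3"
  "wp_coord u v w [2,3,3] = 2 * v $ 2"
  "wp_coord u v w [1,3,3] = 2 * v $ 1"
  "wp_coord u v w [2,2,3] = 2 * v $ 1 - 2 * u $ 3 * v $ 2 + 2 * u $ 2 * v $ 3"
  "wp_coord u v w [1,2,3] = 2 * u $ 1 * v $ 3 - 2 * u $ 3 * v $ 1"
  "wp_coord u v w [1,1,3] = 2 * u $ 1 * v $ 2 - 2 * u $ 2 * v $ 1"
  "wp_coord u v w [2,2,2] = 2 * v $ 3 * w 1 - 2 * v $ 2 * w 2 - 4 * u $ 3 * v $ 1 + 4 * u $ 1 * v $ 3 -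
      2 * u $ 3 * v $ 2 * w 3 + 2 * u $ 2 * v $ 3 * w 3"
  "wp_coord u v w [1,2,2] = 2 * v $ 3 * w 0 - 2 * v $ 1 * w 2 - 2 * u $ 2 * v $ 1 + 2 * u $ 1 * v $ 2 -
      2 * u $ 3 * v $ 1 * w 3 + 2 * u $ 1 * v $ 3 * w 3"
  "wp_coord u v w [1,1,2] = 2 * v $ 2 * w 0 - 2 * v $ 1 * w 1 - 2 * u $ 2 * v $ 1 * w 3 + 2 * u $ 1 * v
      $ 2 * w 3"
  "wp_coord u v w [1,1,1] = 2 * u $ 3 * v $ 1 * w 1 - 2 * u $ 3 * v $ 2 * w 0 - 2 * u $ 2 * v $ 1 * w 2
      + 2 * u $ 2 * v $ 3 * w 0 + 2 * u $ 1 * v $ 2 * w 2 - 2 * u $ 1 * v $ 3 * w 1"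
  by (simp_all add: wp_coord_def)

text \<open>The coefficients of \<open>f = V\<^sup>2 + U W\<close>.\<close>

definition coord_curve :: "complex ^ 3 \<Rightarrow> complex ^ 3 \<Rightarrow> (nat \<Rightarrow> complex) \<Rightarrow> (nat \<Rightarrow> complex) \<Rightarrow> bool" where
  "coord_curve u v w lam \<longleftrightarrow>
     lam 0 = (v $ 1)\<^sup>2 - u $ 1 * w 0 \<and>
     lam 1 = 2 * v $ 1 * v $ 2 - u $ 2 * w 0 - u $ 1 * w 1 \<and>
     lam 2 = (v $ 2)\<^sup>2 + 2 * v $ 1 * v $ 3 - u $ 3 * w 0 - u $ 2 * w 1 - u $ 1 * w 2 \<and>
     lam 3 = w 0 - u $ 3 * w 1 - u $ 2 * w 2 - u $ 1 * w 3 + 2 * v $ 2 * v $ 3 \<and>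
     lam 4 = (v $ 3)\<^sup>2 - u $ 1 + w 1 - u $ 3 * w 2 - u $ 2 * w 3 \<and>
     lam 5 = w 2 - u $ 2 - u $ 3 * w 3 \<and>
     lam 6 = w 3 - u $ 3"

lemma listed_relations_coord:
  assumes "coord_curve u v w lam" "n < 24"
  shows "listed_relations lam (wp_coord u v w) ! n = 0"
proof -
  from assms(1) have
    lam0: "lam 0 = (v $ 1)\<^sup>2 - u $ 1 * w 0" and
    lam1: "lam 1 = 2 * v $ 1 * v $ 2 - u $ 2 * w 0 - u $ 1 * w 1" and
    lam2: "lam 2 = (v $ 2)\<^sup>2 + 2 * v $ 1 * v $ 3 - u $ 3 * w 0 - u $ 2 * w 1 - u $ 1 * w 2" and
    lam3: "lam 3 = w 0 - u $ 3 * w 1 - u $ 2 * w 2 - u $ 1 * w 3 + 2 * v $ 2 * v $ 3" and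
    lam4: "lam 4 = (v $ 3)\<^sup>2 - u $ 1 + w 1 - u $ 3 * w 2 - u $ 2 * w 3" and
    lam5: "lam 5 = w 2 - u $ 2 - u $ 3 * w 3" and
    lam6: "lam 6 = w 3 - u $ 3"
    by (simp_all add: coord_curve_def)
  have "list_all (\<lambda>e. e = 0) (listed_relations lam (wp_coord u v w))"
    unfolding listed_relations_def list.pred_inject wp_coord_simps
      lam0 lam1 lam2 lam3 lam4 lam5 lam6
    by (intro conjI TrueI; simp add: algebra_simps power2_eq_square)
  moreover have "length (listed_relations lam (wp_coord u v w)) = 24"
    by (simp add: listed_relations_def)
  ultimately show ?thesis using assms(2) by (simp add: list_all_length)
qed

section \<open>The coordinates of a triple of points\<close>

definition coord_u :: "(3 \<Rightarrow> complex) \<Rightarrow> complex ^ 3" where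
  "coord_u x = vector [x 1 * x 2 * x 3, - (x 1 * x 2 + x 1 * x 3 + x 2 * x 3), x 1 + x 2 + x 3]"

text \<open>The coefficients of Lagrange's interpolation polynomial.\<close>

definition coord_v :: "(3 \<Rightarrow> complex) \<Rightarrow> (3 \<Rightarrow> complex) \<Rightarrow> complex ^ 3" where
  "coord_v x y = (let a = y 1 / ((x 1 - x 2) * (x 1 - x 3)); b = y 2 / ((x 2 - x 1) * (x 2 - x 3));
       c = y 3 / ((x 3 - x 1) * (x 3 - x 2))
     in vector [a * x 2 * x 3 + b * x 1 * x 3 + c * x 1 * x 2,
       - (a * (x 2 + x 3) + b * (x 1 + x 3) + c * (x 1 + x 2)), a + b + c])"

text \<open>Comparing the coefficients of \<open>x^6\<close>, \<open>x^5\<close>,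
  \<open>x^4\<close>, \<open>x^3\<close> in \<open>f = V^2 + U W\<close> determines the cofactor one
  coefficient at a time, from \<open>w 3\<close> down to \<open>w 0\<close>.\<close>

definition coord_w :: "(nat \<Rightarrow> complex) \<Rightarrow> complex ^ 3 \<Rightarrow> complex ^ 3 \<Rightarrow> nat \<Rightarrow> complex" where
  "coord_w lam u v n =
     (let w3 = lam 6 + u $ 3;
          w2 = lam 5 + u $ 2 + u $ 3 * w3;
          w1 = lam 4 + u $ 1 - (v $ 3)\<^sup>2 + u $ 3 * w2 + u $ 2 * w3;
          w0 = lam 3 + u $ 3 * w1 + u $ 2 * w2 + u $ 1 * w3 - 2 * v $ 2 * v $ 3
      in if n = 3 then w3 else if n = 2 then w2 else if n = 1 then w1 else w0)"

lemma quad_coord_u: "quad (vec_nth (coord_u x)) (x k) = x k ^ 3"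
  using exhaust_3[of k] by (auto simp: quad_def coord_u_def power2_eq_square power3_eq_cube algebra_simps)

lemma quad_coord_v:
  assumes "inj x"
  shows "quad (vec_nth (coord_v x y)) (x k) = y k"
proof -
  define a b c where "a = y 1 / ((x 1 - x 2) * (x 1 - x 3))" "b = y 2 / ((x 2 - x 1) * (x 2 - x 3))"
    "c = y 3 / ((x 3 - x 1) * (x 3 - x 2))"
  have y: "y 1 = a * ((x 1 - x 2) * (x 1 - x 3))" "y 2 = b * ((x 2 - x 1) * (x 2 - x 3))"
    "y 3 = c * ((x 3 - x 1) * (x 3 - x 2))"
    using assms by (simp_all add: a_b_c_def inj_eq)
  have v: "coord_v x y = vector [a * x 2 * x 3 + b * x 1 * x 3 + c * x 1 * x 2,
       - (a * (x 2 + x 3) + b * (x 1 + x 3) + c * (x 1 + x 2)), a + b + c]"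
    by (simp add: coord_v_def a_b_c_def Let_def)
  show ?thesis
    unfolding v quad_def using exhaust_3[of k] y by (auto simp: power2_eq_square algebra_simps)
qed

definition quartic :: "(nat \<Rightarrow> complex) \<Rightarrow> complex \<Rightarrow> complex" where
  "quartic w x = x ^ 4 + w 3 * x ^ 3 + w 2 * x\<^sup>2 + w 1 * x + w 0"

lemma curve_poly_expand:
  "lam 7 = 1 \<Longrightarrow> poly (curve_poly lam) x =
     lam 0 + lam 1 * x + lam 2 * x\<^sup>2 + lam 3 * x ^ 3 + lam 4 * x ^ 4 + lam 5 * x ^ 5 + lam 6 * x ^ 6 + x ^ 7"
  by (simp add: curve_poly_def poly_sum poly_monom numeral_eq_Suc)

lemma coord_curve_points:
  assumes "lam 7 = 1" "inj x" "\<And>k. (y k)\<^sup>2 = poly (curve_poly lam) (x k)"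
  defines "u \<equiv> coord_u x" and "v \<equiv> coord_v x y"
  shows "coord_curve u v (coord_w lam u v) lam"
proof -
  define w where "w = coord_w lam u v"
  have w3: "w 3 = lam 6 + u $ 3" and w2: "w 2 = lam 5 + u $ 2 + u $ 3 * w 3"
    and w1: "w 1 = lam 4 + u $ 1 - (v $ 3)\<^sup>2 + u $ 3 * w 2 + u $ 2 * w 3"
    and w0: "w 0 = lam 3 + u $ 3 * w 1 + u $ 2 * w 2 + u $ 1 * w 3 - 2 * v $ 2 * v $ 3"
    by (simp_all add: w_def coord_w_def Let_def)
  \<comment> \<open>By the recursion for \<open>w\<close> the coefficients of degree 3 and higher
    agree, so the remainder \<open>f - V^2 - U W\<close> is a polynomial of degree at most two, with
    coefficients \<open>c\<close>. It vanishes at the three points.\<close>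
  define c :: "3 \<Rightarrow> complex" where "c = vec_nth (vector
    [lam 0 - ((v $ 1)\<^sup>2 - u $ 1 * w 0), lam 1 - (2 * v $ 1 * v $ 2 - u $ 2 * w 0 - u $ 1 * w 1),
     lam 2 - ((v $ 2)\<^sup>2 + 2 * v $ 1 * v $ 3 - u $ 3 * w 0 - u $ 2 * w 1 - u $ 1 * w 2)])"
  have id: "quad c z = poly (curve_poly lam) z - (quad (vec_nth v) z)\<^sup>2 - (z ^ 3 - quad (vec_nth u) z) *
      quartic w z" for z
    unfolding curve_poly_expand[of lam, OF assms(1)]
    by (simp add: c_def quad_def quartic_def w0 w1 w2 w3 algebra_simps power_numeral_reduce
        del: One_nat_def)
  have "quad c (x k) = 0" for k
    using id[of "x k"] assms(3)[of k] by (simp add: u_def v_def quad_coord_u quad_coord_v[OF assms(2)])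
  from quad_zero_three[OF assms(2) this] have "c 1 = 0" "c 2 = 0" "c 3 = 0" by auto
  then show ?thesis
    unfolding coord_curve_def w_def[symmetric] by (auto simp: c_def w0 w1 w2 w3 simp del: One_nat_def)
qed

section \<open>Generating identities for the table of coordinates\<close>

definition dquad :: "(3 \<Rightarrow> complex) \<Rightarrow> complex \<Rightarrow> complex" where
  "dquad c x = c 2 + 2 * c 3 * x"

definition klein_Fx :: "(nat \<Rightarrow> complex) \<Rightarrow> complex \<Rightarrow> complex \<Rightarrow> complex" where
  "klein_Fx lam x z = lam 1 + z * (2 * lam 2 + lam 3 * (x + z)) + x * z * lam 3
     + 2 * x * z\<^sup>2 * (2 * lam 4 + lam 5 * (x + z)) + x\<^sup>2 * z\<^sup>2 * lam 5
     + 3 * x\<^sup>2 * z ^ 3 * (2 * lam 6 + lam 7 * (x + z)) + x ^ 3 * z ^ 3 * lam 7"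

lemma klein_F_expand:
  "klein_F lam x z = 2 * lam 0 + lam 1 * (x + z) + x * z * (2 * lam 2 + lam 3 * (x + z))
     + x\<^sup>2 * z\<^sup>2 * (2 * lam 4 + lam 5 * (x + z)) + x ^ 3 * z ^ 3 * (2 * lam 6 + lam 7 * (x + z))"
  by (simp add: klein_F_def numeral_eq_Suc)

lemma klein_F_deriv: "((\<lambda>x. klein_F lam x z) has_field_derivative klein_Fx lam x z) (at x)"
  unfolding klein_F_expand klein_Fx_def
  by (auto intro!: derivative_eq_intros simp: algebra_simps power_numeral_reduce)

text \<open>The index \<open>3\<close> equals \<open>0\<close> in the type \<open>3\<close>, so the
  intended order of the indices has to be stated by hand.\<close>

definition rank3 :: "3 \<Rightarrow> nat" where
  "rank3 i = (if i = 1 then 1 else if i = 2 then 2 else 3)"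

definition wp_coord_sym :: "complex ^ 3 \<Rightarrow> complex ^ 3 \<Rightarrow> (nat \<Rightarrow> complex) \<Rightarrow> 3 list \<Rightarrow> complex" where
  "wp_coord_sym u v w I = wp_coord u v w (sort_key rank3 I)"

lemma wp_coord_sym_swap:
  "wp_coord_sym u v w [i, j] = wp_coord_sym u v w [j, i]"
  "wp_coord_sym u v w [i, j, k] = wp_coord_sym u v w [j, i, k]"
  "wp_coord_sym u v w [i, j, k] = wp_coord_sym u v w [i, k, j]"
  unfolding wp_coord_sym_def
  using exhaust_3[of i] exhaust_3[of j] exhaust_3[of k] by (auto simp: rank3_def)

lemma wp_coord_sym_idx: "I \<in> idx2 \<union> idx3 \<Longrightarrow> wp_coord_sym u v w I = wp_coord u v w I"
  by (auto simp: idx2_def idx3_def wp_coord_sym_def rank3_def)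

abbreviation "cubic_u u x \<equiv> x ^ 3 - quad (vec_nth u) x"

lemma wp_coord_sym_simps:
  "wp_coord_sym u v w [1,1] = wp_coord u v w [1,1]"
  "wp_coord_sym u v w [1,2] = wp_coord u v w [1,2]"
  "wp_coord_sym u v w [1,3] = wp_coord u v w [1,3]"
  "wp_coord_sym u v w [2,1] = wp_coord u v w [1,2]"
  "wp_coord_sym u v w [2,2] = wp_coord u v w [2,2]"
  "wp_coord_sym u v w [2,3] = wp_coord u v w [2,3]"
  "wp_coord_sym u v w [3,1] = wp_coord u v w [1,3]"
  "wp_coord_sym u v w [3,2] = wp_coord u v w [2,3]"
  "wp_coord_sym u v w [3,3] = wp_coord u v w [3,3]"
  "wp_coord_sym u v w [1,1,1] = wp_coord u v w [1,1,1]"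
  "wp_coord_sym u v w [1,1,2] = wp_coord u v w [1,1,2]"
  "wp_coord_sym u v w [1,1,3] = wp_coord u v w [1,1,3]"
  "wp_coord_sym u v w [1,2,1] = wp_coord u v w [1,1,2]"
  "wp_coord_sym u v w [1,2,2] = wp_coord u v w [1,2,2]"
  "wp_coord_sym u v w [1,2,3] = wp_coord u v w [1,2,3]"
  "wp_coord_sym u v w [1,3,1] = wp_coord u v w [1,1,3]"
  "wp_coord_sym u v w [1,3,2] = wp_coord u v w [1,2,3]"
  "wp_coord_sym u v w [1,3,3] = wp_coord u v w [1,3,3]"
  "wp_coord_sym u v w [2,1,1] = wp_coord u v w [1,1,2]"
  "wp_coord_sym u v w [2,1,2] = wp_coord u v w [1,2,2]"
  "wp_coord_sym u v w [2,1,3] = wp_coord u v w [1,2,3]"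
  "wp_coord_sym u v w [2,2,1] = wp_coord u v w [1,2,2]"
  "wp_coord_sym u v w [2,2,2] = wp_coord u v w [2,2,2]"
  "wp_coord_sym u v w [2,2,3] = wp_coord u v w [2,2,3]"
  "wp_coord_sym u v w [2,3,1] = wp_coord u v w [1,2,3]"
  "wp_coord_sym u v w [2,3,2] = wp_coord u v w [2,2,3]"
  "wp_coord_sym u v w [2,3,3] = wp_coord u v w [2,3,3]"
  "wp_coord_sym u v w [3,1,1] = wp_coord u v w [1,1,3]"
  "wp_coord_sym u v w [3,1,2] = wp_coord u v w [1,2,3]"
  "wp_coord_sym u v w [3,1,3] = wp_coord u v w [1,3,3]"
  "wp_coord_sym u v w [3,2,1] = wp_coord u v w [1,2,3]"
  "wp_coord_sym u v w [3,2,2] = wp_coord u v w [2,2,3]"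
  "wp_coord_sym u v w [3,2,3] = wp_coord u v w [2,3,3]"
  "wp_coord_sym u v w [3,3,1] = wp_coord u v w [1,3,3]"
  "wp_coord_sym u v w [3,3,2] = wp_coord u v w [2,3,3]"
  "wp_coord_sym u v w [3,3,3] = wp_coord u v w [3,3,3]"
  by (simp_all add: wp_coord_sym_def rank3_def del: One_nat_def)

context
  fixes u v :: "complex ^ 3" and w lam :: "nat \<Rightarrow> complex"
  assumes curve: "coord_curve u v w lam" and lam7: "lam 7 = 1"
begin

private lemma lam_simps:
  "lam 0 = (v $ 1)\<^sup>2 - u $ 1 * w 0"
  "lam 1 = 2 * v $ 1 * v $ 2 - u $ 2 * w 0 - u $ 1 * w 1"
  "lam 2 = (v $ 2)\<^sup>2 + 2 * v $ 1 * v $ 3 - u $ 3 * w 0 - u $ 2 * w 1 - u $ 1 * w 2"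
  "lam 3 = w 0 - u $ 3 * w 1 - u $ 2 * w 2 - u $ 1 * w 3 + 2 * v $ 2 * v $ 3"
  "lam 4 = (v $ 3)\<^sup>2 - u $ 1 + w 1 - u $ 3 * w 2 - u $ 2 * w 3"
  "lam 5 = w 2 - u $ 2 - u $ 3 * w 3"
  "lam 6 = w 3 - u $ 3"
  using curve by (simp_all add: coord_curve_def)

text \<open>The identity from which the 2-index entries of the table are taken. At points of the
  triple U vanishes and V equals y, and the right hand side turns into that of Klein's
  formula.\<close>

lemma quad2_wp_coord:
  "quad2 (\<lambda>i j. wp_coord_sym u v w [i, j]) x z * (x - z)\<^sup>2 =
     klein_F lam x z - 2 * quad (vec_nth v) x * quad (vec_nth v) z
     - cubic_u u x * quartic w z - cubic_u u z * quartic w x"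
  unfolding klein_F_expand lam_simps lam7
  by (simp only: quad2_def quad_def quartic_def wp_coord_sym_simps wp_coord_simps) algebra

text \<open>The partial derivative of \<open>quad2_wp_coord\<close> with respect to
  \<open>x\<close>; the last bracket is W'(x).\<close>

lemma dquad2_wp_coord:
  "quad (\<lambda>j. dquad (\<lambda>i. wp_coord_sym u v w [i, j]) x) z * (x - z)\<^sup>2
     + 2 * (x - z) * quad2 (\<lambda>i j. wp_coord_sym u v w [i, j]) x z =
     klein_Fx lam x z - 2 * dquad (vec_nth v) x * quad (vec_nth v) z
     - (3 * x\<^sup>2 - dquad (vec_nth u) x) * quartic w z
     - cubic_u u z * (4 * x ^ 3 + 3 * w 3 * x\<^sup>2 + 2 * w 2 * x + w 1)"
  unfolding klein_Fx_def lam_simps lam7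
  by (simp only: quad2_def quad_def dquad_def quartic_def wp_coord_sym_simps wp_coord_simps) algebra

lemma curve_poly_coord:
  "poly (curve_poly lam) x = (quad (vec_nth v) x)\<^sup>2 + cubic_u u x * quartic w x"
  unfolding curve_poly_expand[of lam, OF lam7] lam_simps quad_def quartic_def by algebra

end

text \<open>Confluent form of the determinant formula: when two of the points coincide, one of the
  two equal rows is replaced by its derivative.\<close>

lemma quad3_wp_coord_diag:
  "quad3 (\<lambda>i j k. wp_coord_sym u v w [i, j, k]) x x z * (x - z)\<^sup>2 =
     2 * (3 * x\<^sup>2 - dquad (vec_nth u) x) * (quad (vec_nth v) x * quartic w z - quartic w x * quad (vec_nth v) z)
     - 2 * dquad (vec_nth v) x * (cubic_u u x * quartic w z - quartic w x * cubic_u u z)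
     + 2 * (4 * x ^ 3 + 3 * w 3 * x\<^sup>2 + 2 * w 2 * x + w 1) *
         (cubic_u u x * quad (vec_nth v) z - quad (vec_nth v) x * cubic_u u z)"
  by (simp only: quad3_def quad2_def quad_def dquad_def quartic_def wp_coord_sym_simps wp_coord_simps)
    algebra

lemma quad3_wp_coord:
  "quad3 (\<lambda>i j k. wp_coord_sym u v w [i, j, k]) x z s * ((x - z) * (x - s) * (z - s)) =
     2 * (cubic_u u x * (quad (vec_nth v) z * quartic w s - quad (vec_nth v) s * quartic w z)
       - cubic_u u z * (quad (vec_nth v) x * quartic w s - quad (vec_nth v) s * quartic w x)
       + cubic_u u s * (quad (vec_nth v) x * quartic w z - quad (vec_nth v) z * quartic w x))"
  by (simp only: quad3_def quad2_def quad_def dquad_def quartic_def wp_coord_sym_simps wp_coord_simps)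
    algebra

text \<open>The leading coefficient of the determinant formula in its first variable. As that
  variable grows, W dominates its row, and the Wronskian of U and V remains when the other two
  points coincide.\<close>

lemma quad2_wp_coord_3:
  "quad2 (\<lambda>i j. wp_coord_sym u v w [3, i, j]) x x =
     2 * ((3 * x\<^sup>2 - dquad (vec_nth u) x) * quad (vec_nth v) x - cubic_u u x * dquad (vec_nth v) x)"
  by (simp only: quad3_def quad2_def quad_def dquad_def quartic_def wp_coord_sym_simps wp_coord_simps)
    algebra

lemma quad_minus: "quad (\<lambda>i. c i - d i) x = quad c x - quad d x"
  by (simp add: quad_def algebra_simps)

text \<open>\<open>E1\<close> and \<open>E2\<close> are Klein's formula with one of the four points
  at infinity. \<open>D1\<close> is the derivative of \<open>E1\<close>, and \<open>D2\<close>,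
  \<open>D3\<close> are derivatives of \<open>E2\<close>, when one point moves with velocity (2y,
  f'(x)). The table satisfies the same equations, and by \<open>symmetric_quad2_zero\<close> and
  \<open>symmetric_quad3_zero\<close> these have only one symmetric solution.\<close>

lemma wp_eq_coord:
  fixes W :: "3 list \<Rightarrow> complex" and x y :: "3 \<Rightarrow> complex"
  assumes lam7: "lam 7 = 1" and inj: "inj x" and y: "\<And>k. (y k)\<^sup>2 = poly (curve_poly lam) (x k)"
    and sym: "\<And>i j. W [i, j] = W [j, i]" "\<And>i j k. W [i, j, k] = W [j, i, k]"
      "\<And>i j k. W [i, j, k] = W [i, k, j]"
    and E1: "\<And>s. quad (\<lambda>j. W [3, j]) (x s) = x s ^ 3"
    and E2: "\<And>r s. r \<noteq> s \<Longrightarrow>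
      quad2 (\<lambda>i j. W [i, j]) (x r) (x s) * (x r - x s)\<^sup>2 = klein_F lam (x r) (x s) - 2 * y r * y s"
    and D1: "\<And>s. quad2 (\<lambda>i j. W [3, i, j]) (x s) (x s) + 2 * y s * dquad (\<lambda>j. W [3, j]) (x s) =
      6 * y s * (x s)\<^sup>2"
    and D2: "\<And>k r s. k \<noteq> r \<Longrightarrow> k \<noteq> s \<Longrightarrow> r \<noteq> s \<Longrightarrow>
      quad3 (\<lambda>i j k. W [i, j, k]) (x k) (x r) (x s) = 0"
    and D3: "\<And>r s. r \<noteq> s \<Longrightarrow>
      quad3 (\<lambda>i j k. W [i, j, k]) (x r) (x r) (x s) * (x r - x s)\<^sup>2
      + 2 * y r * quad (\<lambda>j. dquad (\<lambda>i. W [i, j]) (x r)) (x s) * (x r - x s)\<^sup>2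
      + 4 * y r * (x r - x s) * quad2 (\<lambda>i j. W [i, j]) (x r) (x s)
      = 2 * y r * klein_Fx lam (x r) (x s) - 2 * poly (pderiv (curve_poly lam)) (x r) * y s"
    and I: "I \<in> idx2 \<union> idx3"
  shows "W I = wp_coord (coord_u x) (coord_v x y) (coord_w lam (coord_u x) (coord_v x y)) I"
proof -
  define u v w where "u = coord_u x" and "v = coord_v x y" and "w = coord_w lam u v"
  note curve = coord_curve_points[OF lam7 inj y, folded u_def v_def, folded w_def]
  have U: "cubic_u u (x k) = 0" and V: "quad (vec_nth v) (x k) = y k" for k
    by (simp_all add: u_def v_def quad_coord_u quad_coord_v[OF inj])
  have ne: "x r \<noteq> x s" if "r \<noteq> s" for r s using inj that by (simp add: inj_eq)
  define P where "P i j = wp_coord_sym u v w [i, j]" for i j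
  define T where "T i j k = wp_coord_sym u v w [i, j, k]" for i j k
  have P3: "P 3 j = u $ j" for j
    using exhaust_3[of j] by (auto simp: P_def wp_coord_sym_simps wp_coord_simps)
  have W2: "W [i, j] = P i j" for i j
  proof -
    have "W [i, j] - P i j = 0"
    proof (rule symmetric_quad2_zero[OF inj, where B = "\<lambda>i j. W [i, j] - P i j"])
      show "W [i, j] - P i j = W [j, i] - P j i" for i j
        using sym(1) wp_coord_sym_swap(1) by (simp add: P_def)
      show "quad (\<lambda>j. W [3, j] - P 3 j) (x s) = 0" for s
        using E1[of s] U[of s] by (simp add: quad_minus P3)
      fix r s :: 3 assume "r \<noteq> s"
      have "quad2 P (x r) (x s) * (x r - x s)\<^sup>2 = klein_F lam (x r) (x s) - 2 * y r * y s"
        using quad2_wp_coord[OF curve lam7, of "x r" "x s"] by (simp add: P_def[abs_def] U V)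
      with E2[OF \<open>r \<noteq> s\<close>] ne[OF \<open>r \<noteq> s\<close>] have "quad2 (\<lambda>i j. W [i, j]) (x r) (x s) = quad2 P (x r) (x s)"
        by (metis mult_right_cancel power_not_zero right_minus_eq)
      then show "quad2 (\<lambda>i j. W [i, j] - P i j) (x r) (x s) = 0"
        by (simp add: quad2_def quad_minus)
    qed
    then show ?thesis by simp
  qed
  \<comment> \<open>Differentiating \<open>f = V^2 + U W\<close> at a zero of U expresses the term
    with \<open>pderiv\<close> in \<open>D3\<close> through the coordinates.\<close>
  have dcurve: "poly (pderiv (curve_poly lam)) (x r) = 2 * y r * dquad (vec_nth v) (x r)
      + (3 * (x r)\<^sup>2 - dquad (vec_nth u) (x r)) * quartic w (x r)" for r
  proof -
    have "((\<lambda>z. (quad (vec_nth v) z)\<^sup>2 + cubic_u u z * quartic w z) has_field_derivative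
       2 * quad (vec_nth v) (x r) * dquad (vec_nth v) (x r) + (3 * (x r)\<^sup>2 - dquad (vec_nth u) (x r)) *
           quartic w (x r)
       + cubic_u u (x r) * (4 * x r ^ 3 + 3 * w 3 * (x r)\<^sup>2 + 2 * w 2 * x r + w 1)) (at (x r))"
      unfolding quad_def dquad_def quartic_def
      by (auto intro!: derivative_eq_intros simp: algebra_simps power_numeral_reduce simp del: One_nat_def)
    then have "(poly (curve_poly lam) has_field_derivative
       2 * quad (vec_nth v) (x r) * dquad (vec_nth v) (x r) + (3 * (x r)\<^sup>2 - dquad (vec_nth u) (x r)) *
           quartic w (x r)
       + cubic_u u (x r) * (4 * x r ^ 3 + 3 * w 3 * (x r)\<^sup>2 + 2 * w 2 * x r + w 1)) (at (x r))"
      by (simp add: curve_poly_coord[OF curve lam7, abs_def])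
    from DERIV_unique[OF poly_DERIV this] show ?thesis by (simp add: U V)
  qed
  have W3: "W [i, j, k] = T i j k" for i j k
  proof -
    have "W [i, j, k] - T i j k = 0"
    proof (rule symmetric_quad3_zero[OF inj, where T = "\<lambda>i j k. W [i, j, k] - T i j k"])
      show "W [i, j, k] - T i j k = W [j, i, k] - T j i k" for i j k
        using sym(2) wp_coord_sym_swap(2) by (simp add: T_def)
      show "W [i, j, k] - T i j k = W [i, k, j] - T i k j" for i j k
        using sym(3) wp_coord_sym_swap(3) by (simp add: T_def)
      show "quad2 (\<lambda>j k. W [3, j, k] - T 3 j k) (x s) (x s) = 0" for s
      proof -
        have "quad2 (T 3) (x s) (x s) = 2 * (3 * (x s)\<^sup>2 - dquad (vec_nth u) (x s)) * y s"
          using quad2_wp_coord_3[of u v w "x s"] by (simp add: T_def[abs_def] U V)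
        moreover have "dquad (\<lambda>j. W [3, j]) (x s) = dquad (vec_nth u) (x s)"
          by (simp add: W2 P3)
        ultimately have "quad2 (\<lambda>i j. W [3, i, j]) (x s) (x s) = quad2 (T 3) (x s) (x s)"
          using D1[of s] by algebra
        then show ?thesis by (simp add: quad2_def quad_minus)
      qed
    next
      fix k r s :: 3 assume *: "k \<noteq> r" "k \<noteq> s" "r \<noteq> s"
      have "quad3 T (x k) (x r) (x s) * ((x k - x r) * (x k - x s) * (x r - x s)) = 0"
        using quad3_wp_coord[of u v w "x k" "x r" "x s"] by (simp add: T_def[abs_def] U)
      then have "quad3 T (x k) (x r) (x s) = 0" using ne * by simp
      with D2[OF *] show "quad3 (\<lambda>i j k. W [i, j, k] - T i j k) (x k) (x r) (x s) = 0"
        by (simp add: quad3_def quad2_def quad_minus)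
    next
      fix r s :: 3 assume rs: "r \<noteq> s"
      have T: "quad3 T (x r) (x r) (x s) * (x r - x s)\<^sup>2 =
          2 * (3 * (x r)\<^sup>2 - dquad (vec_nth u) (x r)) * (y r * quartic w (x s) - quartic w (x r) * y s)"
        using quad3_wp_coord_diag[of u v w "x r" "x s"] by (simp add: T_def[abs_def] U V)
      have "quad (\<lambda>j. dquad (\<lambda>i. W [i, j]) (x r)) (x s) * (x r - x s)\<^sup>2
            + 2 * (x r - x s) * quad2 (\<lambda>i j. W [i, j]) (x r) (x s) =
          klein_Fx lam (x r) (x s) - 2 * dquad (vec_nth v) (x r) * y s
            - (3 * (x r)\<^sup>2 - dquad (vec_nth u) (x r)) * quartic w (x s)"
        using dquad2_wp_coord[OF curve lam7, of "x r" "x s"] by (simp add: W2 P_def[abs_def] U V)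
      with T D3[OF rs] dcurve[of r]
      have "quad3 (\<lambda>i j k. W [i, j, k]) (x r) (x r) (x s) * (x r - x s)\<^sup>2 =
          quad3 T (x r) (x r) (x s) * (x r - x s)\<^sup>2"
        by algebra
      then have "quad3 (\<lambda>i j k. W [i, j, k]) (x r) (x r) (x s) = quad3 T (x r) (x r) (x s)"
        using ne[OF rs] by simp
      then show "quad3 (\<lambda>i j k. W [i, j, k] - T i j k) (x r) (x r) (x s) = 0"
        by (simp add: quad3_def quad2_def quad_minus)
    qed
    then show ?thesis by simp
  qed
  have "W I = wp_coord_sym u v w I"
    using I by (auto simp: idx2_def idx3_def W2 W3 P_def T_def)
  then show ?thesis using wp_coord_sym_idx[OF I] by (simp add: u_def v_def w_def)
qed

section \<open>Klein's formula near infinity\<close>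

text \<open>The data produced by \<open>abelian_chart_at_inf\<close> are fixed together with
  \<sigma>. All triples of points are taken from this one parameter disc, where \<open>A\<close> is
  a single-valued choice of the Abelian integral.\<close>

locale kleinian_chart =
  fixes lam :: "nat \<Rightarrow> complex" and \<sigma> :: "complex ^ 3 \<Rightarrow> complex"
    and \<rho> :: real and h :: "complex \<Rightarrow> complex" and A :: "complex \<Rightarrow> complex ^ 3"
  assumes lam7: "lam 7 = 1" and \<sigma>: "cdiff_on \<sigma> UNIV" and klein: "sigma_klein_formula lam \<sigma>"
    and \<rho>: "\<rho> > 0" and h_holo: "h holomorphic_on ball 0 \<rho>" and h0: "h 0 = 1"
    and h_nz: "\<And>t. t \<in> ball 0 \<rho> \<Longrightarrow> h t \<noteq> 0" and h_even: "\<And>t. h (- t) = h t"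
    and h_sq: "\<And>t. (h t)\<^sup>2 = inf_radicand lam t"
    and A_deriv: "\<And>t i. t \<in> ball 0 \<rho> \<Longrightarrow>
      ((\<lambda>t. A t $ i) has_field_derivative (- 1 / h t * (vector [t ^ 4, t\<^sup>2, 1] :: complex ^ 3) $ i)) (at t)"
    and A_odd: "\<And>t. t \<in> ball 0 \<rho> \<Longrightarrow> A (- t) = - A t"
    and A_int: "\<And>t. t \<in> ball 0 \<rho> \<Longrightarrow> t \<noteq> 0 \<Longrightarrow>
      abelian_integral lam None (Some (1 / t\<^sup>2, h t / t ^ 7)) (A t)"
begin

abbreviation "yy t \<equiv> h t / t ^ 7"

definition xs :: "complex ^ 3 \<Rightarrow> 3 \<Rightarrow> complex" where "xs t k = 1 / (t $ k)\<^sup>2"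

definition ys :: "complex ^ 3 \<Rightarrow> 3 \<Rightarrow> complex" where "ys t k = yy (t $ k)"

definition Abel :: "complex ^ 3 \<Rightarrow> complex ^ 3" where "Abel t = (\<Sum>k\<in>UNIV. A (t $ k))"

definition disc3 :: "(complex ^ 3) set" where "disc3 = {t. \<forall>k. t $ k \<in> ball 0 \<rho>}"

definition generic :: "(complex ^ 3) set" where
  "generic = {t \<in> disc3. (\<forall>k. t $ k \<noteq> 0) \<and> (\<forall>k l. k \<noteq> l \<longrightarrow> (t $ k)\<^sup>2 \<noteq> (t $ l)\<^sup>2)}"

definition regular :: "(complex ^ 3) set" where "regular = {t \<in> generic. \<sigma> (Abel t) \<noteq> 0}"

lemma A_zero [simp]: "A 0 = 0"
  using A_odd[of 0] \<rho> by (simp add: vec_eq_iff)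

lemma h_deriv: "t \<in> ball 0 \<rho> \<Longrightarrow> (h has_field_derivative deriv h t) (at t)"
  using h_holo by (simp add: holomorphic_derivI)

lemma A_has_derivative:
  assumes "t \<in> ball 0 \<rho>"
  shows "(A has_derivative (\<lambda>z. z *s ((- 1 / h t) *s vector [t ^ 4, t\<^sup>2, 1]))) (at t)"
proof (rule has_derivative_vecI)
  fix i
  have "(\<lambda>z. (z *s ((- 1 / h t) *s vector [t ^ 4, t\<^sup>2, 1] :: complex ^ 3)) $ i) =
      (*) (- 1 / h t * (vector [t ^ 4, t\<^sup>2, 1] :: complex ^ 3) $ i)"
    by (simp add: fun_eq_iff)
  with A_deriv[OF assms, of i] show "((\<lambda>t. A t $ i) has_derivative
      (\<lambda>z. (z *s ((- 1 / h t) *s vector [t ^ 4, t\<^sup>2, 1])) $ i)) (at t)"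
    by (simp only: has_field_derivative_def)
qed

lemma A_isCont: "t \<in> ball 0 \<rho> \<Longrightarrow> isCont A t"
  by (rule has_derivative_continuous[OF A_has_derivative])

lemma curve_point: "t \<noteq> 0 \<Longrightarrow> (yy t)\<^sup>2 = poly (curve_poly lam) (1 / t\<^sup>2)"
proof -
  assume t: "t \<noteq> 0"
  have "inf_radicand lam t = lam 0 * t ^ 14 + lam 1 * t ^ 12 + lam 2 * t ^ 10 + lam 3 * t ^ 8 + lam 4 * t ^ 6
      + lam 5 * t ^ 4 + lam 6 * t\<^sup>2 + 1"
    using lam7 by (simp add: inf_radicand_def eval_nat_numeral)
  then show ?thesis
    unfolding power_divide h_sq curve_poly_expand[of lam, OF lam7]
    using t by (simp add: field_simps)
qed

lemma inj_xs: "t \<in> generic \<Longrightarrow> inj (xs t)"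
  by (auto simp: generic_def xs_def inj_def)

lemma ys_nonzero: "t \<in> generic \<Longrightarrow> ys t k \<noteq> 0"
  using h_nz by (auto simp: generic_def ys_def disc3_def)

lemma open_disc3: "open disc3"
proof -
  have "disc3 = (\<Inter>k. {t. t $ k \<in> ball 0 \<rho>})" by (auto simp: disc3_def)
  moreover have "open {t :: complex ^ 3. t $ k \<in> ball 0 \<rho>}" for k
    using open_vimage_vec_nth[OF open_ball, of k 0 \<rho>] by (simp only: vimage_def)
  ultimately show ?thesis by (simp add: open_INT)
qed

lemma open_generic: "open generic"
proof -
  have "generic = disc3 \<inter> (\<Inter>k. {t. t $ k \<noteq> 0}) \<inter> (\<Inter>k. \<Inter>l\<in>-{k}. {t. (t $ k)\<^sup>2 \<noteq> (t $ l)\<^sup>2})"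
    by (auto simp: generic_def)
  moreover have "open {t :: complex ^ 3. t $ k \<noteq> 0}" "open {t :: complex ^ 3. (t $ k)\<^sup>2 \<noteq> (t $ l)\<^sup>2}" for k l
    by (auto intro!: open_Collect_neq continuous_intros)
  ultimately show ?thesis by (auto intro!: open_Int open_INT open_disc3)
qed

lemma Abel_has_derivative:
  assumes "t \<in> disc3"
  shows "(Abel has_derivative (\<lambda>v. \<Sum>k\<in>UNIV. v $ k *s ((- 1 / h (t $ k)) *s vector [(t $ k) ^ 4, (t $
      k)\<^sup>2, 1]))) (at t)"
  unfolding Abel_def
proof (rule has_derivative_sum)
  fix k :: 3
  have "t $ k \<in> ball 0 \<rho>" using assms by (simp add: disc3_def)
  from A_has_derivative[OF this] show "((\<lambda>t. A (t $ k)) has_derivative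
      (\<lambda>v. v $ k *s ((- 1 / h (t $ k)) *s vector [(t $ k) ^ 4, (t $ k)\<^sup>2, 1]))) (at t)"
    by (rule has_derivative_compose[rotated])
      (intro bounded_linear_imp_has_derivative bounded_linear_vec_nth)
qed

lemma Abel_continuous: "continuous_on disc3 Abel"
  by (rule has_derivative_continuous_on) (rule has_derivative_at_withinI[OF Abel_has_derivative])

lemma open_regular: "open regular"
proof -
  have "continuous_on generic (\<lambda>t. \<sigma> (Abel t))"
    by (rule continuous_on_compose2[OF cdiff_on_continuous[OF \<sigma>]])
      (auto intro: continuous_on_subset[OF Abel_continuous] simp: generic_def)
  then have "open (generic \<inter> (\<lambda>t. \<sigma> (Abel t)) -` (-{0}))"
    by (intro continuous_open_preimage open_generic) auto
  then show ?thesis by (simp add: regular_def vimage_def Int_def)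
qed

text \<open>Klein's formula is applied to the points \<open>(x\<^sub>k, - y\<^sub>k)\<close>, which
  have the parameters \<open>- t $ k\<close>. Since \<open>A\<close> is odd, the difference of
  integrals becomes the sum \<open>Abel t + A \<tau>\<close>, and the product of the y-coordinates
  changes its sign.\<close>

lemma klein_near_inf:
  assumes "t \<in> disc3" "\<And>k. t $ k \<noteq> 0" "\<tau> \<in> ball 0 \<rho>" "\<tau> \<noteq> 0" "\<sigma> (Abel t + A \<tau>) \<noteq> 0"
    and "1 / \<tau>\<^sup>2 \<noteq> xs t k"
  shows "quad2 (\<lambda>i j. wp \<sigma> [i, j] (Abel t + A \<tau>)) (1 / \<tau>\<^sup>2) (xs t k) * (1 / \<tau>\<^sup>2 - xs t k)\<^sup>2 =
     klein_F lam (1 / \<tau>\<^sup>2) (xs t k) - 2 * yy \<tau> * ys t k"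
proof -
  let ?P = "\<lambda>m. (xs t m, - ys t m)" and ?a = "\<lambda>m. A (- (t $ m))"
  have t: "- (t $ m) \<in> ball 0 \<rho>" "t $ m \<in> ball 0 \<rho>" for m using assms(1) by (auto simp: disc3_def)
  have int: "abelian_integral lam None (Some (?P m)) (?a m)" for m
    using A_int[OF t(1)[of m]] assms(2)[of m] by (simp add: xs_def ys_def h_even)
  have "(\<Sum>m\<in>UNIV. ?a m) = - Abel t"
    unfolding Abel_def by (simp only: A_odd[OF t(2)] sum_negf)
  then have arg: "A \<tau> - (\<Sum>m\<in>UNIV. ?a m) = Abel t + A \<tau>" by simp
  have "(\<Sum>i\<in>UNIV. \<Sum>j\<in>UNIV. wp \<sigma> [i, j] (A \<tau> - (\<Sum>m\<in>UNIV. ?a m)) *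
            (vector [1, 1 / \<tau>\<^sup>2, (1 / \<tau>\<^sup>2)\<^sup>2] :: complex ^ 3) $ i *
            (vector [1, fst (?P k), (fst (?P k))\<^sup>2] :: complex ^ 3) $ j)
        = (klein_F lam (1 / \<tau>\<^sup>2) (fst (?P k)) + 2 * yy \<tau> * snd (?P k)) / (1 / \<tau>\<^sup>2 - fst (?P k))\<^sup>2"
    by (rule klein[unfolded sigma_klein_formula_def, rule_format, where P = ?P and a = ?a and b = "A \<tau>"
        and k = k])
      (use int A_int[OF assms(3,4)] assms(6) in \<open>simp_all add: arg assms(5) del: vector_uminus_component\<close>)
  moreover have "(\<Sum>i\<in>UNIV. \<Sum>j\<in>UNIV. wp \<sigma> [i, j] (Abel t + A \<tau>) *
            (vector [1, 1 / \<tau>\<^sup>2, (1 / \<tau>\<^sup>2)\<^sup>2] :: complex ^ 3) $ i *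
            (vector [1, xs t k, (xs t k)\<^sup>2] :: complex ^ 3) $ j) =
       quad2 (\<lambda>i j. wp \<sigma> [i, j] (Abel t + A \<tau>)) (1 / \<tau>\<^sup>2) (xs t k)"
    by (simp add: sum_3 quad2_def quad_def algebra_simps)
  ultimately show ?thesis
    unfolding arg using assms(6) by simp
qed

lemma eventually_Abel_plus_A:
  assumes "\<sigma> u \<noteq> 0"
  shows "eventually (\<lambda>\<tau>. \<sigma> (u + A \<tau>) \<noteq> 0) (at 0)" "((\<lambda>\<tau>. wp \<sigma> [i, j] (u + A \<tau>)) \<longlongrightarrow> wp \<sigma> [i, j] u) (at 0)"
proof -
  have A: "((\<lambda>\<tau>. u + A \<tau>) \<longlongrightarrow> u) (at 0)"
    using A_isCont[of 0] \<rho> by (auto simp: isCont_def intro!: tendsto_eq_intros)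
  have S: "open {u. \<sigma> u \<noteq> 0}" by (rule open_nonzero_set[OF \<sigma>])
  show "eventually (\<lambda>\<tau>. \<sigma> (u + A \<tau>) \<noteq> 0) (at 0)"
    using topological_tendstoD[OF A S] assms by simp
  have "isCont (wp \<sigma> [i, j]) u"
    using cdiff_on_continuous[OF cdiff_on_wp2[OF \<sigma>]] S assms
    by (simp add: continuous_on_eq_continuous_at)
  from isCont_tendsto_compose[OF this A] show "((\<lambda>\<tau>. wp \<sigma> [i, j] (u + A \<tau>)) \<longlongrightarrow> wp \<sigma> [i, j] u) (at 0)" .
qed

lemma tendsto_quad: "(\<And>i. ((\<lambda>\<tau>. c \<tau> i) \<longlongrightarrow> d i) F) \<Longrightarrow> ((\<lambda>\<tau>. quad (c \<tau>) x) \<longlongrightarrow> quad d x) F"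
  unfolding quad_def by (intro tendsto_intros)

lemma eventually_in_disc: "eventually (\<lambda>\<tau>. \<tau> \<in> ball 0 \<rho> \<and> \<tau> \<noteq> 0) (at 0)"
  using \<rho> by (auto simp: eventually_at dist_commute intro!: exI[of _ \<rho>])

text \<open>Klein's formula for \<open>P \<rightarrow> \<infinity>\<close>.\<close>

lemma wp_cubic:
  assumes "t \<in> regular"
  shows "quad (\<lambda>j. wp \<sigma> [3, j] (Abel t)) (xs t s) = xs t s ^ 3"
proof -
  define u z y where "u = Abel t" and "z = xs t s" and "y = ys t s"
  have u: "\<sigma> u \<noteq> 0" using assms by (simp add: regular_def u_def)
  define Q where "Q i \<tau> = quad (\<lambda>j. wp \<sigma> [i, j] (u + A \<tau>)) z" for i \<tau>
  \<comment> \<open>The factor \<open>\<tau> ^ 8\<close> clears the poles at infinity: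
    \<open>\<tau> ^ 4\<close> for the quadratic polynomial and \<open>\<tau> ^ 4\<close> for the
    squared difference. At 0 only \<open>z ^ 3\<close> survives in \<open>G\<close>, and the term
    with y keeps a factor \<tau>.\<close>
  define G where "G \<tau> = 2 * lam 0 * \<tau> ^ 8 + lam 1 * (\<tau> ^ 6 + z * \<tau> ^ 8) + z * \<tau> ^ 6 * (2 * lam 2)
     + lam 3 * z * (\<tau> ^ 4 + z * \<tau> ^ 6) + z\<^sup>2 * (2 * lam 4 * \<tau> ^ 4 + lam 5 * (\<tau>\<^sup>2 + z * \<tau> ^ 4))
     + z ^ 3 * (2 * lam 6 * \<tau>\<^sup>2 + (1 + z * \<tau>\<^sup>2))" for \<tau>
  have G: "G \<tau> = \<tau> ^ 8 * klein_F lam (1 / \<tau>\<^sup>2) z" if "\<tau> \<noteq> 0" for \<tau>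
  proof -
    have "\<tau>\<^sup>2 * (1 / \<tau>\<^sup>2) = 1" using that by simp
    then show ?thesis unfolding G_def klein_F_expand lam7 by algebra
  qed
  have Q: "(Q i \<longlongrightarrow> quad (\<lambda>j. wp \<sigma> [i, j] u) z) (at 0)" for i
    unfolding Q_def by (intro tendsto_quad eventually_Abel_plus_A(2) u)
  have hlim: "(h \<longlongrightarrow> 1) (at 0)"
    using h_deriv[of 0, THEN DERIV_isCont] \<rho> by (simp add: isCont_def h0)
  have lim: "((\<lambda>\<tau>. (\<tau> ^ 4 * Q 1 \<tau> + \<tau>\<^sup>2 * Q 2 \<tau> + Q 3 \<tau>) * (1 - z * \<tau>\<^sup>2)\<^sup>2 - (G \<tau> - 2 * \<tau> * h \<tau> * y)) \<longlongrightarrow>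
      (0 ^ 4 * quad (\<lambda>j. wp \<sigma> [1, j] u) z + 0\<^sup>2 * quad (\<lambda>j. wp \<sigma> [2, j] u) z + quad (\<lambda>j. wp \<sigma> [3, j] u) z)
      * (1 - z * 0\<^sup>2)\<^sup>2 - (G 0 - 2 * 0 * 1 * y)) (at 0)"
    unfolding G_def by (intro tendsto_intros Q hlim)
  have "isCont (\<lambda>\<tau>. z * \<tau>\<^sup>2) 0" by (intro continuous_intros)
  then have "((\<lambda>\<tau>. z * \<tau>\<^sup>2) \<longlongrightarrow> 0) (at 0)" by (simp add: isCont_def)
  then have ne: "eventually (\<lambda>\<tau>. z * \<tau>\<^sup>2 \<noteq> 1) (at 0)"
    by (rule tendsto_imp_eventually_ne) simp
  have "eventually (\<lambda>\<tau>. (\<tau> ^ 4 * Q 1 \<tau> + \<tau>\<^sup>2 * Q 2 \<tau> + Q 3 \<tau>) * (1 - z * \<tau>\<^sup>2)\<^sup>2 - (G \<tau> - 2 * \<tau> * h \<tau> *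
      y) = 0) (at 0)"
    using ne eventually_in_disc eventually_Abel_plus_A(1)[OF u]
  proof eventually_elim
    case (elim \<tau>)
    have \<tau>: "\<tau> \<noteq> 0" using elim by simp
    have "1 / \<tau>\<^sup>2 \<noteq> xs t s" using elim(1) \<tau> by (metis nonzero_eq_divide_eq power_not_zero z_def)
    then have "quad2 (\<lambda>i j. wp \<sigma> [i, j] (u + A \<tau>)) (1 / \<tau>\<^sup>2) z * (1 / \<tau>\<^sup>2 - z)\<^sup>2 =
        klein_F lam (1 / \<tau>\<^sup>2) z - 2 * yy \<tau> * y"
      unfolding u_def z_def y_def
      using assms elim by (intro klein_near_inf) (auto simp: regular_def generic_def u_def)
    then have "\<tau> ^ 8 * (quad2 (\<lambda>i j. wp \<sigma> [i, j] (u + A \<tau>)) (1 / \<tau>\<^sup>2) z * (1 / \<tau>\<^sup>2 - z)\<^sup>2) =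
        G \<tau> - \<tau> ^ 8 * (2 * yy \<tau> * y)"
      by (simp add: G[OF \<tau>] right_diff_distrib)
    moreover have "\<tau> ^ 8 * (2 * yy \<tau> * y) = 2 * \<tau> * h \<tau> * y"
      using \<tau> by (simp add: field_simps power_numeral_reduce)
    moreover have "\<tau> ^ 8 * (quad2 (\<lambda>i j. wp \<sigma> [i, j] (u + A \<tau>)) (1 / \<tau>\<^sup>2) z * (1 / \<tau>\<^sup>2 - z)\<^sup>2) =
        (\<tau> ^ 4 * quad2 (\<lambda>i j. wp \<sigma> [i, j] (u + A \<tau>)) (1 / \<tau>\<^sup>2) z) * (\<tau>\<^sup>2 * (1 / \<tau>\<^sup>2 - z))\<^sup>2"
      by (simp add: power_mult_distrib power_numeral_reduce)
    moreover have "\<tau> ^ 4 * quad2 (\<lambda>i j. wp \<sigma> [i, j] (u + A \<tau>)) (1 / \<tau>\<^sup>2) z = \<tau> ^ 4 * Q 1 \<tau> + \<tau>\<^sup>2 * Q 2 \<tau>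
        + Q 3 \<tau>"
    proof -
      have "\<tau>\<^sup>2 * (1 / \<tau>\<^sup>2) = 1" using \<tau> by simp
      then show ?thesis unfolding quad2_def quad_def[of _ "1 / \<tau>\<^sup>2"] Q_def by algebra
    qed
    moreover have "\<tau>\<^sup>2 * (1 / \<tau>\<^sup>2 - z) = 1 - z * \<tau>\<^sup>2" using \<tau> by (simp add: field_simps)
    ultimately show ?case by simp
  qed
  then have "((\<lambda>\<tau>. (\<tau> ^ 4 * Q 1 \<tau> + \<tau>\<^sup>2 * Q 2 \<tau> + Q 3 \<tau>) * (1 - z * \<tau>\<^sup>2)\<^sup>2 - (G \<tau> - 2 * \<tau> * h \<tau> * y)) \<longlongrightarrow>
      0) (at 0)"
    by (rule tendsto_eventually)
  from tendsto_unique[OF _ this lim] show ?thesis by (simp add: G_def u_def z_def)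
qed

text \<open>Klein's formula for \<open>P = P\<^sub>r\<close>, where the point \<open>P\<^sub>r\<close> of the triple is replaced by a point tending
  to infinity.\<close>

lemma wp_quad2:
  assumes "t \<in> regular" "r \<noteq> s"
  shows "quad2 (\<lambda>i j. wp \<sigma> [i, j] (Abel t)) (xs t r) (xs t s) * (xs t r - xs t s)\<^sup>2 =
    klein_F lam (xs t r) (xs t s) - 2 * ys t r * ys t s"
proof -
  define u where "u = Abel t"
  have u: "\<sigma> u \<noteq> 0" using assms by (simp add: regular_def u_def)
  have t: "t \<in> generic" using assms by (simp add: regular_def)
  have "((\<lambda>\<tau>. quad2 (\<lambda>i j. wp \<sigma> [i, j] (u + A \<tau>)) (xs t r) (xs t s) * (xs t r - xs t s)\<^sup>2) \<longlongrightarrow>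
      quad2 (\<lambda>i j. wp \<sigma> [i, j] u) (xs t r) (xs t s) * (xs t r - xs t s)\<^sup>2) (at 0)"
    unfolding quad2_def by (intro tendsto_intros tendsto_quad eventually_Abel_plus_A(2) u)
  moreover have "eventually (\<lambda>\<tau>. quad2 (\<lambda>i j. wp \<sigma> [i, j] (u + A \<tau>)) (xs t r) (xs t s) * (xs t r - xs t s)\<^sup>2
      = klein_F lam (xs t r) (xs t s) - 2 * ys t r * ys t s) (at 0)"
    using eventually_in_disc eventually_Abel_plus_A(1)[OF u]
  proof eventually_elim
    case (elim \<tau>)
    \<comment> \<open>Interchanging \<tau> with the parameter of the r-th point leaves the sum over
      all four points unchanged.\<close>
    define t' :: "complex ^ 3" where "t' = (\<chi> k. if k = r then \<tau> else t $ k)"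
    have "Abel t' + A (t $ r) = (\<Sum>k\<in>UNIV. (A (t' $ k) + (if k = r then A (t $ r) else 0)))"
      by (simp add: Abel_def sum.distrib)
    also have "\<dots> = (\<Sum>k\<in>UNIV. (A (t $ k) + (if k = r then A \<tau> else 0)))"
      by (intro sum.cong refl) (simp add: t'_def)
    also have "\<dots> = u + A \<tau>" by (simp add: Abel_def u_def sum.distrib)
    finally have arg: "Abel t' + A (t $ r) = u + A \<tau>" .
    have xs': "xs t' s = xs t s" "ys t' s = ys t s" using assms(2) by (simp_all add: t'_def xs_def ys_def)
    have "xs t r \<noteq> xs t s" using inj_xs[OF t] assms(2) by (simp add: inj_eq)
    have "quad2 (\<lambda>i j. wp \<sigma> [i, j] (Abel t' + A (t $ r))) (1 / (t $ r)\<^sup>2) (xs t' s) * (1 / (t $ r)\<^sup>2 -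
        xs t' s)\<^sup>2 =
       klein_F lam (1 / (t $ r)\<^sup>2) (xs t' s) - 2 * yy (t $ r) * ys t' s"
    proof (rule klein_near_inf)
      show "t' \<in> disc3" using t elim by (auto simp: t'_def generic_def disc3_def)
      show "t' $ k \<noteq> 0" for k using t elim by (auto simp: t'_def generic_def)
      show "t $ r \<in> ball 0 \<rho>" "t $ r \<noteq> 0" using t by (auto simp: generic_def disc3_def)
      show "\<sigma> (Abel t' + A (t $ r)) \<noteq> 0" using elim arg by simp
      show "1 / (t $ r)\<^sup>2 \<noteq> xs t' s" using \<open>xs t r \<noteq> xs t s\<close> by (simp add: xs') (simp add: xs_def)
    qed
    then show ?case unfolding arg xs' by (simp add: xs_def[of t r] ys_def[of t r])
  qed
  ultimately have "quad2 (\<lambda>i j. wp \<sigma> [i, j] u) (xs t r) (xs t s) * (xs t r - xs t s)\<^sup>2 =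
      klein_F lam (xs t r) (xs t s) - 2 * ys t r * ys t s"
    using tendsto_unique[OF at_neq_bot _ tendsto_eventually] by blast
  then show ?thesis by (simp add: u_def)
qed

end

section \<open>Derivatives of Klein's formula along the curve\<close>

context kleinian_chart
begin

text \<open>The factor between d/dt and the derivation with dx = 2y, dy = f'(x), under which the
  Abelian integral moves in direction (1, x, x^2). It is nonzero at generic parameters and cancels
  from each differentiated identity.\<close>

definition speed :: "complex ^ 3 \<Rightarrow> 3 \<Rightarrow> complex" where
  "speed t k = - ((t $ k) ^ 4 / h (t $ k))"

lemma coordinate_line: "(t + axis k z :: complex ^ 3) $ l = (if l = k then t $ k + z else t $ l)"
  by (simp add: axis_def)

lemma has_derivative_Abel_line:
  assumes "t \<in> generic"
  shows "((\<lambda>z. Abel (t + axis k z)) has_derivative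
    (\<lambda>z. z *s (speed t k *s vector [1, xs t k, (xs t k)\<^sup>2]))) (at 0)"
proof -
  have tk: "t $ k \<in> ball 0 \<rho>" "t $ k \<noteq> 0" using assms by (auto simp: generic_def disc3_def)
  have "Abel (t + axis k z) = Abel t - A (t $ k) + A (t $ k + z)" for z
  proof -
    have "Abel (t + axis k z) = (\<Sum>l\<in>UNIV. A (t $ l) + (if l = k then A (t $ k + z) - A (t $ k) else 0))"
      unfolding Abel_def coordinate_line by (intro sum.cong) auto
    also have "\<dots> = Abel t + (A (t $ k + z) - A (t $ k))" by (simp add: sum.distrib Abel_def)
    finally show ?thesis by simp
  qed
  moreover have deriv: "((\<lambda>z. A (t $ k + z)) has_derivative
      (\<lambda>z. z *s ((- 1 / h (t $ k)) *s vector [(t $ k) ^ 4, (t $ k)\<^sup>2, 1]))) (at 0)"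
    by (rule has_derivative_compose[of "\<lambda>z. t $ k + z" "\<lambda>z. z" 0 UNIV A])
      (use A_has_derivative[OF tk(1)] in \<open>auto intro!: derivative_eq_intros\<close>)
  have "(- 1 / h (t $ k)) *s vector [(t $ k) ^ 4, (t $ k)\<^sup>2, 1] =
      speed t k *s (vector [1, xs t k, (xs t k)\<^sup>2] :: complex ^ 3)"
    using tk by (simp add: vec_eq_iff forall_3 speed_def xs_def power_numeral_reduce field_simps)
  from has_derivative_add[OF has_derivative_const deriv[unfolded this], of "Abel t - A (t $ k)"]
  have "((\<lambda>z. Abel t - A (t $ k) + A (t $ k + z)) has_derivative
    (\<lambda>z. z *s (speed t k *s vector [1, xs t k, (xs t k)\<^sup>2]))) (at 0)" by simp
  ultimately show ?thesis by simp
qed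

lemma wp2_deriv_line:
  assumes "t \<in> regular"
  shows "((\<lambda>z. wp \<sigma> [i, j] (Abel (t + axis k z))) has_field_derivative
    speed t k * quad (\<lambda>m. wp \<sigma> [m, i, j] (Abel t)) (xs t k)) (at 0)"
proof -
  have "has_grad (wp \<sigma> [i, j]) (\<lambda>m. wp \<sigma> [m, i, j] (Abel t)) (Abel (t + axis k 0))"
    using has_grad_wp2[OF \<sigma>, of "Abel t" i j] assms by (simp add: regular_def axis_def
        zero_vec_def[symmetric] vec_eq_iff)
  from has_grad_chain[OF this has_derivative_Abel_line] assms show ?thesis
    by (simp add: regular_def sum_3 quad_def algebra_simps)
qed

lemma xs_deriv_line:
  assumes "t \<in> generic"
  shows "((\<lambda>z. xs (t + axis k z) l) has_field_derivative
    (if l = k then speed t k * (2 * ys t k) else 0)) (at 0)"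
proof (cases "l = k")
  case True
  have tk: "t $ k \<noteq> 0" "h (t $ k) \<noteq> 0" using assms h_nz by (auto simp: generic_def disc3_def)
  have "((\<lambda>z. 1 / (t $ k + z)\<^sup>2) has_field_derivative speed t k * (2 * ys t k)) (at 0)"
    using tk by (auto intro!: derivative_eq_intros simp: speed_def ys_def field_simps power_numeral_reduce)
  then show ?thesis using True unfolding xs_def coordinate_line by simp
next
  case False
  then show ?thesis unfolding xs_def coordinate_line by simp
qed

text \<open>The derivative of \<open>h\<close> is never made explicit: the equation of the curve is
  differentiated and divided by 2y, which is nonzero here.\<close>

lemma ys_deriv_line:
  assumes "t \<in> generic"
  shows "((\<lambda>z. ys (t + axis k z) l) has_field_derivative
    (if l = k then speed t k * poly (pderiv (curve_poly lam)) (xs t k) else 0)) (at 0)"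
proof (cases "l = k")
  case True
  have tk: "t $ k \<noteq> 0" "t $ k \<in> ball 0 \<rho>" using assms by (auto simp: generic_def disc3_def)
  have t0: "t + axis k 0 = t" by (simp add: axis_def zero_vec_def[symmetric])
  obtain D where D: "((\<lambda>z. ys (t + axis k z) k) has_field_derivative D) (at 0)"
  proof -
    have "((\<lambda>z. h (t $ k + z)) has_field_derivative deriv h (t $ k) * 1) (at 0)"
      by (rule DERIV_chain2[where f = h]) (use h_deriv[OF tk(2)] in \<open>auto intro!: derivative_eq_intros\<close>)
    moreover have "((\<lambda>z. (t $ k + z) ^ 7) has_field_derivative 7 * (t $ k) ^ 6) (at 0)"
      by (auto intro!: derivative_eq_intros)
    ultimately show ?thesis
      using that DERIV_divide[of "\<lambda>z. h (t $ k + z)" _ 0 UNIV "\<lambda>z. (t $ k + z) ^ 7"] tk(1)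
      unfolding ys_def coordinate_line by auto
  qed
  have dy: "((\<lambda>z. (ys (t + axis k z) k)\<^sup>2) has_field_derivative 2 * ys t k * D) (at 0)"
    using DERIV_power[OF D, of 2] by (simp add: t0 mult.assoc mult.commute[of D])
  have dp: "((\<lambda>z. poly (curve_poly lam) (xs (t + axis k z) k)) has_field_derivative
      poly (pderiv (curve_poly lam)) (xs t k) * (speed t k * (2 * ys t k))) (at 0)"
    using DERIV_chain2[OF poly_DERIV xs_deriv_line[OF assms, of k k]] by (simp add: t0)
  have ev: "eventually (\<lambda>z. (ys (t + axis k z) k)\<^sup>2 = poly (curve_poly lam) (xs (t + axis k z) k)) (nhds 0)"
  proof -
    have "eventually (\<lambda>z. z \<noteq> - (t $ k)) (nhds 0)"
      using tk(1) by (intro t1_space_nhds) auto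
    then show ?thesis
    proof eventually_elim
      case (elim z)
      then have "t $ k + z \<noteq> 0" by (metis eq_neg_iff_add_eq_0 add.commute)
      from curve_point[OF this] show ?case by (simp add: ys_def xs_def coordinate_line)
    qed
  qed
  have "2 * ys t k * D = poly (pderiv (curve_poly lam)) (xs t k) * (speed t k * (2 * ys t k))"
    by (rule DERIV_unique[OF dy[unfolded DERIV_cong_ev[OF refl ev refl]] dp])
  then show ?thesis using ys_nonzero[OF assms, of k] D True by (simp add: mult.commute)
next
  case False
  then show ?thesis unfolding ys_def coordinate_line by simp
qed

lemma speed_nonzero: "t \<in> generic \<Longrightarrow> speed t k \<noteq> 0"
  using h_nz by (auto simp: generic_def disc3_def speed_def)

lemma eventually_regular_line: "t \<in> regular \<Longrightarrow> eventually (\<lambda>z. t + axis k z \<in> regular) (nhds 0)"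
proof -
  assume t: "t \<in> regular"
  have "open ((\<lambda>z. t + axis k z) -` regular)"
    by (intro open_vimage open_regular continuous_intros continuous_axis)
  then have "eventually (\<lambda>z. z \<in> (\<lambda>z. t + axis k z) -` regular) (nhds 0)"
    using t by (intro eventually_nhds_in_open) (auto simp: axis_def zero_vec_def[symmetric])
  then show ?thesis by simp
qed

text \<open>Regular parameters form an open set, so an identity valid on them may be differentiated
  in each coordinate separately.\<close>

lemma derivatives_equal:
  assumes "t \<in> regular" "\<And>t. t \<in> regular \<Longrightarrow> f t = g t"
    and "((\<lambda>z. f (t + axis k z)) has_field_derivative a) (at 0)"
    and "((\<lambda>z. g (t + axis k z)) has_field_derivative b) (at 0)"
  shows "a = b"
proof -
  have "eventually (\<lambda>z. f (t + axis k z) = g (t + axis k z)) (nhds 0)"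
    using eventually_regular_line[OF assms(1)] by eventually_elim (rule assms(2))
  from DERIV_cong_ev[OF refl this refl, of a] assms(3,4) show ?thesis
    using DERIV_unique by blast
qed

text \<open>\<open>wp_cubic\<close> differentiated with respect to the s-th point.\<close>

lemma wp3_diag:
  assumes "t \<in> regular"
  shows "quad2 (\<lambda>i j. wp \<sigma> [3, i, j] (Abel t)) (xs t s) (xs t s)
     + 2 * ys t s * dquad (\<lambda>j. wp \<sigma> [3, j] (Abel t)) (xs t s) = 6 * ys t s * (xs t s)\<^sup>2"
proof -
  have t: "t \<in> generic" "t + axis s 0 = t"
    using assms by (simp_all add: regular_def axis_def zero_vec_def[symmetric])
  note D = wp2_deriv_line[OF assms, of 3 _ s] xs_deriv_line[OF t(1), of s s]
  have L: "((\<lambda>z. quad (\<lambda>j. wp \<sigma> [3, j] (Abel (t + axis s z))) (xs (t + axis s z) s)) has_field_derivative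
     speed t s * (quad (\<lambda>j. quad (\<lambda>m. wp \<sigma> [m, 3, j] (Abel t)) (xs t s)) (xs t s)
       + 2 * ys t s * dquad (\<lambda>j. wp \<sigma> [3, j] (Abel t)) (xs t s))) (at 0)"
    unfolding quad_def[of "\<lambda>j. wp \<sigma> [3, j] _"]
    by (auto intro!: derivative_eq_intros D simp: t(2) dquad_def quad_def algebra_simps power2_eq_square)
  have R: "((\<lambda>z. xs (t + axis s z) s ^ 3) has_field_derivative speed t s * (6 * ys t s * (xs t s)\<^sup>2)) (at 0)"
    by (auto intro!: derivative_eq_intros D simp: t(2) algebra_simps)
  from derivatives_equal[OF assms, of "\<lambda>t. quad (\<lambda>j. wp \<sigma> [3, j] (Abel t)) (xs t s)" "\<lambda>t. xs t s ^ 3",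
      OF wp_cubic L R]
  have "quad (\<lambda>j. quad (\<lambda>m. wp \<sigma> [m, 3, j] (Abel t)) (xs t s)) (xs t s)
       + 2 * ys t s * dquad (\<lambda>j. wp \<sigma> [3, j] (Abel t)) (xs t s) = 6 * ys t s * (xs t s)\<^sup>2"
    using speed_nonzero[OF t(1)] by simp
  moreover have "quad (\<lambda>j. quad (\<lambda>m. wp \<sigma> [m, 3, j] (Abel t)) (xs t s)) (xs t s) =
      quad2 (\<lambda>i j. wp \<sigma> [3, i, j] (Abel t)) (xs t s) (xs t s)"
    unfolding quad2_def
    by (subst quad_swap) (use assms in \<open>simp add: wp3_commute12[OF \<sigma>, of _ _ 3] regular_def\<close>)
  ultimately show ?thesis by simp
qed

lemma quad2_deriv_line:
  assumes "t \<in> regular"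
  shows "((\<lambda>z. quad2 (\<lambda>i j. wp \<sigma> [i, j] (Abel (t + axis k z))) (xs (t + axis k z) r) (xs t s))
      has_field_derivative
     speed t k * (quad3 (\<lambda>m i j. wp \<sigma> [m, i, j] (Abel t)) (xs t k) (xs t r) (xs t s)
       + (if r = k then 2 * ys t k * quad (\<lambda>j. dquad (\<lambda>i. wp \<sigma> [i, j] (Abel t)) (xs t k)) (xs t s) else
           0))) (at 0)"
proof -
  have t: "t \<in> generic" "t + axis k 0 = t"
    using assms by (simp_all add: regular_def axis_def zero_vec_def[symmetric])
  show ?thesis
    unfolding quad2_def quad_def
    by (rule derivative_eq_intros wp2_deriv_line[OF assms] xs_deriv_line[OF t(1)] refl)+
      (simp add: t(2) quad3_def quad2_def quad_def dquad_def algebra_simps power2_eq_square)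
qed

text \<open>Moving the k-th point changes neither the right hand side of \<open>wp_quad2\<close> for
  \<open>r\<close>, \<open>s\<close> nor the arguments of the form on the left, so only the
  derivative of the coefficients is left.\<close>

lemma wp3_distinct:
  assumes "t \<in> regular" "k \<noteq> r" "k \<noteq> s" "r \<noteq> s"
  shows "quad3 (\<lambda>i j k. wp \<sigma> [i, j, k] (Abel t)) (xs t k) (xs t r) (xs t s) = 0"
proof -
  have t: "t \<in> generic" using assms by (simp add: regular_def)
  let ?c = "(xs t r - xs t s)\<^sup>2"
  have const: "xs (t + axis k z) r = xs t r" "xs (t + axis k z) s = xs t s"
     "ys (t + axis k z) r = ys t r" "ys (t + axis k z) s = ys t s" for z
    using assms(2,3) unfolding xs_def ys_def coordinate_line by simp_all
  have L: "((\<lambda>z. quad2 (\<lambda>i j. wp \<sigma> [i, j] (Abel (t + axis k z))) (xs (t + axis k z) r) (xs (t + axis k z) s) *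
      (xs (t + axis k z) r - xs (t + axis k z) s)\<^sup>2) has_field_derivative
      speed t k * quad3 (\<lambda>m i j. wp \<sigma> [m, i, j] (Abel t)) (xs t k) (xs t r) (xs t s) * ?c) (at 0)"
    using DERIV_cmult_right[OF quad2_deriv_line[OF assms(1), of k r s], of ?c] assms(2) by (simp add: const)
  have R: "((\<lambda>z. klein_F lam (xs (t + axis k z) r) (xs (t + axis k z) s) - 2 * ys (t + axis k z) r * ys
      (t + axis k z) s)
      has_field_derivative 0) (at 0)"
    by (simp add: const)
  from derivatives_equal[OF assms(1), of "\<lambda>t. quad2 (\<lambda>i j. wp \<sigma> [i, j] (Abel t)) (xs t r) (xs t s) * (xs
      t r - xs t s)\<^sup>2"
      "\<lambda>t. klein_F lam (xs t r) (xs t s) - 2 * ys t r * ys t s", OF wp_quad2[OF _ assms(4)] L R]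
  show ?thesis using speed_nonzero[OF t] inj_xs[OF t] assms(4) by (simp add: inj_eq)
qed

text \<open>\<open>wp_quad2\<close> differentiated with respect to a point that occurs in it, which
  brings in the derivatives of x and y.\<close>

lemma wp3_repeated:
  assumes "t \<in> regular" "r \<noteq> s"
  shows "quad3 (\<lambda>i j k. wp \<sigma> [i, j, k] (Abel t)) (xs t r) (xs t r) (xs t s) * (xs t r - xs t s)\<^sup>2
      + 2 * ys t r * quad (\<lambda>j. dquad (\<lambda>i. wp \<sigma> [i, j] (Abel t)) (xs t r)) (xs t s) * (xs t r - xs t s)\<^sup>2
      + 4 * ys t r * (xs t r - xs t s) * quad2 (\<lambda>i j. wp \<sigma> [i, j] (Abel t)) (xs t r) (xs t s)
      = 2 * ys t r * klein_Fx lam (xs t r) (xs t s) - 2 * poly (pderiv (curve_poly lam)) (xs t r) * ys t s"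
    (is "?lhs = ?rhs")
proof -
  have t: "t \<in> generic" "t + axis r 0 = t"
    using assms by (simp_all add: regular_def axis_def zero_vec_def[symmetric])
  have const: "xs (t + axis r z) s = xs t s" "ys (t + axis r z) s = ys t s" for z
    using assms(2) unfolding xs_def ys_def coordinate_line by simp_all
  note D = xs_deriv_line[OF t(1), of r r] ys_deriv_line[OF t(1), of r r]
  have L: "((\<lambda>z. quad2 (\<lambda>i j. wp \<sigma> [i, j] (Abel (t + axis r z))) (xs (t + axis r z) r) (xs (t + axis r z) s) *
      (xs (t + axis r z) r - xs (t + axis r z) s)\<^sup>2) has_field_derivative speed t r * ?lhs) (at 0)"
    unfolding const
    by (rule derivative_eq_intros quad2_deriv_line[OF assms(1)] D refl)+
      (simp add: t(2) algebra_simps power2_eq_square)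
  have "((\<lambda>z. klein_F lam (xs (t + axis r z) r) (xs t s)) has_field_derivative
      klein_Fx lam (xs t r) (xs t s) * (speed t r * (2 * ys t r))) (at 0)"
    using DERIV_chain2[OF klein_F_deriv D(1), of lam "xs t s"] by (simp add: t(2))
  then have R: "((\<lambda>z. klein_F lam (xs (t + axis r z) r) (xs (t + axis r z) s) - 2 * ys (t + axis r z) r
      * ys (t + axis r z) s)
      has_field_derivative speed t r * ?rhs) (at 0)"
    unfolding const using D(2) by (auto intro!: derivative_eq_intros simp: algebra_simps)
  from derivatives_equal[OF assms(1), of "\<lambda>t. quad2 (\<lambda>i j. wp \<sigma> [i, j] (Abel t)) (xs t r) (xs t s) * (xs
      t r - xs t s)\<^sup>2"
      "\<lambda>t. klein_F lam (xs t r) (xs t s) - 2 * ys t r * ys t s", OF wp_quad2[OF _ assms(2)] L R]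
  show ?thesis using speed_nonzero[OF t(1)] by simp
qed

definition coord :: "complex ^ 3 \<Rightarrow> 3 list \<Rightarrow> complex" where
  "coord t = wp_coord (coord_u (xs t)) (coord_v (xs t) (ys t))
     (coord_w lam (coord_u (xs t)) (coord_v (xs t) (ys t)))"

lemma ys_sq: "t \<in> generic \<Longrightarrow> (ys t k)\<^sup>2 = poly (curve_poly lam) (xs t k)"
  unfolding ys_def xs_def by (rule curve_point) (simp add: generic_def)

lemma wp_Abel:
  assumes "t \<in> regular" "I \<in> idx2 \<union> idx3"
  shows "wp \<sigma> I (Abel t) = coord t I"
  unfolding coord_def
proof (rule wp_eq_coord[where W = "\<lambda>I. wp \<sigma> I (Abel t)" and lam = lam and x = "xs t" and y = "ys t"])
  have t: "t \<in> generic" "\<sigma> (Abel t) \<noteq> 0" using assms(1) by (auto simp: regular_def)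
  show "inj (xs t)" by (rule inj_xs[OF t(1)])
  show "(ys t k)\<^sup>2 = poly (curve_poly lam) (xs t k)" for k by (rule ys_sq[OF t(1)])
  show "wp \<sigma> [i, j] (Abel t) = wp \<sigma> [j, i] (Abel t)" for i j by (rule wp2_commute[OF \<sigma> t(2)])
  show "wp \<sigma> [i, j, k] (Abel t) = wp \<sigma> [j, i, k] (Abel t)" for i j k by (rule wp3_commute12[OF \<sigma> t(2)])
  show "wp \<sigma> [i, j, k] (Abel t) = wp \<sigma> [i, k, j] (Abel t)" for i j k by (rule wp3_commute23[OF \<sigma> t(2)])
qed (use lam7 assms(2) in \<open>auto intro: wp_cubic[OF assms(1)] wp_quad2[OF assms(1)] wp3_diag[OF assms(1)]
    wp3_distinct[OF assms(1)] wp3_repeated[OF assms(1)]\<close>)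

end

section \<open>Degeneration to the cuspidal curve\<close>

definition coord_map :: "(3 \<Rightarrow> complex) \<Rightarrow> (3 \<Rightarrow> complex) \<Rightarrow> (nat \<Rightarrow> complex) \<Rightarrow> 3 list \<Rightarrow> complex" where
  "coord_map x y lam = wp_coord (coord_u x) (coord_v x y) (coord_w lam (coord_u x) (coord_v x y))"

lemma tendsto_wp_coord:
  assumes "(u \<longlongrightarrow> u') F" "(v \<longlongrightarrow> v') F" "\<And>n. ((\<lambda>\<tau>. w \<tau> n) \<longlongrightarrow> w' n) F" "I \<in> idx2 \<union> idx3"
  shows "((\<lambda>\<tau>. wp_coord (u \<tau>) (v \<tau>) (w \<tau>) I) \<longlongrightarrow> wp_coord u' v' w' I) F"
proof -
  note lim = tendsto_add tendsto_diff tendsto_mult tendsto_const tendsto_vec_nth[OF assms(1)]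
    tendsto_vec_nth[OF assms(2)] assms(3)
  show ?thesis
    using assms(4) unfolding idx2_def idx3_def Un_iff insert_iff empty_iff
    by (elim disjE FalseE; hypsubst; unfold wp_coord_simps; intro lim)
qed

lemma tendsto_vec3:
  assumes "(a \<longlongrightarrow> a') F" "(b \<longlongrightarrow> b') F" "(c \<longlongrightarrow> c') F"
  shows "((\<lambda>\<tau>. vector [a \<tau>, b \<tau>, c \<tau>] :: complex ^ 3) \<longlongrightarrow> vector [a', b', c']) F"
proof (rule vec_tendstoI)
  show "((\<lambda>\<tau>. (vector [a \<tau>, b \<tau>, c \<tau>] :: complex ^ 3) $ i) \<longlongrightarrow> (vector [a', b', c'] :: complex ^ 3) $ i) F" for i
    using exhaust_3[of i] assms by auto
qed

lemma tendsto_coord_u: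
  assumes "\<And>k. ((\<lambda>\<tau>. x \<tau> k) \<longlongrightarrow> x' k) F"
  shows "((\<lambda>\<tau>. coord_u (x \<tau>)) \<longlongrightarrow> coord_u x') F"
  unfolding coord_u_def by (intro tendsto_vec3 tendsto_add tendsto_mult tendsto_minus assms)

lemma tendsto_coord_v:
  assumes "\<And>k. ((\<lambda>\<tau>. x \<tau> k) \<longlongrightarrow> x' k) F" "\<And>k. ((\<lambda>\<tau>. y \<tau> k) \<longlongrightarrow> y' k) F" "inj x'"
  shows "((\<lambda>\<tau>. coord_v (x \<tau>) (y \<tau>)) \<longlongrightarrow> coord_v x' y') F"
proof -
  have ne: "x' 1 \<noteq> x' 2" "x' 1 \<noteq> x' 3" "x' 2 \<noteq> x' 3" using assms(3) by (auto simp: inj_eq)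
  show ?thesis
    unfolding coord_v_def Let_def
    by (intro tendsto_vec3 tendsto_add tendsto_diff tendsto_mult tendsto_minus tendsto_divide assms(1,2))
      (simp_all add: ne ne[symmetric])
qed

lemma tendsto_coord_w:
  assumes "(u \<longlongrightarrow> u') F" "(v \<longlongrightarrow> v') F" "\<And>j. j < 7 \<Longrightarrow> ((\<lambda>\<tau>. lam \<tau> j) \<longlongrightarrow> lam' j) F"
  shows "((\<lambda>\<tau>. coord_w (lam \<tau>) (u \<tau>) (v \<tau>) n) \<longlongrightarrow> coord_w lam' u' v' n) F"
proof -
  note lim = tendsto_add tendsto_diff tendsto_mult tendsto_const tendsto_power tendsto_vec_nth[OF assms(1)]
    tendsto_vec_nth[OF assms(2)] assms(3)[of 6] assms(3)[of 5] assms(3)[of 4] assms(3)[of 3]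
  consider "n = 3" | "n = 2" | "n = 1" | "n \<noteq> 3 \<and> n \<noteq> 2 \<and> n \<noteq> 1" by blast
  then show ?thesis
    by cases (auto simp: coord_w_def Let_def intro!: lim)
qed

text \<open>The index 7 is excluded because in the degeneration the leading coefficient stays 1,
  whereas the limit is taken to be the zero function.\<close>

lemma tendsto_coord_map:
  assumes "\<And>k. ((\<lambda>\<tau>. x \<tau> k) \<longlongrightarrow> x' k) F" "\<And>k. ((\<lambda>\<tau>. y \<tau> k) \<longlongrightarrow> y' k) F" "inj x'"
    and "\<And>j. j < 7 \<Longrightarrow> ((\<lambda>\<tau>. lam \<tau> j) \<longlongrightarrow> lam' j) F" "I \<in> idx2 \<union> idx3"
  shows "((\<lambda>\<tau>. coord_map (x \<tau>) (y \<tau>) (lam \<tau>) I) \<longlongrightarrow> coord_map x' y' lam' I) F"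
  unfolding coord_map_def
  by (intro tendsto_wp_coord tendsto_coord_u tendsto_coord_v tendsto_coord_w assms)

text \<open>The weights in which \<open>u\<^sub>1, u\<^sub>2, u\<^sub>3, x, y, lam j\<close> have weights \<open>-5, -3, -1, 2, 7, 14 - 2 j\<close>.\<close>

definition weight :: "3 list \<Rightarrow> nat" where
  "weight I = (\<Sum>i\<leftarrow>I. if i = 1 then 5 else if i = 2 then 3 else 1)"

lemma weight_simps:
  "weight [1,1] = 10" "weight [1,2] = 8" "weight [1,3] = 6" "weight [2,2] = 6"
  "weight [2,3] = 4" "weight [3,3] = 2" "weight [1,1,1] = 15" "weight [1,1,2] = 13"
  "weight [1,1,3] = 11" "weight [1,2,2] = 11" "weight [1,2,3] = 9" "weight [1,3,3] = 7"
  "weight [2,2,2] = 9" "weight [2,2,3] = 7" "weight [2,3,3] = 5" "weight [3,3,3] = 3"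
  by (simp_all add: weight_def)

text \<open>Weighted homogeneity. It passes from the points to the coefficients of U and V, then to
  W along the recursion of \<open>coord_w\<close>, and finally to every entry of the table.\<close>

lemma coord_map_scale:
  assumes "e \<noteq> 0" "I \<in> idx2 \<union> idx3"
  shows "coord_map (\<lambda>k. e\<^sup>2 * x k) (\<lambda>k. e ^ 7 * y k) (\<lambda>j. e ^ (14 - 2 * j) * lam j) I =
    e ^ weight I * coord_map x y lam I"
proof -
  define u v w where "u = coord_u x" and "v = coord_v x y" and "w = coord_w lam u v"
  let ?x = "\<lambda>k. e\<^sup>2 * x k" and ?y = "\<lambda>k. e ^ 7 * y k" and ?lam = "\<lambda>j. e ^ (14 - 2 * j) * lam j"
  have u: "coord_u ?x $ 1 = e ^ 6 * u $ 1" "coord_u ?x $ 2 = e ^ 4 * u $ 2" "coord_u ?x $ 3 = e ^ 2 * u $ 3"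
    unfolding u_def coord_u_def vector_3 by algebra+
  have frac: "e ^ 7 * a / ((e\<^sup>2 * b - e\<^sup>2 * c) * (e\<^sup>2 * b - e\<^sup>2 * d)) = e ^ 3 * (a / ((b - c) * (b -
      d)))" for a b c d
  proof -
    have "(e\<^sup>2 * b - e\<^sup>2 * c) * (e\<^sup>2 * b - e\<^sup>2 * d) = e ^ 4 * ((b - c) * (b - d))"
      by algebra
    moreover have "e ^ 7 * a = e ^ 4 * (e ^ 3 * a)" by algebra
    ultimately have "e ^ 7 * a / ((e\<^sup>2 * b - e\<^sup>2 * c) * (e\<^sup>2 * b - e\<^sup>2 * d)) =
        (e ^ 4 * (e ^ 3 * a)) / (e ^ 4 * ((b - c) * (b - d)))" by (simp only:)
    also have "\<dots> = (e ^ 3 * a) / ((b - c) * (b - d))"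
      by (rule mult_divide_mult_cancel_left) (simp add: assms(1))
    finally show ?thesis by simp
  qed
  have v: "coord_v ?x ?y $ 1 = e ^ 7 * v $ 1" "coord_v ?x ?y $ 2 = e ^ 5 * v $ 2" "coord_v ?x ?y $ 3 = e
      ^ 3 * v $ 3"
    unfolding v_def coord_v_def Let_def frac vector_3 by algebra+
  define u' v' w' where "u' = coord_u ?x" and "v' = coord_v ?x ?y" and "w' = coord_w ?lam u' v'"
  note u' = u[folded u'_def] and v' = v[folded v'_def]
  have w: "w 3 = lam 6 + u $ 3" "w 2 = lam 5 + u $ 2 + u $ 3 * w 3"
    "w 1 = lam 4 + u $ 1 - (v $ 3)\<^sup>2 + u $ 3 * w 2 + u $ 2 * w 3"
    "w 0 = lam 3 + u $ 3 * w 1 + u $ 2 * w 2 + u $ 1 * w 3 - 2 * v $ 2 * v $ 3"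
    by (simp_all add: w_def coord_w_def Let_def)
  have w': "w' 3 = e\<^sup>2 * lam 6 + u' $ 3" "w' 2 = e ^ 4 * lam 5 + u' $ 2 + u' $ 3 * w' 3"
    "w' 1 = e ^ 6 * lam 4 + u' $ 1 - (v' $ 3)\<^sup>2 + u' $ 3 * w' 2 + u' $ 2 * w' 3"
    "w' 0 = e ^ 8 * lam 3 + u' $ 3 * w' 1 + u' $ 2 * w' 2 + u' $ 1 * w' 3 - 2 * v' $ 2 * v' $ 3"
    by (simp_all add: w'_def coord_w_def Let_def)
  note w' = w'[unfolded u' v']
  have w3: "w' 3 = e\<^sup>2 * w 3" unfolding w(1) w'(1) by algebra
  have w2: "w' 2 = e ^ 4 * w 2" unfolding w(2) w'(2) w3 by algebra
  have w1: "w' 1 = e ^ 6 * w 1" unfolding w(3) w'(3) w3 w2 by algebra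
  have w0: "w' 0 = e ^ 8 * w 0" unfolding w(4) w'(4) w3 w2 w1 by algebra
  have "\<forall>I\<in>idx2 \<union> idx3. wp_coord u' v' w' I = e ^ weight I * wp_coord u v w I"
    unfolding idx2_def idx3_def ball_Un ball_simps wp_coord_simps u' v' w0 w1 w2 w3 weight_simps
    by (intro conjI TrueI; (rule refl | algebra))
  then show ?thesis using assms(2) by (simp add: coord_map_def u_def v_def w_def u'_def v'_def w'_def)
qed

section \<open>Openness of the Abel map, density, and the degeneration limit\<close>

context kleinian_chart
begin

text \<open>The columns of the Jacobian are nonzero multiples of (1, x_k, x_k^2), a Vandermonde
  matrix with distinct nodes. Its transpose is injective because a polynomial of degree at most two
  with three zeros vanishes. Transposing a left inverse of it yields the right inverse needed for
  the open mapping theorem.\<close>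

lemma Abel_image_interior:
  assumes "open B" "B \<subseteq> generic" "B \<noteq> {}"
  shows "interior (Abel ` B) \<noteq> {}"
proof -
  obtain t where t: "t \<in> B" using assms(3) by blast
  then have gen: "t \<in> generic" "t \<in> disc3" using assms(2) by (auto simp: generic_def)
  define M :: "complex ^ 3 ^ 3" where "M = (\<chi> i k. speed t k * (vector [1, xs t k, (xs t k)\<^sup>2] ::
      complex ^ 3) $ i)"
  have col: "(- 1 / h (t $ k)) *s vector [(t $ k) ^ 4, (t $ k)\<^sup>2, 1] =
      speed t k *s (vector [1, xs t k, (xs t k)\<^sup>2] :: complex ^ 3)" for k
  proof -
    have "t $ k \<noteq> 0" using gen(1) by (simp add: generic_def)
    then show ?thesis by (simp add: vec_eq_iff forall_3 speed_def xs_def power_numeral_reduce field_simps)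
  qed
  have "inj ((*v) (transpose M))"
  proof (rule injI)
    fix a b :: "complex ^ 3" assume "transpose M *v a = transpose M *v b"
    then have "(transpose M *v a) $ k = (transpose M *v b) $ k" for k by simp
    then have "speed t k * quad (\<lambda>i. a $ i - b $ i) (xs t k) = 0" for k
      by (simp add: M_def transpose_def matrix_vector_mult_def sum_3 quad_def algebra_simps)
    then have "quad (\<lambda>i. a $ i - b $ i) (xs t k) = 0" for k using speed_nonzero[OF gen(1)] by simp
    from quad_zero_three[OF inj_xs[OF gen(1)] this] show "a = b" by (simp add: vec_eq_iff)
  qed
  then obtain N where "N ** transpose M = mat 1" using matrix_left_invertible_injective[of "transpose
      M"] by blast
  then have MN: "M ** transpose N = mat 1"
    by (metis matrix_transpose_mul transpose_mat transpose_transpose)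
  have "Abel t \<in> interior (Abel ` B)"
  proof (rule sussmann_open_mapping[OF assms(1) _ t Abel_has_derivative[OF gen(2)], where g' = "(*v)
      (transpose N)"])
    show "continuous_on B Abel"
      using assms(2) by (intro continuous_on_subset[OF Abel_continuous]) (auto simp: generic_def)
    have "linear ((*v) (transpose N) :: complex ^ 3 \<Rightarrow> complex ^ 3)"
      by (intro linearI) (simp_all add: vec_eq_iff matrix_vector_mult_def sum_3 algebra_simps)
    then show "bounded_linear ((*v) (transpose N) :: complex ^ 3 \<Rightarrow> complex ^ 3)"
      by (simp add: linear_conv_bounded_linear)
    have eq: "(\<Sum>k\<in>UNIV. v $ k *s ((- 1 / h (t $ k)) *s vector [(t $ k) ^ 4, (t $ k)\<^sup>2, 1])) = M *v v" for v
      unfolding col by (simp add: vec_eq_iff M_def matrix_vector_mult_def sum_3 algebra_simps)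
    show "(\<lambda>v. \<Sum>k\<in>UNIV. v $ k *s ((- 1 / h (t $ k)) *s vector [(t $ k) ^ 4, (t $ k)\<^sup>2, 1])) \<circ> (*v)
        (transpose N) = id"
      by (simp only: eq fun_eq_iff o_apply id_apply matrix_vector_mul_assoc MN matrix_vector_mul_lid simp_thms)
    show "t \<in> interior B" using t assms(1) by (simp add: interior_open)
  qed simp
  then show ?thesis by blast
qed

text \<open>If \<sigma> vanished on the image of a nonempty open set of generic parameters, it would
  vanish on an open set and hence identically.\<close>

lemma generic_subset_closure_regular:
  assumes "\<sigma> u \<noteq> 0"
  shows "generic \<subseteq> closure regular"
proof
  fix t assume t: "t \<in> generic"
  show "t \<in> closure regular"
  proof (rule ccontr)
    assume "t \<notin> closure regular"
    define B where "B = generic - closure regular"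
    have B: "open B" "B \<subseteq> generic" "B \<noteq> {}"
      using t \<open>t \<notin> closure regular\<close> open_generic by (auto simp: B_def)
    have "\<sigma> (Abel t) = 0" if "t \<in> B" for t
      using that closure_subset[of regular] by (auto simp: B_def regular_def)
    then have "\<sigma> v = 0" if "v \<in> interior (Abel ` B)" for v
      using that interior_subset by blast
    \<comment> \<open>With the constant 1 as the nonvanishing function, the identity theorem applies
      to \<sigma> on the whole space.\<close>
    with identity_theorem_nonzero_set[of "\<lambda>_. 1" \<sigma> "interior (Abel ` B)" u] Abel_image_interior[OF B] \<sigma>
    have "\<sigma> u = 0" by (simp add: cdiff_on_const)
    then show False using assms by simp
  qed
qed

lemma generic_scale:
  assumes "\<And>k. \<theta> $ k \<noteq> 0" "\<And>k l. k \<noteq> l \<Longrightarrow> (\<theta> $ k)\<^sup>2 \<noteq> (\<theta> $ l)\<^sup>2"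
  shows "eventually (\<lambda>\<epsilon>. of_real \<epsilon> *s \<theta> \<in> generic) (at_right 0)"
proof -
  have lim: "((\<lambda>\<epsilon>. norm (of_real \<epsilon> * \<theta> $ k)) \<longlongrightarrow> norm (of_real 0 * \<theta> $ k)) (at_right 0)" for k
    by (intro tendsto_intros)
  have "eventually (\<lambda>\<epsilon>. norm (of_real \<epsilon> * \<theta> $ k) < \<rho>) (at_right 0)" for k
    using order_tendstoD(2)[OF lim[of k], of \<rho>] \<rho> by simp
  then have "eventually (\<lambda>\<epsilon>. \<forall>k. norm (of_real \<epsilon> * \<theta> $ k) < \<rho>) (at_right 0)"
    by (simp add: eventually_all_finite)
  with eventually_at_right_less[of "0 :: real"] show ?thesis
    by eventually_elim (use assms in \<open>auto simp: generic_def disc3_def power_mult_distrib\<close>)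
qed

lemma regular_nonempty:
  assumes "\<sigma> u \<noteq> 0"
  shows "regular \<noteq> {}"
proof -
  have "eventually (\<lambda>\<epsilon>. of_real \<epsilon> *s vector [1, 2, 3] \<in> generic) (at_right 0)"
  proof (rule generic_scale)
    show "(vector [1, 2, 3] :: complex ^ 3) $ k \<noteq> 0" for k using exhaust_3[of k] by auto
    show "((vector [1, 2, 3] :: complex ^ 3) $ k)\<^sup>2 \<noteq> ((vector [1, 2, 3] :: complex ^ 3) $ l)\<^sup>2" if "k \<noteq>
        l" for k l
      using exhaust_3[of k] exhaust_3[of l] that by auto
  qed
  then have "generic \<noteq> {}" using eventually_happens' trivial_limit_at_right_real by fastforce
  then show ?thesis using generic_subset_closure_regular[OF assms] by auto
qed

lemma coord_eq: "coord t = coord_map (xs t) (ys t) lam"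
  by (simp add: coord_def coord_map_def)

lemma listed_relations_cong:
  assumes "\<And>I. I \<in> idx2 \<union> idx3 \<Longrightarrow> w I = w' I"
  shows "listed_relations l w = listed_relations l w'"
proof -
  have "\<forall>I\<in>idx2 \<union> idx3. w I = w' I" using assms by blast
  then have *: "w [1,1] = w' [1,1]" "w [1,2] = w' [1,2]" "w [1,3] = w' [1,3]" "w [2,2] = w' [2,2]"
    "w [2,3] = w' [2,3]" "w [3,3] = w' [3,3]" "w [1,1,1] = w' [1,1,1]" "w [1,1,2] = w' [1,1,2]"
    "w [1,1,3] = w' [1,1,3]" "w [1,2,2] = w' [1,2,2]" "w [1,2,3] = w' [1,2,3]" "w [1,3,3] = w' [1,3,3]"
    "w [2,2,2] = w' [2,2,2]" "w [2,2,3] = w' [2,2,3]" "w [2,3,3] = w' [2,3,3]" "w [3,3,3] = w' [3,3,3]"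
    by (simp_all only: idx2_def idx3_def ball_Un ball_simps)
  show ?thesis unfolding listed_relations_def * by (rule refl)
qed

lemma cdiff_on_listed_relation:
  assumes "n < 24"
  shows "cdiff_on (\<lambda>u. listed_relations lam (\<lambda>I. wp \<sigma> I u) ! n) {u. \<sigma> u \<noteq> 0}"
proof -
  have diff: "cdiff_on (\<lambda>u. f u - g u) S" if "cdiff_on f S" "cdiff_on g S" for f g S
    using cdiff_on_add[OF that(1) cdiff_on_uminus[OF that(2)]] by simp
  note intros = diff cdiff_on_add cdiff_on_mult cdiff_on_uminus cdiff_on_wp2[OF \<sigma>] cdiff_on_wp3[OF \<sigma>]
      cdiff_on_const
  have "list_all (\<lambda>f. cdiff_on f {u. \<sigma> u \<noteq> 0})
    (map (\<lambda>n u. listed_relations lam (\<lambda>I. wp \<sigma> I u) ! n) [0..<24])"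
    unfolding listed_relations_def upt_conv_Cons[of 0 24, simplified]
    by (simp add: upt_conv_Cons; intro conjI intros)
  then show ?thesis using assms by (simp add: list_all_iff)
qed

lemma listed_relations_vanish:
  assumes "n < 24" "\<sigma> u \<noteq> 0"
  shows "listed_relations lam (\<lambda>I. wp \<sigma> I u) ! n = 0"
proof (rule identity_theorem_nonzero_set[OF \<sigma> cdiff_on_listed_relation[OF assms(1)] _ _ _ _ assms(2)])
  show "open (interior (Abel ` regular))" by simp
  show "interior (Abel ` regular) \<noteq> {}"
    by (rule Abel_image_interior[OF open_regular _ regular_nonempty[OF assms(2)]]) (auto simp: regular_def)
  show "interior (Abel ` regular) \<subseteq> {u. \<sigma> u \<noteq> 0}"
    using interior_subset[of "Abel ` regular"] by (auto simp: regular_def)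
  fix u assume "u \<in> interior (Abel ` regular)"
  then obtain t where t: "t \<in> regular" "u = Abel t" using interior_subset by blast
  then have "t \<in> generic" by (simp add: regular_def)
  have "listed_relations lam (\<lambda>I. wp \<sigma> I u) = listed_relations lam (coord t)"
    unfolding t(2) by (rule listed_relations_cong) (rule wp_Abel[OF t(1)])
  also have "\<dots> ! n = 0"
    unfolding coord_def
    by (rule listed_relations_coord[OF coord_curve_points[OF lam7 inj_xs ys_sq] assms(1)]) (use \<open>t \<in>
        generic\<close> in auto)
  finally show "listed_relations lam (\<lambda>I. wp \<sigma> I u) ! n = 0" .
qed

text \<open>The degeneration follows a ray into the origin, and \<sigma> might vanish at points of
  that ray. Density and continuity therefore carry the relation from regular to all generic
  parameters first.\<close>

lemma relation_on_generic:
  assumes "is_bilinear_relation \<sigma> c d" "\<sigma> u \<noteq> 0" "t \<in> generic"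
  shows "bilinear_expr c d (coord t) = 0"
proof -
  have reg: "bilinear_expr c d (coord t) = 0" if "t \<in> regular" for t
  proof -
    have "bilinear_expr c d (coord t) = bilinear_expr c d (\<lambda>I. wp \<sigma> I (Abel t))"
      unfolding bilinear_expr_def using wp_Abel[OF that] by simp
    then show ?thesis using assms(1) that by (simp add: is_bilinear_relation_def regular_def)
  qed
  have cont: "continuous_on generic (\<lambda>t. bilinear_expr c d (coord t))"
  proof -
    have "((\<lambda>t. coord t I) \<longlongrightarrow> coord t I) (at t within generic)" if "t \<in> generic" "I \<in> idx2 \<union> idx3" for t I
      unfolding coord_eq
    proof (rule tendsto_coord_map)
      have tk: "t $ k \<noteq> 0" "t $ k \<in> ball 0 \<rho>" for k using that by (auto simp: generic_def disc3_def)
      show "((\<lambda>t. xs t k) \<longlongrightarrow> xs t k) (at t within generic)" for k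
        unfolding xs_def by (intro tendsto_intros) (simp add: tk)
      have "((\<lambda>t. h (t $ k)) \<longlongrightarrow> h (t $ k)) (at t within generic)" for k
        by (rule isCont_tendsto_compose[OF DERIV_isCont[OF h_deriv[OF tk(2)]]]) (intro tendsto_intros)
      then show "((\<lambda>t. ys t k) \<longlongrightarrow> ys t k) (at t within generic)" for k
        unfolding ys_def by (intro tendsto_intros) (simp_all add: tk)
      show "inj (xs t)" by (rule inj_xs[OF that(1)])
    qed (use that(2) in auto)
    then show ?thesis
      unfolding continuous_on_def bilinear_expr_def by (intro ballI tendsto_intros) auto
  qed
  have "t \<in> closure regular" using generic_subset_closure_regular[OF assms(2)] assms(3) by blast
  then obtain f where f: "\<And>n. f n \<in> regular" "f \<longlonglongrightarrow> t" by (auto simp: closure_sequential)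
  have "(\<lambda>n. bilinear_expr c d (coord (f n))) \<longlonglongrightarrow> bilinear_expr c d (coord t)"
    by (rule continuous_on_tendsto_compose[OF cont f(2) assms(3)]) (use f(1) in \<open>auto simp: regular_def\<close>)
  then show ?thesis using reg[OF f(1)] by (simp add: LIMSEQ_const_iff)
qed

text \<open>The top weight part of a relation survives in the limit where the curve degenerates to \<open>y\<^sup>2 = x\<^sup>7\<close>.\<close>

lemma top_weight_relation:
  assumes rel: "is_bilinear_relation \<sigma> c d" and "\<sigma> u \<noteq> 0"
    and c: "\<And>K. K \<in> idx3 \<Longrightarrow> weight K > n \<Longrightarrow> c K = 0"
    and d: "\<And>I K. I \<in> idx2 \<Longrightarrow> K \<in> idx3 \<Longrightarrow> weight I + weight K > n \<Longrightarrow> d I K = 0"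
    and x: "\<And>k. x k \<noteq> 0" "\<And>k l. k \<noteq> l \<Longrightarrow> (x k)\<^sup>2 \<noteq> (x l)\<^sup>2"
  shows "bilinear_expr (\<lambda>K. if weight K = n then c K else 0)
    (\<lambda>I K. if weight I + weight K = n then d I K else 0)
    (coord_map (\<lambda>k. (x k)\<^sup>2) (\<lambda>k. x k ^ 7) (\<lambda>_. 0)) = 0"
proof -
  \<comment> \<open>The parameters \<open>\<epsilon> / x k\<close> belong to points which, after
    scaling by their weights, are \<open>((x k)\<^sup>2, h (\<epsilon> / x k) * x k ^ 7)\<close> and
    tend to points of the cuspidal curve.\<close>
  define \<theta> :: "complex ^ 3" where "\<theta> = (\<chi> k. 1 / x k)"
  define V where "V \<epsilon> I = of_real \<epsilon> ^ weight I * coord (of_real \<epsilon> *s \<theta>) I" for \<epsilon> :: real and I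
  let ?V0 = "coord_map (\<lambda>k. (x k)\<^sup>2) (\<lambda>k. x k ^ 7) (\<lambda>_. 0)"
  have pos: "eventually (\<lambda>\<epsilon>. \<epsilon> > 0) (at_right (0 :: real))" by (rule eventually_at_right_less)
  have real0: "((\<lambda>\<epsilon>. complex_of_real \<epsilon>) \<longlongrightarrow> 0) (at_right 0)"
    using tendsto_of_real[of "\<lambda>\<epsilon>. \<epsilon>" 0 "at_right 0"] by simp
  have V: "((\<lambda>\<epsilon>. V \<epsilon> I) \<longlongrightarrow> ?V0 I) (at_right 0)" if I: "I \<in> idx2 \<union> idx3" for I
  proof -
    have "((\<lambda>\<epsilon>. coord_map (\<lambda>k. (x k)\<^sup>2) (\<lambda>k. h (of_real \<epsilon> / x k) * x k ^ 7)
        (\<lambda>j. of_real \<epsilon> ^ (14 - 2 * j) * lam j) I) \<longlongrightarrow> ?V0 I) (at_right 0)"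
    proof (rule tendsto_coord_map[OF _ _ _ _ I])
      show "((\<lambda>\<epsilon>. h (of_real \<epsilon> / x k) * x k ^ 7) \<longlongrightarrow> x k ^ 7) (at_right 0)" for k
      proof -
        have "isCont h 0" using h_deriv[of 0, THEN DERIV_isCont] \<rho> by simp
        then have "((\<lambda>\<epsilon>. h (of_real \<epsilon> / x k)) \<longlongrightarrow> h 0) (at_right 0)"
          by (rule isCont_tendsto_compose) (use tendsto_divide[OF real0 tendsto_const x(1), of k] in simp)
        from tendsto_mult[OF this tendsto_const[of "x k ^ 7"]] show ?thesis by (simp add: h0)
      qed
      show "((\<lambda>\<epsilon>. of_real \<epsilon> ^ (14 - 2 * j) * lam j) \<longlongrightarrow> 0) (at_right 0)" if "j < 7" for j
        using tendsto_mult[OF tendsto_power[OF real0, of "14 - 2 * j"] tendsto_const[of "lam j"]] that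
        by (simp add: power_0_left)
      show "inj (\<lambda>k. (x k)\<^sup>2)" using x(2) by (auto simp: inj_def)
    qed (rule tendsto_const)
    moreover have "eventually (\<lambda>\<epsilon>. coord_map (\<lambda>k. (x k)\<^sup>2) (\<lambda>k. h (of_real \<epsilon> / x k) * x k ^ 7)
        (\<lambda>j. of_real \<epsilon> ^ (14 - 2 * j) * lam j) I = V \<epsilon> I) (at_right 0)"
      using pos
    proof eventually_elim
      case (elim \<epsilon>)
      define e where "e = complex_of_real \<epsilon>"
      have e: "e \<noteq> 0" using elim by (simp add: e_def)
      have "e\<^sup>2 * xs (e *s \<theta>) k = (x k)\<^sup>2" "e ^ 7 * ys (e *s \<theta>) k = h (e / x k) * x k ^ 7" for k
        using e x(1)[of k] by (simp_all add: xs_def ys_def \<theta>_def power_divide)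
      with coord_map_scale[OF e I, of "xs (e *s \<theta>)" "ys (e *s \<theta>)" lam] show ?case
        by (simp add: V_def coord_eq flip: e_def)
    qed
    ultimately show ?thesis by (rule Lim_transform_eventually)
  qed
  \<comment> \<open>A coefficient of weight \<open>m\<close> acquires the factor
    \<open>\<epsilon> ^ (n - m)\<close>, so only weight \<open>n\<close> survives. The case
    \<open>m > n\<close> is set apart because subtraction of naturals truncates; coefficients of
    such weight are 0 by \<open>c\<close> and \<open>d\<close>.\<close>
  have power0: "((\<lambda>\<epsilon>. (if m > n then 0 else of_real \<epsilon> ^ (n - m) * a) * F \<epsilon>) \<longlongrightarrow> (if m = n then a else 0) *
      F0) (at_right 0)"
    if "(F \<longlongrightarrow> F0) (at_right 0)" for m a and F :: "real \<Rightarrow> complex" and F0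
  proof -
    have "((\<lambda>\<epsilon>. (if m > n then 0 else of_real \<epsilon> ^ (n - m) * a)) \<longlongrightarrow> (if m = n then a else 0)) (at_right 0)"
      using tendsto_mult[OF tendsto_power[OF real0, of "n - m"] tendsto_const[of a]]
      by (cases m n rule: linorder_cases) (simp_all add: power_0_left)
    from tendsto_mult[OF this that] show ?thesis .
  qed
  have "((\<lambda>\<epsilon>. bilinear_expr (\<lambda>K. if weight K > n then 0 else of_real \<epsilon> ^ (n - weight K) * c K)
      (\<lambda>I K. if weight I + weight K > n then 0 else of_real \<epsilon> ^ (n - (weight I + weight K)) * d I K) (V \<epsilon>)) \<longlongrightarrow>
     bilinear_expr (\<lambda>K. if weight K = n then c K else 0)
    (\<lambda>I K. if weight I + weight K = n then d I K else 0) ?V0) (at_right 0)"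
    unfolding bilinear_expr_def by (intro tendsto_add tendsto_sum power0 tendsto_mult V) auto
  moreover have "eventually (\<lambda>\<epsilon>. bilinear_expr (\<lambda>K. if weight K > n then 0 else of_real \<epsilon> ^ (n - weight
      K) * c K)
      (\<lambda>I K. if weight I + weight K > n then 0 else of_real \<epsilon> ^ (n - (weight I + weight K)) * d I K) (V \<epsilon>) = 0)
      (at_right 0)"
  proof -
    have "eventually (\<lambda>\<epsilon>. of_real \<epsilon> *s \<theta> \<in> generic) (at_right 0)"
    proof (rule generic_scale)
      show "\<theta> $ k \<noteq> 0" for k using x(1) by (simp add: \<theta>_def)
      show "(\<theta> $ k)\<^sup>2 \<noteq> (\<theta> $ l)\<^sup>2" if "k \<noteq> l" for k l
        using x(2)[OF that] by (simp add: \<theta>_def power_one_over)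
    qed
    then show ?thesis
      using pos
    proof eventually_elim
      case (elim \<epsilon>)
      define e where "e = complex_of_real \<epsilon>"
      have pw: "(if m > n then 0 else e ^ (n - m) * a) * (e ^ m * b) = e ^ n * (a * b)" if "m > n \<Longrightarrow> a =
          0" for m a b
        using that by (cases "m > n") (auto simp: mult_ac power_add[symmetric])
      have "bilinear_expr (\<lambda>K. if weight K > n then 0 else e ^ (n - weight K) * c K)
        (\<lambda>I K. if weight I + weight K > n then 0 else e ^ (n - (weight I + weight K)) * d I K) (V \<epsilon>) =
        e ^ n * bilinear_expr c d (coord (e *s \<theta>))"
        unfolding bilinear_expr_def distrib_left sum_distrib_left
      proof (intro arg_cong2[of _ _ _ _ "(+)"] sum.cong refl)
        fix K assume K: "K \<in> idx3"
        show "(if n < weight K then 0 else e ^ (n - weight K) * c K) * V \<epsilon> K = e ^ n * (c K * coord (e *s \<theta>) K)"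
          unfolding V_def e_def[symmetric] by (rule pw) (use c[OF K] in auto)
        fix I assume I: "I \<in> idx2"
        have "V \<epsilon> I * V \<epsilon> K = e ^ (weight I + weight K) * (coord (e *s \<theta>) I * coord (e *s \<theta>) K)"
          by (simp add: V_def e_def power_add)
        then show "(if n < weight I + weight K then 0 else e ^ (n - (weight I + weight K)) * d I K) * (V
            \<epsilon> I * V \<epsilon> K) =
            e ^ n * (d I K * (coord (e *s \<theta>) I * coord (e *s \<theta>) K))"
          using pw[of "weight I + weight K" "d I K"] d[OF I K] by auto
      qed
      then show ?case
        using relation_on_generic[OF rel assms(2) elim(1)] unfolding e_def[symmetric] by simp
    qed
  qed
  ultimately show ?thesis
    using tendsto_unique[OF trivial_limit_at_right_real _ tendsto_eventually] by blast
qed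

end

section \<open>Completeness of the relations\<close>

text \<open>Modulo the listed relations these 24 products depend on the other 46 symbols.\<close>

definition dependent :: "(3 list \<times> 3 list) set" where
  "dependent = {([3,3], [2,3,3]), ([3,3], [1,3,3]), ([3,3], [2,2,3]), ([2,3], [1,3,3]),
     ([3,3], [1,2,3]), ([3,3], [2,2,2]), ([2,3], [1,2,3]), ([2,3], [2,2,2]),
     ([3,3], [1,1,3]), ([3,3], [1,2,2]), ([1,3], [2,2,2]), ([2,3], [1,1,3]),
     ([2,3], [1,2,2]), ([3,3], [1,1,2]), ([1,3], [1,2,2]), ([2,2], [1,2,2]),
     ([2,3], [1,1,2]), ([3,3], [1,1,1]), ([1,3], [1,1,2]), ([2,2], [1,1,2]),
     ([2,3], [1,1,1]), ([1,3], [1,1,1]), ([2,2], [1,1,1]), ([1,2], [1,1,1])}"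

text \<open>Equality is demanded for all values of the symbols, hence between formal expressions, as
  in the second half of the theorem.\<close>

definition reducible :: "(nat \<Rightarrow> complex) \<Rightarrow> ((3 list \<Rightarrow> complex) \<Rightarrow> complex) \<Rightarrow> bool" where
  "reducible lam f \<longleftrightarrow> (\<exists>a c d. (\<forall>I K. (I, K) \<in> dependent \<longrightarrow> d I K = 0) \<and>
     (\<forall>w. f w = bilinear_expr c d w + (\<Sum>n<24. a n * listed_relations lam w ! n)))"

lemma reducibleI:
  assumes "\<And>I K. (I, K) \<in> dependent \<Longrightarrow> d I K = 0"
    "\<And>w. f w = bilinear_expr c d w + (\<Sum>n<24. a n * listed_relations lam w ! n)"
  shows "reducible lam f"
  unfolding reducible_def
  by (rule exI[of _ a], rule exI[of _ c], rule exI[of _ d]) (use assms in auto)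

lemma reducible_add:
  assumes "reducible lam f" "reducible lam g"
  shows "reducible lam (\<lambda>w. f w + g w)"
proof -
  from assms(1) obtain a c d where 1: "\<forall>I K. (I, K) \<in> dependent \<longrightarrow> d I K = 0"
    "\<forall>w. f w = bilinear_expr c d w + (\<Sum>n<24. a n * listed_relations lam w ! n)"
    unfolding reducible_def by (elim exE conjE)
  from assms(2) obtain a' c' d' where 2: "\<forall>I K. (I, K) \<in> dependent \<longrightarrow> d' I K = 0"
    "\<forall>w. g w = bilinear_expr c' d' w + (\<Sum>n<24. a' n * listed_relations lam w ! n)"
    unfolding reducible_def by (elim exE conjE)
  show ?thesis
    by (rule reducibleI[where a = "\<lambda>n. a n + a' n" and c = "\<lambda>K. c K + c' K" and d = "\<lambda>I K. d I K + d' I K"])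
      (simp_all add: 1 2 bilinear_expr_def distrib_right sum.distrib)
qed

lemma reducible_scale:
  assumes "reducible lam f"
  shows "reducible lam (\<lambda>w. k * f w)"
proof -
  from assms obtain a c d where 1: "\<forall>I K. (I, K) \<in> dependent \<longrightarrow> d I K = 0"
    "\<forall>w. f w = bilinear_expr c d w + (\<Sum>n<24. a n * listed_relations lam w ! n)"
    unfolding reducible_def by (elim exE conjE)
  show ?thesis
    by (rule reducibleI[where a = "\<lambda>n. k * a n" and c = "\<lambda>K. k * c K" and d = "\<lambda>I K. k * d I K"])
      (simp_all add: 1 bilinear_expr_def distrib_left sum_distrib_left mult.assoc)
qed

lemma reducible_zero: "reducible lam (\<lambda>w. 0)"
  by (rule reducibleI[where a = "\<lambda>_. 0" and c = "\<lambda>_. 0" and d = "\<lambda>_ _. 0"]) (simp_all add: bilinear_expr_def)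

lemma reducible_sum:
  "(\<And>k. k \<in> S \<Longrightarrow> reducible lam (f k)) \<Longrightarrow> reducible lam (\<lambda>w. \<Sum>k\<in>S. f k w)"
  by (induction S rule: infinite_finite_induct) (simp_all add: reducible_zero reducible_add)

lemma reducible_relation: "m < 24 \<Longrightarrow> reducible lam (\<lambda>w. listed_relations lam w ! m)"
  by (rule reducibleI[where a = "\<lambda>n. if n = m then 1 else 0" and c = "\<lambda>_. 0" and d = "\<lambda>_ _. 0"])
    (simp_all add: bilinear_expr_def if_distrib[of "\<lambda>x. x * _"] cong: if_cong)

lemma finite_idx [simp]: "finite idx2" "finite idx3"
  by (simp_all add: idx2_def idx3_def)

lemma reducible_single:
  assumes "K \<in> idx3"
  shows "reducible lam (\<lambda>w. w K)"
  by (rule reducibleI[where a = "\<lambda>_. 0" and c = "\<lambda>K'. if K' = K then 1 else 0" and d = "\<lambda>_ _. 0"])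
    (use assms in \<open>simp_all add: bilinear_expr_def if_distrib[of "\<lambda>x. x * _"] cong: if_cong\<close>)

lemma reducible_prod:
  assumes "I \<in> idx2" "K \<in> idx3" "(I, K) \<notin> dependent"
  shows "reducible lam (\<lambda>w. w I * w K)"
proof -
  define d :: "3 list \<Rightarrow> 3 list \<Rightarrow> complex" where "d I' K' = (if I' = I then if K' = K then 1 else 0 else
      0)" for I' K'
  have inner: "(\<Sum>K'\<in>idx3. d I' K' * (w I' * w K')) = (if I' = I then w I * w K else 0)" for I' w
    unfolding d_def using assms(2) by (simp add: if_distrib[of "\<lambda>x. x * _"] cong: if_cong)
  have "bilinear_expr (\<lambda>_. 0) d w = w I * w K" for w
    unfolding bilinear_expr_def inner using assms(1) by simp
  moreover have "d I' K' = 0" if "(I', K') \<in> dependent" for I' K' using assms(3) that by (auto simp: d_def)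
  ultimately show ?thesis
    by (intro reducibleI[where a = "\<lambda>_. 0" and c = "\<lambda>_. 0" and d = d]) simp_all
qed

lemma reducible_cancel:
  assumes "reducible lam (\<lambda>w. k * f w)" "k \<noteq> 0"
  shows "reducible lam f"
  using reducible_scale[OF assms(1), of "1 / k"] assms(2) by simp

text \<open>The multipliers bring the list into reduced echelon form with the products in
  \<open>dependent\<close> as pivots: each combination isolates one pivot, with a factor 1, 2 or 3,
  in terms of 3-index symbols and independent products. No pivot relies on another one.\<close>

lemma reducible_dependent:
  assumes "(I, K) \<in> dependent"
  shows "reducible lam (\<lambda>w. w I * w K)"
proof -
  note red = reducible_add reducible_scale reducible_relation reducible_single reducible_prod

  have "reducible lam (\<lambda>w. (listed_relations lam w ! 0) + (w [1,3,3] + ((-1) * w [2,2,3] + (w [2,3] * w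
      [3,3,3]))))"
    by (intro red) (simp_all add: idx2_def idx3_def dependent_def)
  also have "\<dots> = (\<lambda>w. w [3,3] * w [2,3,3])"
    by (rule ext) (simp add: listed_relations_def; algebra)
  finally have r0: "reducible lam (\<lambda>w. w [3,3] * w [2,3,3])" .

  have "reducible lam (\<lambda>w. (listed_relations lam w ! 1) + ((-1) * w [1,2,3] + (w [1,3] * w [3,3,3])))"
    by (intro red) (simp_all add: idx2_def idx3_def dependent_def)
  also have "\<dots> = (\<lambda>w. w [3,3] * w [1,3,3])"
    by (rule ext) (simp add: listed_relations_def; algebra)
  finally have r1: "reducible lam (\<lambda>w. w [3,3] * w [1,3,3])" .

  have "reducible lam (\<lambda>w. (-1) * (listed_relations lam w ! 2) + ((-4) * w [1,2,3] + ((2 * lam 6) * w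
      [1,3,3] + (w [2,2,2] + (((-2) * lam 6) * w [2,2,3] + (lam 5 * w [2,3,3] + (w [2,2] * w [3,3,3] +
      (w [2,3] * w [2,3,3]))))))))"
    by (intro red) (simp_all add: idx2_def idx3_def dependent_def)
  also have "\<dots> = (\<lambda>w. 2 * (w [3,3] * w [2,2,3]))"
    by (rule ext) (simp add: listed_relations_def; algebra)
  finally have r2: "reducible lam (\<lambda>w. w [3,3] * w [2,2,3])" by (rule reducible_cancel) simp

  have "reducible lam (\<lambda>w. (-1) * (listed_relations lam w ! 3) + ((-1) * w [1,1,3] + (w [1,3] * w [2,3,3])))"
    by (intro red) (simp_all add: idx2_def idx3_def dependent_def)
  also have "\<dots> = (\<lambda>w. w [2,3] * w [1,3,3])"
    by (rule ext) (simp add: listed_relations_def; algebra)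
  finally have r3: "reducible lam (\<lambda>w. w [2,3] * w [1,3,3])" .

  have "reducible lam (\<lambda>w. (listed_relations lam w ! 3) + ((-1) * (listed_relations lam w ! 5) + ((-2) *
      w [1,1,3] + (w [1,2,2] + (((-2) * lam 6) * w [1,2,3] + (lam 5 * w [1,3,3] + (w [1,2] * w [3,3,3] +
      (w [1,3] * w [2,3,3]))))))))"
    by (intro red) (simp_all add: idx2_def idx3_def dependent_def)
  also have "\<dots> = (\<lambda>w. 2 * (w [3,3] * w [1,2,3]))"
    by (rule ext) (simp add: listed_relations_def; algebra)
  finally have r4: "reducible lam (\<lambda>w. w [3,3] * w [1,2,3])" by (rule reducible_cancel) simp

  have "reducible lam (\<lambda>w. (listed_relations lam w ! 4) + ((-3) * w [1,1,3] + (w [1,2,2] + (((-2) * lam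
      6) * w [1,2,3] + ((2 * lam 5) * w [1,3,3] + (((-1) * lam 5) * w [2,2,3] + ((2 * lam 4) * w [2,3,3]
      + (((-1) * lam 3) * w [3,3,3] + (2 * (w [2,2] * w [2,3,3]) + ((-1) * (w [2,3] * w
      [2,2,3])))))))))))"
    by (intro red) (simp_all add: idx2_def idx3_def dependent_def)
  also have "\<dots> = (\<lambda>w. w [3,3] * w [2,2,2])"
    by (rule ext) (simp add: listed_relations_def; algebra)
  finally have r5: "reducible lam (\<lambda>w. w [3,3] * w [2,2,2])" .

  have "reducible lam (\<lambda>w. (-1) * (listed_relations lam w ! 8) + (w [1,1,2] + (((-2) * lam 6) * w
      [1,1,3] + (w [1,2] * w [2,3,3] + (2 * (w [1,3] * w [2,2,3]) + ((-1) * (w [2,2] * w [1,3,3])))))))"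
    by (intro red) (simp_all add: idx2_def idx3_def dependent_def)
  also have "\<dots> = (\<lambda>w. 2 * (w [2,3] * w [1,2,3]))"
    by (rule ext) (simp add: listed_relations_def; algebra)
  finally have r6: "reducible lam (\<lambda>w. w [2,3] * w [1,2,3])" by (rule reducible_cancel) simp

  have "reducible lam (\<lambda>w. (-1) * (listed_relations lam w ! 6) + (w [1,1,2] + (((-2) * lam 6) * w
      [1,1,3] + (lam 3 * w [2,3,3] + (((-2) * lam 2) * w [3,3,3] + ((-2) * (w [1,1] * w [3,3,3]) + (2 *
      (w [1,2] * w [2,3,3]) + (2 * (w [1,3] * w [1,3,3]) + ((-2) * (w [2,2] * w [1,3,3]) + (w [2,2] * w
      [2,2,3]))))))))))"
    by (intro red) (simp_all add: idx2_def idx3_def dependent_def)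
  also have "\<dots> = (\<lambda>w. w [2,3] * w [2,2,2])"
    by (rule ext) (simp add: listed_relations_def; algebra)
  finally have r7: "reducible lam (\<lambda>w. w [2,3] * w [2,2,2])" .

  have "reducible lam (\<lambda>w. 2 * (listed_relations lam w ! 7) + ((-1) * (listed_relations lam w ! 8) + (w
      [1,1,2] + (((-2) * lam 6) * w [1,1,3] + (w [1,2] * w [2,3,3] + (2 * (w [1,3] * w [1,3,3]) + ((-1)
      * (w [2,2] * w [1,3,3]))))))))"
    by (intro red) (simp_all add: idx2_def idx3_def dependent_def)
  also have "\<dots> = (\<lambda>w. 2 * (w [3,3] * w [1,1,3]))"
    by (rule ext) (simp add: listed_relations_def; algebra)
  finally have r8: "reducible lam (\<lambda>w. w [3,3] * w [1,1,3])" by (rule reducible_cancel) simp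

  have "reducible lam (\<lambda>w. (listed_relations lam w ! 9) + (((-1) * lam 5) * w [1,2,3] + ((2 * lam 4) * w
      [1,3,3] + (w [1,1] * w [3,3,3] + ((-1) * (w [1,3] * w [1,3,3]) + ((-1) * (w [1,3] * w [2,2,3]) +
      (2 * (w [2,2] * w [1,3,3]))))))))"
    by (intro red) (simp_all add: idx2_def idx3_def dependent_def)
  also have "\<dots> = (\<lambda>w. w [3,3] * w [1,2,2])"
    by (rule ext) (simp add: listed_relations_def; algebra)
  finally have r9: "reducible lam (\<lambda>w. w [3,3] * w [1,2,2])" .

  have "reducible lam (\<lambda>w. (-1) * (listed_relations lam w ! 10) + ((-1) * (listed_relations lam w ! 12)
      + ((listed_relations lam w ! 13) + (((-3) * lam 1) * w [3,3,3] + ((-3) * (w [1,1] * w [2,3,3]) +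
      ((-3) * (w [1,2] * w [1,3,3]) + (3 * (w [1,2] * w [2,2,3]) + (6 * (w [1,3] * w [1,2,3])))))))))"
    by (intro red) (simp_all add: idx2_def idx3_def dependent_def)
  also have "\<dots> = (\<lambda>w. 3 * (w [1,3] * w [2,2,2]))"
    by (rule ext) (simp add: listed_relations_def; algebra)
  finally have r10: "reducible lam (\<lambda>w. w [1,3] * w [2,2,2])" by (rule reducible_cancel) simp

  have "reducible lam (\<lambda>w. (listed_relations lam w ! 10) + ((-3) * (listed_relations lam w ! 11) + ((-2)
      * (listed_relations lam w ! 12) + ((-1) * (listed_relations lam w ! 13) + (3 * w [1,1,1] + (((-3)
      * lam 5) * w [1,1,3] + ((-3) * (w [1,2] * w [1,3,3]) + (3 * (w [1,2] * w [2,2,3]) + (6 * (w [1,3]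
      * w [1,2,3]) + ((-3) * (w [2,2] * w [1,2,3])))))))))))"
    by (intro red) (simp_all add: idx2_def idx3_def dependent_def)
  also have "\<dots> = (\<lambda>w. 3 * (w [2,3] * w [1,1,3]))"
    by (rule ext) (simp add: listed_relations_def; algebra)
  finally have r11: "reducible lam (\<lambda>w. w [2,3] * w [1,1,3])" by (rule reducible_cancel) simp

  have "reducible lam (\<lambda>w. (-1) * (listed_relations lam w ! 11) + (w [1,1,1] + (((-1) * lam 5) * w
      [1,1,3] + (lam 3 * w [1,3,3] + (((-1) * lam 1) * w [3,3,3] + (w [1,2] * w [2,2,3]))))))"
    by (intro red) (simp_all add: idx2_def idx3_def dependent_def)
  also have "\<dots> = (\<lambda>w. w [2,3] * w [1,2,2])"
    by (rule ext) (simp add: listed_relations_def; algebra)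
  finally have r12: "reducible lam (\<lambda>w. w [2,3] * w [1,2,2])" .

  have "reducible lam (\<lambda>w. (-1) * (listed_relations lam w ! 10) + (3 * (listed_relations lam w ! 11) +
      (2 * (listed_relations lam w ! 12) + ((-2) * (listed_relations lam w ! 13) + ((-3) * w [1,1,1] +
      ((3 * lam 3) * w [1,3,3] + (3 * (w [1,1] * w [2,3,3]) + (6 * (w [1,2] * w [1,3,3]) + ((-3) * (w
      [1,2] * w [2,2,3]) + ((-6) * (w [1,3] * w [1,2,3]) + (3 * (w [2,2] * w [1,2,3]))))))))))))"
    by (intro red) (simp_all add: idx2_def idx3_def dependent_def)
  also have "\<dots> = (\<lambda>w. 3 * (w [3,3] * w [1,1,2]))"
    by (rule ext) (simp add: listed_relations_def; algebra)
  finally have r13: "reducible lam (\<lambda>w. w [3,3] * w [1,1,2])" by (rule reducible_cancel) simp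

  have "reducible lam (\<lambda>w. (-1) * (listed_relations lam w ! 16) + ((listed_relations lam w ! 17) +
      (((-6) * lam 0) * w [3,3,3] + ((-3) * (w [1,1] * w [1,3,3]) + (3 * (w [1,2] * w [1,2,3]) + (3 * (w
      [1,3] * w [1,1,3])))))))"
    by (intro red) (simp_all add: idx2_def idx3_def dependent_def)
  also have "\<dots> = (\<lambda>w. 3 * (w [1,3] * w [1,2,2]))"
    by (rule ext) (simp add: listed_relations_def; algebra)
  finally have r14: "reducible lam (\<lambda>w. w [1,3] * w [1,2,2])" by (rule reducible_cancel) simp

  have "reducible lam (\<lambda>w. (-1) * (listed_relations lam w ! 14) + ((-2) * (listed_relations lam w ! 15)
      + (2 * (listed_relations lam w ! 16) + (2 * (listed_relations lam w ! 17) + ((2 * lam 6) * w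
      [1,1,1] + (((-1) * lam 5) * w [1,1,2] + (((-4) * lam 4) * w [1,1,3] + ((2 * lam 3) * w [1,2,3] +
      (((-2) * lam 2) * w [1,3,3] + (lam 1 * w [2,3,3] + (((-4) * lam 0) * w [3,3,3] + ((-6) * (w [1,1]
      * w [1,3,3]) + (2 * (w [1,1] * w [2,2,3]) + (2 * (w [1,2] * w [1,2,3]) + (w [1,2] * w [2,2,2] + (6
      * (w [1,3] * w [1,1,3]) + ((-4) * (w [2,2] * w [1,1,3]))))))))))))))))))"
    by (intro red) (simp_all add: idx2_def idx3_def dependent_def)
  also have "\<dots> = (\<lambda>w. w [2,2] * w [1,2,2])"
    by (rule ext) (simp add: listed_relations_def; algebra)
  finally have r15: "reducible lam (\<lambda>w. w [2,2] * w [1,2,2])" .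

  have "reducible lam (\<lambda>w. (-1) * (listed_relations lam w ! 16) + ((-2) * (listed_relations lam w ! 17)
      + ((6 * lam 2) * w [1,3,3] + (((-3) * lam 1) * w [2,3,3] + (6 * (w [1,1] * w [1,3,3]) + ((-6) * (w
      [1,3] * w [1,1,3]) + (3 * (w [2,2] * w [1,1,3]))))))))"
    by (intro red) (simp_all add: idx2_def idx3_def dependent_def)
  also have "\<dots> = (\<lambda>w. 3 * (w [2,3] * w [1,1,2]))"
    by (rule ext) (simp add: listed_relations_def; algebra)
  finally have r16: "reducible lam (\<lambda>w. w [2,3] * w [1,1,2])" by (rule reducible_cancel) simp

  have "reducible lam (\<lambda>w. (-1) * (listed_relations lam w ! 15) + ((listed_relations lam w ! 16) +
      (((-2) * lam 4) * w [1,1,3] + (lam 3 * w [1,2,3] + ((-1) * (w [1,1] * w [1,3,3]) + (w [1,1] * w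
      [2,2,3] + (w [1,2] * w [1,2,3] + (2 * (w [1,3] * w [1,1,3]) + ((-2) * (w [2,2] * w
      [1,1,3]))))))))))"
    by (intro red) (simp_all add: idx2_def idx3_def dependent_def)
  also have "\<dots> = (\<lambda>w. w [3,3] * w [1,1,1])"
    by (rule ext) (simp add: listed_relations_def; algebra)
  finally have r17: "reducible lam (\<lambda>w. w [3,3] * w [1,1,1])" .

  have "reducible lam (\<lambda>w. (-1) * (listed_relations lam w ! 19) + (lam 1 * w [1,3,3] + (((-2) * lam 0) *
      w [2,3,3] + (w [1,2] * w [1,1,3]))))"
    by (intro red) (simp_all add: idx2_def idx3_def dependent_def)
  also have "\<dots> = (\<lambda>w. w [1,3] * w [1,1,2])"
    by (rule ext) (simp add: listed_relations_def; algebra)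
  finally have r18: "reducible lam (\<lambda>w. w [1,3] * w [1,1,2])" .

  have "reducible lam (\<lambda>w. (-1) * (listed_relations lam w ! 18) + (lam 5 * w [1,1,1] + (((-2) * lam 4) *
      w [1,1,2] + (((-2) * lam 3) * w [1,1,3] + (lam 3 * w [1,2,2] + ((2 * lam 2) * w [1,2,3] + ((3 *
      lam 1) * w [1,3,3] + (((-1) * lam 1) * w [2,2,3] + (((-4) * lam 0) * w [2,3,3] + (w [1,1] * w
      [2,2,2] + (w [1,2] * w [1,2,2])))))))))))"
    by (intro red) (simp_all add: idx2_def idx3_def dependent_def)
  also have "\<dots> = (\<lambda>w. 2 * (w [2,2] * w [1,1,2]))"
    by (rule ext) (simp add: listed_relations_def; algebra)
  finally have r19: "reducible lam (\<lambda>w. w [2,2] * w [1,1,2])" by (rule reducible_cancel) simp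

  have "reducible lam (\<lambda>w. 2 * (listed_relations lam w ! 19) + ((listed_relations lam w ! 20) + (((-1) *
      lam 3) * w [1,1,3] + ((2 * lam 2) * w [1,2,3] + (lam 1 * w [1,3,3] + (((-1) * lam 1) * w [2,2,3] +
      (2 * (w [1,1] * w [1,2,3]) + ((-1) * (w [1,2] * w [1,1,3])))))))))"
    by (intro red) (simp_all add: idx2_def idx3_def dependent_def)
  also have "\<dots> = (\<lambda>w. w [2,3] * w [1,1,1])"
    by (rule ext) (simp add: listed_relations_def; algebra)
  finally have r20: "reducible lam (\<lambda>w. w [2,3] * w [1,1,1])" .

  have "reducible lam (\<lambda>w. (listed_relations lam w ! 22) + (lam 1 * w [1,2,3] + ((2 * lam 0) * w [1,3,3]
      + (((-2) * lam 0) * w [2,2,3] + (w [1,1] * w [1,1,3])))))"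
    by (intro red) (simp_all add: idx2_def idx3_def dependent_def)
  also have "\<dots> = (\<lambda>w. w [1,3] * w [1,1,1])"
    by (rule ext) (simp add: listed_relations_def; algebra)
  finally have r21: "reducible lam (\<lambda>w. w [1,3] * w [1,1,1])" .

  have "reducible lam (\<lambda>w. (listed_relations lam w ! 21) + (((-1) * lam 3) * w [1,1,2] + (((-2) * lam 2)
      * w [1,1,3] + ((2 * lam 2) * w [1,2,2] + ((4 * lam 1) * w [1,2,3] + ((4 * lam 0) * w [1,3,3] +
      (((-1) * lam 1) * w [2,2,2] + (((-4) * lam 0) * w [2,2,3] + (2 * (w [1,1] * w [1,2,2]) + ((-1) *
      (w [1,2] * w [1,1,2])))))))))))"
    by (intro red) (simp_all add: idx2_def idx3_def dependent_def)
  also have "\<dots> = (\<lambda>w. w [2,2] * w [1,1,1])"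
    by (rule ext) (simp add: listed_relations_def; algebra)
  finally have r22: "reducible lam (\<lambda>w. w [2,2] * w [1,1,1])" .

  have "reducible lam (\<lambda>w. (listed_relations lam w ! 23) + (((-1) * lam 1) * w [1,1,3] + (lam 1 * w
      [1,2,2] + ((4 * lam 0) * w [1,2,3] + (((-2) * lam 0) * w [2,2,2] + (w [1,1] * w [1,1,2]))))))"
    by (intro red) (simp_all add: idx2_def idx3_def dependent_def)
  also have "\<dots> = (\<lambda>w. w [1,2] * w [1,1,1])"
    by (rule ext) (simp add: listed_relations_def; algebra)
  finally have r23: "reducible lam (\<lambda>w. w [1,2] * w [1,1,1])" .

  have "\<forall>(I, K)\<in>dependent. reducible lam (\<lambda>w. w I * w K)"
    unfolding dependent_def ball_simps prod.case
    by (intro conjI TrueI r0 r1 r2 r3 r4 r5 r6 r7 r8 r9 r10 r11 r12 r13 r14 r15 r16 r17 r18 r19 r20 r21 r22 r23)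
  then show ?thesis using assms by blast
qed

lemma reducible_bilinear_expr: "reducible lam (bilinear_expr c d)"
proof -
  have "reducible lam (\<lambda>w. w I * w K)" if "I \<in> idx2" "K \<in> idx3" for I K
    using that reducible_prod reducible_dependent by blast
  then show ?thesis
    unfolding bilinear_expr_def[abs_def]
    by (intro reducible_add reducible_sum reducible_scale reducible_single)
qed

text \<open>The \<open>\<wp>\<close> functions of \<open>y\<^sup>2 = x\<^sup>7\<close> in terms of the points \<open>(r\<^sup>2, r\<^sup>7)\<close>, \<open>r = a, b, c\<close>.\<close>

definition cusp_wp :: "complex \<Rightarrow> complex \<Rightarrow> complex \<Rightarrow> 3 list \<Rightarrow> complex" where
  "cusp_wp a b c = (let r = (vector [a, b, c] :: complex ^ 3)
     in coord_map (\<lambda>k. (r $ k)\<^sup>2) (\<lambda>k. (r $ k) ^ 7) (\<lambda>_. 0))"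

text \<open>The sign of an entry of the triple is the choice of y over x = r^2. Within each triple
  the fourth powers of the entries, and so the points, are distinct up to what
  \<open>top_weight_relation\<close> requires. The largest weight parts have seven unknowns, which
  fixes the number of triples.\<close>

lemma cusp_wp_values_1:
  "cusp_wp 1 (-2) (-3) [1,1] = 324 / 25"
  "cusp_wp 1 (-2) (-3) [1,2] = - 1089 / 25"
  "cusp_wp 1 (-2) (-3) [1,3] = 36"
  "cusp_wp 1 (-2) (-3) [2,2] = 10321 / 100"
  "cusp_wp 1 (-2) (-3) [2,3] = -49"
  "cusp_wp 1 (-2) (-3) [3,3] = 14"
  "cusp_wp 1 (-2) (-3) [1,1,1] = - 11664 / 125"
  "cusp_wp 1 (-2) (-3) [1,1,2] = 39204 / 125"
  "cusp_wp 1 (-2) (-3) [1,1,3] = - 1296 / 5"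
  "cusp_wp 1 (-2) (-3) [1,2,2] = - 112329 / 125"
  "cusp_wp 1 (-2) (-3) [1,2,3] = 612"
  "cusp_wp 1 (-2) (-3) [1,3,3] = - 1404 / 5"
  "cusp_wp 1 (-2) (-3) [2,2,2] = 987481 / 500"
  "cusp_wp 1 (-2) (-3) [2,2,3] = -1013"
  "cusp_wp 1 (-2) (-3) [2,3,3] = 375"
  "cusp_wp 1 (-2) (-3) [3,3,3] = - 461 / 5"
  by (simp_all add: cusp_wp_def Let_def coord_map_def wp_coord_simps coord_u_def coord_v_def coord_w_def
      power_divide)

lemma cusp_wp_values_2:
  "cusp_wp 1 (-2) (-4) [1,1] = 4096 / 81"
  "cusp_wp 1 (-2) (-4) [1,2] = - 9472 / 81"
  "cusp_wp 1 (-2) (-4) [1,3] = 64"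
  "cusp_wp 1 (-2) (-4) [2,2] = 17296 / 81"
  "cusp_wp 1 (-2) (-4) [2,3] = -84"
  "cusp_wp 1 (-2) (-4) [3,3] = 21"
  "cusp_wp 1 (-2) (-4) [1,1,1] = - 524288 / 729"
  "cusp_wp 1 (-2) (-4) [1,1,2] = 1212416 / 729"
  "cusp_wp 1 (-2) (-4) [1,1,3] = - 8192 / 9"
  "cusp_wp 1 (-2) (-4) [1,2,2] = - 2508800 / 729"
  "cusp_wp 1 (-2) (-4) [1,2,3] = 14848 / 9"
  "cusp_wp 1 (-2) (-4) [1,3,3] = - 5504 / 9"
  "cusp_wp 1 (-2) (-4) [2,2,2] = 4437632 / 729"
  "cusp_wp 1 (-2) (-4) [2,2,3] = - 22304 / 9"
  "cusp_wp 1 (-2) (-4) [2,3,3] = 7096 / 9"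
  "cusp_wp 1 (-2) (-4) [3,3,3] = - 1574 / 9"
  by (simp_all add: cusp_wp_def Let_def coord_map_def wp_coord_simps coord_u_def coord_v_def coord_w_def
      power_divide)

lemma cusp_wp_values_3:
  "cusp_wp 1 (-2) 3 [1,1] = 2025"
  "cusp_wp 1 (-2) 3 [1,2] = - 7785 / 4"
  "cusp_wp 1 (-2) 3 [1,3] = 36"
  "cusp_wp 1 (-2) 3 [2,2] = 31657 / 16"
  "cusp_wp 1 (-2) 3 [2,3] = -49"
  "cusp_wp 1 (-2) 3 [3,3] = 14"
  "cusp_wp 1 (-2) 3 [1,1,1] = 182250"
  "cusp_wp 1 (-2) 3 [1,1,2] = - 350325 / 2"
  "cusp_wp 1 (-2) 3 [1,1,3] = 3240"
  "cusp_wp 1 (-2) 3 [1,2,2] = 1385685 / 8"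
  "cusp_wp 1 (-2) 3 [1,2,3] = -3762"
  "cusp_wp 1 (-2) 3 [1,3,3] = 594"
  "cusp_wp 1 (-2) 3 [2,2,2] = - 5626133 / 32"
  "cusp_wp 1 (-2) 3 [2,2,3] = 8909 / 2"
  "cusp_wp 1 (-2) 3 [2,3,3] = - 1437 / 2"
  "cusp_wp 1 (-2) 3 [3,3,3] = 253 / 2"
  by (simp_all add: cusp_wp_def Let_def coord_map_def wp_coord_simps coord_u_def coord_v_def coord_w_def
      power_divide)

lemma cusp_wp_values_4:
  "cusp_wp 1 (-2) 4 [1,1] = 36864 / 25"
  "cusp_wp 1 (-2) 4 [1,2] = - 36096 / 25"
  "cusp_wp 1 (-2) 4 [1,3] = 64"
  "cusp_wp 1 (-2) 4 [2,2] = 37904 / 25"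
  "cusp_wp 1 (-2) 4 [2,3] = -84"
  "cusp_wp 1 (-2) 4 [3,3] = 21"
  "cusp_wp 1 (-2) 4 [1,1,1] = 14155776 / 125"
  "cusp_wp 1 (-2) 4 [1,1,2] = - 13860864 / 125"
  "cusp_wp 1 (-2) 4 [1,1,3] = 24576 / 5"
  "cusp_wp 1 (-2) 4 [1,2,2] = 14063616 / 125"
  "cusp_wp 1 (-2) 4 [1,2,3] = -5632"
  "cusp_wp 1 (-2) 4 [1,3,3] = 4224 / 5"
  "cusp_wp 1 (-2) 4 [2,2,2] = - 14733184 / 125"
  "cusp_wp 1 (-2) 4 [2,2,3] = 6624"
  "cusp_wp 1 (-2) 4 [2,3,3] = -1032"
  "cusp_wp 1 (-2) 4 [3,3,3] = 946 / 5"
  by (simp_all add: cusp_wp_def Let_def coord_map_def wp_coord_simps coord_u_def coord_v_def coord_w_def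
      power_divide)

lemma cusp_wp_values_5:
  "cusp_wp 1 2 (-3) [1,1] = 1764"
  "cusp_wp 1 2 (-3) [1,2] = -1897"
  "cusp_wp 1 2 (-3) [1,3] = 36"
  "cusp_wp 1 2 (-3) [2,2] = 70849 / 36"
  "cusp_wp 1 2 (-3) [2,3] = -49"
  "cusp_wp 1 2 (-3) [3,3] = 14"
  "cusp_wp 1 2 (-3) [1,1,1] = -148176"
  "cusp_wp 1 2 (-3) [1,1,2] = 159348"
  "cusp_wp 1 2 (-3) [1,1,3] = -3024"
  "cusp_wp 1 2 (-3) [1,2,2] = - 505015 / 3"
  "cusp_wp 1 2 (-3) [1,2,3] = 3684"
  "cusp_wp 1 2 (-3) [1,3,3] = -588"
  "cusp_wp 1 2 (-3) [2,2,2] = 18848863 / 108"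
  "cusp_wp 1 2 (-3) [2,2,3] = - 13279 / 3"
  "cusp_wp 1 2 (-3) [2,3,3] = 2149 / 3"
  "cusp_wp 1 2 (-3) [3,3,3] = - 379 / 3"
  by (simp_all add: cusp_wp_def Let_def coord_map_def wp_coord_simps coord_u_def coord_v_def coord_w_def
      power_divide)

lemma cusp_wp_values_6:
  "cusp_wp 1 2 (-4) [1,1] = 102400 / 81"
  "cusp_wp 1 2 (-4) [1,2] = - 113920 / 81"
  "cusp_wp 1 2 (-4) [1,3] = 64"
  "cusp_wp 1 2 (-4) [2,2] = 122128 / 81"
  "cusp_wp 1 2 (-4) [2,3] = -84"
  "cusp_wp 1 2 (-4) [3,3] = 21"
  "cusp_wp 1 2 (-4) [1,1,1] = - 65536000 / 729"
  "cusp_wp 1 2 (-4) [1,1,2] = 72908800 / 729"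
  "cusp_wp 1 2 (-4) [1,1,3] = - 40960 / 9"
  "cusp_wp 1 2 (-4) [1,2,2] = - 79636480 / 729"
  "cusp_wp 1 2 (-4) [1,2,3] = 49664 / 9"
  "cusp_wp 1 2 (-4) [1,3,3] = - 7552 / 9"
  "cusp_wp 1 2 (-4) [2,2,2] = 85314688 / 729"
  "cusp_wp 1 2 (-4) [2,2,3] = - 59296 / 9"
  "cusp_wp 1 2 (-4) [2,3,3] = 9272 / 9"
  "cusp_wp 1 2 (-4) [3,3,3] = - 1702 / 9"
  by (simp_all add: cusp_wp_def Let_def coord_map_def wp_coord_simps coord_u_def coord_v_def coord_w_def
      power_divide)

lemma cusp_wp_values_7:
  "cusp_wp 1 (-2) (-5) [1,1] = 5625 / 49"
  "cusp_wp 1 (-2) (-5) [1,2] = - 44025 / 196"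
  "cusp_wp 1 (-2) (-5) [1,3] = 100"
  "cusp_wp 1 (-2) (-5) [2,2] = 288569 / 784"
  "cusp_wp 1 (-2) (-5) [2,3] = -129"
  "cusp_wp 1 (-2) (-5) [3,3] = 30"
  "cusp_wp 1 (-2) (-5) [1,1,1] = - 843750 / 343"
  "cusp_wp 1 (-2) (-5) [1,1,2] = 3301875 / 686"
  "cusp_wp 1 (-2) (-5) [1,1,3] = - 15000 / 7"
  "cusp_wp 1 (-2) (-5) [1,2,2] = - 23742675 / 2744"
  "cusp_wp 1 (-2) (-5) [1,2,3] = 24350 / 7"
  "cusp_wp 1 (-2) (-5) [1,3,3] = - 7950 / 7"
  "cusp_wp 1 (-2) (-5) [2,2,2] = 152954003 / 10976"
  "cusp_wp 1 (-2) (-5) [2,2,3] = - 69723 / 14"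
  "cusp_wp 1 (-2) (-5) [2,3,3] = 20211 / 14"
  "cusp_wp 1 (-2) (-5) [3,3,3] = - 4283 / 14"
  by (simp_all add: cusp_wp_def Let_def coord_map_def wp_coord_simps coord_u_def coord_v_def coord_w_def
      power_divide)

section \<open>Splitting a reduced relation by weight\<close>

definition top_part :: "nat \<Rightarrow> (3 list \<Rightarrow> complex) \<Rightarrow> (3 list \<Rightarrow> 3 list \<Rightarrow> complex) \<Rightarrow> (3 list \<Rightarrow> complex) \<Rightarrow>
    complex" where
  "top_part n c d = bilinear_expr (\<lambda>K. if weight K = n then c K else 0)
     (\<lambda>I K. if weight I + weight K = n then d I K else 0)"

lemma bilinear_expr_expand: "bilinear_expr c d w =
  c [1,1,1] * w [1,1,1] + c [1,1,2] * w [1,1,2] +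
  c [1,1,3] * w [1,1,3] + c [1,2,2] * w [1,2,2] +
  c [1,2,3] * w [1,2,3] + c [1,3,3] * w [1,3,3] +
  c [2,2,2] * w [2,2,2] + c [2,2,3] * w [2,2,3] +
  c [2,3,3] * w [2,3,3] + c [3,3,3] * w [3,3,3] +
  d [1,1] [1,1,1] * (w [1,1] * w [1,1,1]) + d [1,1] [1,1,2] * (w [1,1] * w [1,1,2]) +
  d [1,1] [1,1,3] * (w [1,1] * w [1,1,3]) + d [1,1] [1,2,2] * (w [1,1] * w [1,2,2]) +
  d [1,1] [1,2,3] * (w [1,1] * w [1,2,3]) + d [1,1] [1,3,3] * (w [1,1] * w [1,3,3]) +
  d [1,1] [2,2,2] * (w [1,1] * w [2,2,2]) + d [1,1] [2,2,3] * (w [1,1] * w [2,2,3]) +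
  d [1,1] [2,3,3] * (w [1,1] * w [2,3,3]) + d [1,1] [3,3,3] * (w [1,1] * w [3,3,3]) +
  d [1,2] [1,1,1] * (w [1,2] * w [1,1,1]) + d [1,2] [1,1,2] * (w [1,2] * w [1,1,2]) +
  d [1,2] [1,1,3] * (w [1,2] * w [1,1,3]) + d [1,2] [1,2,2] * (w [1,2] * w [1,2,2]) +
  d [1,2] [1,2,3] * (w [1,2] * w [1,2,3]) + d [1,2] [1,3,3] * (w [1,2] * w [1,3,3]) +
  d [1,2] [2,2,2] * (w [1,2] * w [2,2,2]) + d [1,2] [2,2,3] * (w [1,2] * w [2,2,3]) +
  d [1,2] [2,3,3] * (w [1,2] * w [2,3,3]) + d [1,2] [3,3,3] * (w [1,2] * w [3,3,3]) +
  d [1,3] [1,1,1] * (w [1,3] * w [1,1,1]) + d [1,3] [1,1,2] * (w [1,3] * w [1,1,2]) +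
  d [1,3] [1,1,3] * (w [1,3] * w [1,1,3]) + d [1,3] [1,2,2] * (w [1,3] * w [1,2,2]) +
  d [1,3] [1,2,3] * (w [1,3] * w [1,2,3]) + d [1,3] [1,3,3] * (w [1,3] * w [1,3,3]) +
  d [1,3] [2,2,2] * (w [1,3] * w [2,2,2]) + d [1,3] [2,2,3] * (w [1,3] * w [2,2,3]) +
  d [1,3] [2,3,3] * (w [1,3] * w [2,3,3]) + d [1,3] [3,3,3] * (w [1,3] * w [3,3,3]) +
  d [2,2] [1,1,1] * (w [2,2] * w [1,1,1]) + d [2,2] [1,1,2] * (w [2,2] * w [1,1,2]) +
  d [2,2] [1,1,3] * (w [2,2] * w [1,1,3]) + d [2,2] [1,2,2] * (w [2,2] * w [1,2,2]) +
  d [2,2] [1,2,3] * (w [2,2] * w [1,2,3]) + d [2,2] [1,3,3] * (w [2,2] * w [1,3,3]) +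
  d [2,2] [2,2,2] * (w [2,2] * w [2,2,2]) + d [2,2] [2,2,3] * (w [2,2] * w [2,2,3]) +
  d [2,2] [2,3,3] * (w [2,2] * w [2,3,3]) + d [2,2] [3,3,3] * (w [2,2] * w [3,3,3]) +
  d [2,3] [1,1,1] * (w [2,3] * w [1,1,1]) + d [2,3] [1,1,2] * (w [2,3] * w [1,1,2]) +
  d [2,3] [1,1,3] * (w [2,3] * w [1,1,3]) + d [2,3] [1,2,2] * (w [2,3] * w [1,2,2]) +
  d [2,3] [1,2,3] * (w [2,3] * w [1,2,3]) + d [2,3] [1,3,3] * (w [2,3] * w [1,3,3]) +
  d [2,3] [2,2,2] * (w [2,3] * w [2,2,2]) + d [2,3] [2,2,3] * (w [2,3] * w [2,2,3]) +
  d [2,3] [2,3,3] * (w [2,3] * w [2,3,3]) + d [2,3] [3,3,3] * (w [2,3] * w [3,3,3]) +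
  d [3,3] [1,1,1] * (w [3,3] * w [1,1,1]) + d [3,3] [1,1,2] * (w [3,3] * w [1,1,2]) +
  d [3,3] [1,1,3] * (w [3,3] * w [1,1,3]) + d [3,3] [1,2,2] * (w [3,3] * w [1,2,2]) +
  d [3,3] [1,2,3] * (w [3,3] * w [1,2,3]) + d [3,3] [1,3,3] * (w [3,3] * w [1,3,3]) +
  d [3,3] [2,2,2] * (w [3,3] * w [2,2,2]) + d [3,3] [2,2,3] * (w [3,3] * w [2,2,3]) +
  d [3,3] [2,3,3] * (w [3,3] * w [2,3,3]) + d [3,3] [3,3,3] * (w [3,3] * w [3,3,3])"
  by (simp add: bilinear_expr_def idx2_def idx3_def)

text \<open>Weights of two indices are even and weights of three are odd, so only odd totals occur,
  from 25 = 10 + 15 down to 3.\<close>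

lemma top_part_25:
  assumes "\<And>I K. (I, K) \<in> dependent \<Longrightarrow> d I K = 0"
  shows "top_part 25 c d w = d [1,1] [1,1,1] * (w [1,1] * w [1,1,1])"
  unfolding top_part_def bilinear_expr_expand weight_simps using assms by (simp add: dependent_def)

lemma top_part_23:
  assumes "\<And>I K. (I, K) \<in> dependent \<Longrightarrow> d I K = 0"
  shows "top_part 23 c d w = d [1,1] [1,1,2] * (w [1,1] * w [1,1,2])"
  unfolding top_part_def bilinear_expr_expand weight_simps using assms by (simp add: dependent_def)

lemma top_part_21:
  assumes "\<And>I K. (I, K) \<in> dependent \<Longrightarrow> d I K = 0"
  shows "top_part 21 c d w = d [1,1] [1,1,3] * (w [1,1] * w [1,1,3]) + d [1,1] [1,2,2] * (w [1,1] * w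
      [1,2,2]) + d [1,2] [1,1,2] * (w [1,2] * w [1,1,2])"
  unfolding top_part_def bilinear_expr_expand weight_simps using assms by (simp add: dependent_def)

lemma top_part_19:
  assumes "\<And>I K. (I, K) \<in> dependent \<Longrightarrow> d I K = 0"
  shows "top_part 19 c d w = d [1,1] [1,2,3] * (w [1,1] * w [1,2,3]) + d [1,1] [2,2,2] * (w [1,1] * w
      [2,2,2]) + d [1,2] [1,1,3] * (w [1,2] * w [1,1,3]) + d [1,2] [1,2,2] * (w [1,2] * w [1,2,2])"
  unfolding top_part_def bilinear_expr_expand weight_simps using assms by (simp add: dependent_def)

lemma top_part_17:
  assumes "\<And>I K. (I, K) \<in> dependent \<Longrightarrow> d I K = 0"
  shows "top_part 17 c d w = d [1,1] [1,3,3] * (w [1,1] * w [1,3,3]) + d [1,1] [2,2,3] * (w [1,1] * w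
      [2,2,3]) + d [1,2] [1,2,3] * (w [1,2] * w [1,2,3]) + d [1,2] [2,2,2] * (w [1,2] * w [2,2,2]) + d
      [1,3] [1,1,3] * (w [1,3] * w [1,1,3]) + d [2,2] [1,1,3] * (w [2,2] * w [1,1,3])"
  unfolding top_part_def bilinear_expr_expand weight_simps using assms by (simp add: dependent_def)

lemma top_part_15:
  assumes "\<And>I K. (I, K) \<in> dependent \<Longrightarrow> d I K = 0"
  shows "top_part 15 c d w = c [1,1,1] * w [1,1,1] + d [1,1] [2,3,3] * (w [1,1] * w [2,3,3]) + d [1,2]
      [1,3,3] * (w [1,2] * w [1,3,3]) + d [1,2] [2,2,3] * (w [1,2] * w [2,2,3]) + d [1,3] [1,2,3] * (w
      [1,3] * w [1,2,3]) + d [2,2] [1,2,3] * (w [2,2] * w [1,2,3]) + d [2,2] [2,2,2] * (w [2,2] * w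
      [2,2,2])"
  unfolding top_part_def bilinear_expr_expand weight_simps using assms by (simp add: dependent_def)

lemma top_part_13:
  assumes "\<And>I K. (I, K) \<in> dependent \<Longrightarrow> d I K = 0"
  shows "top_part 13 c d w = c [1,1,2] * w [1,1,2] + d [1,1] [3,3,3] * (w [1,1] * w [3,3,3]) + d [1,2]
      [2,3,3] * (w [1,2] * w [2,3,3]) + d [1,3] [1,3,3] * (w [1,3] * w [1,3,3]) + d [1,3] [2,2,3] * (w
      [1,3] * w [2,2,3]) + d [2,2] [1,3,3] * (w [2,2] * w [1,3,3]) + d [2,2] [2,2,3] * (w [2,2] * w
      [2,2,3])"
  unfolding top_part_def bilinear_expr_expand weight_simps using assms by (simp add: dependent_def)

lemma top_part_11:
  assumes "\<And>I K. (I, K) \<in> dependent \<Longrightarrow> d I K = 0"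
  shows "top_part 11 c d w = c [1,1,3] * w [1,1,3] + c [1,2,2] * w [1,2,2] + d [1,2] [3,3,3] * (w [1,2]
      * w [3,3,3]) + d [1,3] [2,3,3] * (w [1,3] * w [2,3,3]) + d [2,2] [2,3,3] * (w [2,2] * w [2,3,3]) +
      d [2,3] [2,2,3] * (w [2,3] * w [2,2,3])"
  unfolding top_part_def bilinear_expr_expand weight_simps using assms by (simp add: dependent_def)

lemma top_part_9:
  assumes "\<And>I K. (I, K) \<in> dependent \<Longrightarrow> d I K = 0"
  shows "top_part 9 c d w = c [1,2,3] * w [1,2,3] + c [2,2,2] * w [2,2,2] + d [1,3] [3,3,3] * (w [1,3] *
      w [3,3,3]) + d [2,2] [3,3,3] * (w [2,2] * w [3,3,3]) + d [2,3] [2,3,3] * (w [2,3] * w [2,3,3])"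
  unfolding top_part_def bilinear_expr_expand weight_simps using assms by (simp add: dependent_def)

lemma top_part_7:
  assumes "\<And>I K. (I, K) \<in> dependent \<Longrightarrow> d I K = 0"
  shows "top_part 7 c d w = c [1,3,3] * w [1,3,3] + c [2,2,3] * w [2,2,3] + d [2,3] [3,3,3] * (w [2,3] *
      w [3,3,3])"
  unfolding top_part_def bilinear_expr_expand weight_simps using assms by (simp add: dependent_def)

lemma top_part_5:
  assumes "\<And>I K. (I, K) \<in> dependent \<Longrightarrow> d I K = 0"
  shows "top_part 5 c d w = c [2,3,3] * w [2,3,3] + d [3,3] [3,3,3] * (w [3,3] * w [3,3,3])"
  unfolding top_part_def bilinear_expr_expand weight_simps using assms by (simp add: dependent_def)

lemma top_part_3:
  assumes "\<And>I K. (I, K) \<in> dependent \<Longrightarrow> d I K = 0"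
  shows "top_part 3 c d w = c [3,3,3] * w [3,3,3]"
  unfolding top_part_def bilinear_expr_expand weight_simps using assms by (simp add: dependent_def)

context kleinian_chart
begin

text \<open>A descending induction on the weight, written out: once all coefficients above weight n
  are 0, the part of weight n vanishes at the sample triples, and these linear equations have only
  the zero solution.\<close>

lemma reduced_relation_trivial:
  assumes rel: "is_bilinear_relation \<sigma> c d" and u: "\<sigma> u \<noteq> 0"
    and dep: "\<And>I K. (I, K) \<in> dependent \<Longrightarrow> d I K = 0"
  shows "bilinear_expr c d w = 0"
proof -
  let ?w1 = "cusp_wp 1 (-2) (-3)"
    and ?w2 = "cusp_wp 1 (-2) (-4)"
    and ?w3 = "cusp_wp 1 (-2) 3"
    and ?w4 = "cusp_wp 1 (-2) 4"
    and ?w5 = "cusp_wp 1 2 (-3)"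
    and ?w6 = "cusp_wp 1 2 (-4)"
    and ?w7 = "cusp_wp 1 (-2) (-5)"
  let ?above = "\<lambda>n. (\<forall>K\<in>idx3. weight K > n \<longrightarrow> c K = 0) \<and>
    (\<forall>I\<in>idx2. \<forall>K\<in>idx3. weight I + weight K > n \<longrightarrow> d I K = 0)"
  note dep' = dep[unfolded dependent_def, simplified]
  have top: "top_part n c d (cusp_wp a b e) = 0"
    if "?above n" "a \<noteq> 0" "b \<noteq> 0" "e \<noteq> 0" "a\<^sup>2 \<noteq> b\<^sup>2" "a\<^sup>2 \<noteq> e\<^sup>2" "b\<^sup>2 \<noteq> e\<^sup>2" for n a b e
    unfolding top_part_def cusp_wp_def Let_def
  proof (rule top_weight_relation[OF rel u])
    show "(vector [a, b, e] :: complex ^ 3) $ k \<noteq> 0" for k using exhaust_3[of k] that(2-4) by auto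
    show "((vector [a, b, e] :: complex ^ 3) $ k)\<^sup>2 \<noteq> ((vector [a, b, e] :: complex ^ 3) $ l)\<^sup>2" if "k \<noteq>
        l" for k l
      using exhaust_3[of k] exhaust_3[of l] that \<open>a\<^sup>2 \<noteq> b\<^sup>2\<close> \<open>a\<^sup>2 \<noteq> e\<^sup>2\<close> \<open>b\<^sup>2 \<noteq> e\<^sup>2\<close> by auto
  qed (use that(1) in auto)

  have c25: "?above 25"
    unfolding idx2_def idx3_def ball_simps weight_simps by (simp_all add: dep')
  let ?t = "\<lambda>w :: 3 list \<Rightarrow> complex. d [1,1] [1,1,1] * (w [1,1] * w [1,1,1])"
  have e1: "?t ?w1 = 0"
    by (subst top_part_25[symmetric], erule dep, rule top[OF c25]) simp_all
  have z25: "d [1,1] [1,1,1] = 0"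
    using e1 unfolding cusp_wp_values_1 by simp
  have c23: "?above 23"
    unfolding idx2_def idx3_def ball_simps weight_simps by (simp_all add: dep' z25)
  let ?t = "\<lambda>w :: 3 list \<Rightarrow> complex. d [1,1] [1,1,2] * (w [1,1] * w [1,1,2])"
  have e1: "?t ?w1 = 0"
    by (subst top_part_23[symmetric], erule dep, rule top[OF c23]) simp_all
  have z23: "d [1,1] [1,1,2] = 0"
    using e1 unfolding cusp_wp_values_1 by simp
  have c21: "?above 21"
    unfolding idx2_def idx3_def ball_simps weight_simps by (simp_all add: dep' z25 z23)
  let ?t = "\<lambda>w :: 3 list \<Rightarrow> complex. d [1,1] [1,1,3] * (w [1,1] * w [1,1,3]) + d [1,1] [1,2,2] * (w [1,1]
      * w [1,2,2]) + d [1,2] [1,1,2] * (w [1,2] * w [1,1,2])"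
  have e1: "?t ?w1 = 0"
    by (subst top_part_21[symmetric], erule dep, rule top[OF c21]) simp_all
  have e2: "?t ?w2 = 0"
    by (subst top_part_21[symmetric], erule dep, rule top[OF c21]) simp_all
  have e3: "?t ?w3 = 0"
    by (subst top_part_21[symmetric], erule dep, rule top[OF c21]) simp_all
  \<comment> \<open>There are as many samples as unknowns, and the square rational system is
    nonsingular. The same scheme serves every lower weight.\<close>
  have z21: "d [1,1] [1,1,3] = 0" "d [1,1] [1,2,2] = 0" "d [1,2] [1,1,2] = 0"
    using e1 e2 e3 unfolding cusp_wp_values_1 cusp_wp_values_2 cusp_wp_values_3 by algebra+
  have c19: "?above 19"
    unfolding idx2_def idx3_def ball_simps weight_simps by (simp_all add: dep' z25 z23 z21)
  let ?t = "\<lambda>w :: 3 list \<Rightarrow> complex. d [1,1] [1,2,3] * (w [1,1] * w [1,2,3]) + d [1,1] [2,2,2] * (w [1,1]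
      * w [2,2,2]) + d [1,2] [1,1,3] * (w [1,2] * w [1,1,3]) + d [1,2] [1,2,2] * (w [1,2] * w [1,2,2])"
  have e1: "?t ?w1 = 0"
    by (subst top_part_19[symmetric], erule dep, rule top[OF c19]) simp_all
  have e2: "?t ?w2 = 0"
    by (subst top_part_19[symmetric], erule dep, rule top[OF c19]) simp_all
  have e3: "?t ?w3 = 0"
    by (subst top_part_19[symmetric], erule dep, rule top[OF c19]) simp_all
  have e4: "?t ?w4 = 0"
    by (subst top_part_19[symmetric], erule dep, rule top[OF c19]) simp_all
  have z19: "d [1,1] [1,2,3] = 0" "d [1,1] [2,2,2] = 0" "d [1,2] [1,1,3] = 0" "d [1,2] [1,2,2] = 0"
    using e1 e2 e3 e4 unfolding cusp_wp_values_1 cusp_wp_values_2 cusp_wp_values_3 cusp_wp_values_4 by algebra+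
  have c17: "?above 17"
    unfolding idx2_def idx3_def ball_simps weight_simps by (simp_all add: dep' z25 z23 z21 z19)
  let ?t = "\<lambda>w :: 3 list \<Rightarrow> complex. d [1,1] [1,3,3] * (w [1,1] * w [1,3,3]) + d [1,1] [2,2,3] * (w [1,1]
      * w [2,2,3]) + d [1,2] [1,2,3] * (w [1,2] * w [1,2,3]) + d [1,2] [2,2,2] * (w [1,2] * w [2,2,2]) +
      d [1,3] [1,1,3] * (w [1,3] * w [1,1,3]) + d [2,2] [1,1,3] * (w [2,2] * w [1,1,3])"
  have e1: "?t ?w1 = 0"
    by (subst top_part_17[symmetric], erule dep, rule top[OF c17]) simp_all
  have e2: "?t ?w2 = 0"
    by (subst top_part_17[symmetric], erule dep, rule top[OF c17]) simp_all
  have e3: "?t ?w3 = 0"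
    by (subst top_part_17[symmetric], erule dep, rule top[OF c17]) simp_all
  have e4: "?t ?w4 = 0"
    by (subst top_part_17[symmetric], erule dep, rule top[OF c17]) simp_all
  have e5: "?t ?w5 = 0"
    by (subst top_part_17[symmetric], erule dep, rule top[OF c17]) simp_all
  have e6: "?t ?w6 = 0"
    by (subst top_part_17[symmetric], erule dep, rule top[OF c17]) simp_all
  have z17: "d [1,1] [1,3,3] = 0" "d [1,1] [2,2,3] = 0" "d [1,2] [1,2,3] = 0" "d [1,2] [2,2,2] = 0" "d
      [1,3] [1,1,3] = 0" "d [2,2] [1,1,3] = 0"
    using e1 e2 e3 e4 e5 e6 unfolding cusp_wp_values_1 cusp_wp_values_2 cusp_wp_values_3
        cusp_wp_values_4 cusp_wp_values_5 cusp_wp_values_6 by algebra+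
  have c15: "?above 15"
    unfolding idx2_def idx3_def ball_simps weight_simps by (simp_all add: dep' z25 z23 z21 z19 z17)
  let ?t = "\<lambda>w :: 3 list \<Rightarrow> complex. c [1,1,1] * w [1,1,1] + d [1,1] [2,3,3] * (w [1,1] * w [2,3,3]) + d
      [1,2] [1,3,3] * (w [1,2] * w [1,3,3]) + d [1,2] [2,2,3] * (w [1,2] * w [2,2,3]) + d [1,3] [1,2,3]
      * (w [1,3] * w [1,2,3]) + d [2,2] [1,2,3] * (w [2,2] * w [1,2,3]) + d [2,2] [2,2,2] * (w [2,2] * w
      [2,2,2])"
  have e1: "?t ?w1 = 0"
    by (subst top_part_15[symmetric], erule dep, rule top[OF c15]) simp_all
  have e2: "?t ?w2 = 0"
    by (subst top_part_15[symmetric], erule dep, rule top[OF c15]) simp_all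
  have e3: "?t ?w3 = 0"
    by (subst top_part_15[symmetric], erule dep, rule top[OF c15]) simp_all
  have e4: "?t ?w4 = 0"
    by (subst top_part_15[symmetric], erule dep, rule top[OF c15]) simp_all
  have e5: "?t ?w5 = 0"
    by (subst top_part_15[symmetric], erule dep, rule top[OF c15]) simp_all
  have e6: "?t ?w6 = 0"
    by (subst top_part_15[symmetric], erule dep, rule top[OF c15]) simp_all
  have e7: "?t ?w7 = 0"
    by (subst top_part_15[symmetric], erule dep, rule top[OF c15]) simp_all
  have z15: "c [1,1,1] = 0" "d [1,1] [2,3,3] = 0" "d [1,2] [1,3,3] = 0" "d [1,2] [2,2,3] = 0" "d [1,3]
      [1,2,3] = 0" "d [2,2] [1,2,3] = 0" "d [2,2] [2,2,2] = 0"
    using e1 e2 e3 e4 e5 e6 e7 unfolding cusp_wp_values_1 cusp_wp_values_2 cusp_wp_values_3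
        cusp_wp_values_4 cusp_wp_values_5 cusp_wp_values_6 cusp_wp_values_7 by algebra+
  have c13: "?above 13"
    unfolding idx2_def idx3_def ball_simps weight_simps by (simp_all add: dep' z25 z23 z21 z19 z17 z15)
  let ?t = "\<lambda>w :: 3 list \<Rightarrow> complex. c [1,1,2] * w [1,1,2] + d [1,1] [3,3,3] * (w [1,1] * w [3,3,3]) + d
      [1,2] [2,3,3] * (w [1,2] * w [2,3,3]) + d [1,3] [1,3,3] * (w [1,3] * w [1,3,3]) + d [1,3] [2,2,3]
      * (w [1,3] * w [2,2,3]) + d [2,2] [1,3,3] * (w [2,2] * w [1,3,3]) + d [2,2] [2,2,3] * (w [2,2] * w
      [2,2,3])"
  have e1: "?t ?w1 = 0"
    by (subst top_part_13[symmetric], erule dep, rule top[OF c13]) simp_all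
  have e2: "?t ?w2 = 0"
    by (subst top_part_13[symmetric], erule dep, rule top[OF c13]) simp_all
  have e3: "?t ?w3 = 0"
    by (subst top_part_13[symmetric], erule dep, rule top[OF c13]) simp_all
  have e4: "?t ?w4 = 0"
    by (subst top_part_13[symmetric], erule dep, rule top[OF c13]) simp_all
  have e5: "?t ?w5 = 0"
    by (subst top_part_13[symmetric], erule dep, rule top[OF c13]) simp_all
  have e6: "?t ?w6 = 0"
    by (subst top_part_13[symmetric], erule dep, rule top[OF c13]) simp_all
  have e7: "?t ?w7 = 0"
    by (subst top_part_13[symmetric], erule dep, rule top[OF c13]) simp_all
  have z13: "c [1,1,2] = 0" "d [1,1] [3,3,3] = 0" "d [1,2] [2,3,3] = 0" "d [1,3] [1,3,3] = 0" "d [1,3]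
      [2,2,3] = 0" "d [2,2] [1,3,3] = 0" "d [2,2] [2,2,3] = 0"
    using e1 e2 e3 e4 e5 e6 e7 unfolding cusp_wp_values_1 cusp_wp_values_2 cusp_wp_values_3
        cusp_wp_values_4 cusp_wp_values_5 cusp_wp_values_6 cusp_wp_values_7 by algebra+
  have c11: "?above 11"
    unfolding idx2_def idx3_def ball_simps weight_simps by (simp_all add: dep' z25 z23 z21 z19 z17 z15 z13)
  let ?t = "\<lambda>w :: 3 list \<Rightarrow> complex. c [1,1,3] * w [1,1,3] + c [1,2,2] * w [1,2,2] + d [1,2] [3,3,3] * (w
      [1,2] * w [3,3,3]) + d [1,3] [2,3,3] * (w [1,3] * w [2,3,3]) + d [2,2] [2,3,3] * (w [2,2] * w
      [2,3,3]) + d [2,3] [2,2,3] * (w [2,3] * w [2,2,3])"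
  have e1: "?t ?w1 = 0"
    by (subst top_part_11[symmetric], erule dep, rule top[OF c11]) simp_all
  have e2: "?t ?w2 = 0"
    by (subst top_part_11[symmetric], erule dep, rule top[OF c11]) simp_all
  have e3: "?t ?w3 = 0"
    by (subst top_part_11[symmetric], erule dep, rule top[OF c11]) simp_all
  have e4: "?t ?w4 = 0"
    by (subst top_part_11[symmetric], erule dep, rule top[OF c11]) simp_all
  have e5: "?t ?w5 = 0"
    by (subst top_part_11[symmetric], erule dep, rule top[OF c11]) simp_all
  have e6: "?t ?w6 = 0"
    by (subst top_part_11[symmetric], erule dep, rule top[OF c11]) simp_all
  have z11: "c [1,1,3] = 0" "c [1,2,2] = 0" "d [1,2] [3,3,3] = 0" "d [1,3] [2,3,3] = 0" "d [2,2] [2,3,3]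
      = 0" "d [2,3] [2,2,3] = 0"
    using e1 e2 e3 e4 e5 e6 unfolding cusp_wp_values_1 cusp_wp_values_2 cusp_wp_values_3
        cusp_wp_values_4 cusp_wp_values_5 cusp_wp_values_6 by algebra+
  have c9: "?above 9"
    unfolding idx2_def idx3_def ball_simps weight_simps by (simp_all add: dep' z25 z23 z21 z19 z17 z15 z13 z11)
  let ?t = "\<lambda>w :: 3 list \<Rightarrow> complex. c [1,2,3] * w [1,2,3] + c [2,2,2] * w [2,2,2] + d [1,3] [3,3,3] * (w
      [1,3] * w [3,3,3]) + d [2,2] [3,3,3] * (w [2,2] * w [3,3,3]) + d [2,3] [2,3,3] * (w [2,3] * w
      [2,3,3])"
  have e1: "?t ?w1 = 0"
    by (subst top_part_9[symmetric], erule dep, rule top[OF c9]) simp_all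
  have e2: "?t ?w2 = 0"
    by (subst top_part_9[symmetric], erule dep, rule top[OF c9]) simp_all
  have e3: "?t ?w3 = 0"
    by (subst top_part_9[symmetric], erule dep, rule top[OF c9]) simp_all
  have e4: "?t ?w4 = 0"
    by (subst top_part_9[symmetric], erule dep, rule top[OF c9]) simp_all
  have e5: "?t ?w5 = 0"
    by (subst top_part_9[symmetric], erule dep, rule top[OF c9]) simp_all
  have z9: "c [1,2,3] = 0" "c [2,2,2] = 0" "d [1,3] [3,3,3] = 0" "d [2,2] [3,3,3] = 0" "d [2,3] [2,3,3] = 0"
    using e1 e2 e3 e4 e5 unfolding cusp_wp_values_1 cusp_wp_values_2 cusp_wp_values_3 cusp_wp_values_4
        cusp_wp_values_5 by algebra+
  have c7: "?above 7"
    unfolding idx2_def idx3_def ball_simps weight_simps by (simp_all add: dep' z25 z23 z21 z19 z17 z15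
        z13 z11 z9)
  let ?t = "\<lambda>w :: 3 list \<Rightarrow> complex. c [1,3,3] * w [1,3,3] + c [2,2,3] * w [2,2,3] + d [2,3] [3,3,3] * (w
      [2,3] * w [3,3,3])"
  have e1: "?t ?w1 = 0"
    by (subst top_part_7[symmetric], erule dep, rule top[OF c7]) simp_all
  have e2: "?t ?w2 = 0"
    by (subst top_part_7[symmetric], erule dep, rule top[OF c7]) simp_all
  have e3: "?t ?w3 = 0"
    by (subst top_part_7[symmetric], erule dep, rule top[OF c7]) simp_all
  have z7: "c [1,3,3] = 0" "c [2,2,3] = 0" "d [2,3] [3,3,3] = 0"
    using e1 e2 e3 unfolding cusp_wp_values_1 cusp_wp_values_2 cusp_wp_values_3 by algebra+
  have c5: "?above 5"
    unfolding idx2_def idx3_def ball_simps weight_simps by (simp_all add: dep' z25 z23 z21 z19 z17 z15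
        z13 z11 z9 z7)
  let ?t = "\<lambda>w :: 3 list \<Rightarrow> complex. c [2,3,3] * w [2,3,3] + d [3,3] [3,3,3] * (w [3,3] * w [3,3,3])"
  have e1: "?t ?w1 = 0"
    by (subst top_part_5[symmetric], erule dep, rule top[OF c5]) simp_all
  have e2: "?t ?w2 = 0"
    by (subst top_part_5[symmetric], erule dep, rule top[OF c5]) simp_all
  have z5: "c [2,3,3] = 0" "d [3,3] [3,3,3] = 0"
    using e1 e2 unfolding cusp_wp_values_1 cusp_wp_values_2 by algebra+
  have c3: "?above 3"
    unfolding idx2_def idx3_def ball_simps weight_simps by (simp_all add: dep' z25 z23 z21 z19 z17 z15
        z13 z11 z9 z7 z5)
  let ?t = "\<lambda>w :: 3 list \<Rightarrow> complex. c [3,3,3] * w [3,3,3]"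
  have e1: "?t ?w1 = 0"
    by (subst top_part_3[symmetric], erule dep, rule top[OF c3]) simp_all
  have z3: "c [3,3,3] = 0"
    using e1 unfolding cusp_wp_values_1 by simp
  show ?thesis
    unfolding bilinear_expr_expand by (simp add: dep' z25 z23 z21 z19 z17 z15 z13 z11 z9 z7 z5 z3)
qed

end

text \<open>If \<sigma> vanished everywhere, \<open>is_bilinear_relation\<close> would hold
  vacuously for all coefficients; the normalisation of the Taylor expansion excludes this.\<close>

lemma sigma_leading_part_nonzero:
  assumes "sigma_leading_part \<sigma>"
  shows "\<exists>u. \<sigma> u \<noteq> 0"
proof (rule ccontr)
  assume "\<nexists>u. \<sigma> u \<noteq> 0"
  then have \<sigma>: "\<sigma> = (\<lambda>_. 0)" by auto
  have "(pd i ^^ n) (\<lambda>_. 0) = (\<lambda>_. 0)" for i n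
    by (induction n) (simp_all add: pd_def fun_eq_iff)
  then have "taylor_coeff \<sigma> a b c = 0" for a b c
    unfolding taylor_coeff_def \<sigma> by simp
  moreover have "(\<Sum>(a, b, c) \<in> {(a, b, c). 5 * a + 3 * b + c = 6}.
        taylor_coeff \<sigma> a b c * (u $ 1) ^ a * (u $ 2) ^ b * (u $ 3) ^ c)
      = 1 / 45 * (u $ 3) ^ 6 - 1 / 3 * (u $ 3) ^ 3 * u $ 2 - (u $ 2)\<^sup>2 + u $ 3 * u $ 1" for u :: "complex ^ 3"
    using assms by (simp add: sigma_leading_part_def)
  \<comment> \<open>At this vector the prescribed leading part equals 1/45 + 1.\<close>
  from this[of "vector [1, 0, 1]"] show False
    using calculation by (simp add: split_beta)
qed

theorem theorem4p4:
  fixes lam :: "nat \<Rightarrow> complex" and \<sigma> :: "complex ^ 3 \<Rightarrow> complex"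
  assumes "lam 7 = 1" and "nonsingular_curve lam" and "kleinian_sigma lam \<sigma>"
  shows "(\<forall>n<24. \<forall>u. \<sigma> u \<noteq> 0 \<longrightarrow> listed_relations lam (\<lambda>I. wp \<sigma> I u) ! n = 0) \<and>
         (\<forall>c d. is_bilinear_relation \<sigma> c d \<longrightarrow>
            (\<exists>a :: nat \<Rightarrow> complex. \<forall>w. bilinear_expr c d w = (\<Sum>n<24. a n * listed_relations lam w ! n)))"
proof -
  have \<sigma>: "cdiff_on \<sigma> UNIV" "sigma_klein_formula lam \<sigma>" "sigma_leading_part \<sigma>"
    using assms(3) by (auto simp: kleinian_sigma_def intro: entire_imp_cdiff_on)
  obtain u where u: "\<sigma> u \<noteq> 0" using sigma_leading_part_nonzero[OF \<sigma>(3)] by blast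
  obtain \<rho> h A where chart: "\<rho> > 0" "h holomorphic_on ball 0 \<rho>" "h 0 = 1"
    "\<And>t. t \<in> ball 0 \<rho> \<Longrightarrow> h t \<noteq> 0" "\<And>t. h (- t) = h t" "\<And>t. (h t)\<^sup>2 = inf_radicand lam t"
    "\<And>t i. t \<in> ball 0 \<rho> \<Longrightarrow>
      ((\<lambda>t. A t $ i) has_field_derivative (- 1 / h t * (vector [t ^ 4, t\<^sup>2, 1] :: complex ^ 3) $ i)) (at t)"
    "\<And>t. t \<in> ball 0 \<rho> \<Longrightarrow> A (- t) = - A t"
    "\<And>t. t \<in> ball 0 \<rho> \<Longrightarrow> t \<noteq> 0 \<Longrightarrow> abelian_integral lam None (Some (1 / t\<^sup>2, h t / t ^ 7)) (A t)"
    using abelian_chart_at_inf[of lam, OF assms(1)] by blast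
  interpret kleinian_chart lam \<sigma> \<rho> h A
    by unfold_locales (fact assms(1) \<sigma>(1,2) chart)+
  have "\<exists>a. \<forall>w. bilinear_expr c d w = (\<Sum>n<24. a n * listed_relations lam w ! n)"
    if rel: "is_bilinear_relation \<sigma> c d" for c d
  proof -
    from reducible_bilinear_expr[of lam c d] obtain a c' d' where
      red: "\<forall>I K. (I, K) \<in> dependent \<longrightarrow> d' I K = 0"
        "\<forall>w. bilinear_expr c d w = bilinear_expr c' d' w + (\<Sum>n<24. a n * listed_relations lam w ! n)"
      unfolding reducible_def by (elim exE conjE)
    \<comment> \<open>The listed relations vanish on the actual functions, so subtracting them from
      a relation leaves a relation.\<close>
    have "is_bilinear_relation \<sigma> c' d'"
      unfolding is_bilinear_relation_def
    proof (intro allI impI)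
      fix v assume v: "\<sigma> v \<noteq> 0"
      have "(\<Sum>n<24. a n * listed_relations lam (\<lambda>I. wp \<sigma> I v) ! n) = 0"
        by (intro sum.neutral ballI) (simp add: listed_relations_vanish[OF _ v])
      moreover have "bilinear_expr c d (\<lambda>I. wp \<sigma> I v) = 0"
        using rel v by (simp add: is_bilinear_relation_def)
      ultimately show "bilinear_expr c' d' (\<lambda>I. wp \<sigma> I v) = 0"
        using red(2)[rule_format, of "\<lambda>I. wp \<sigma> I v"] by simp
    qed
    from reduced_relation_trivial[OF this u] red show ?thesis by auto
  qed
  then show ?thesis using listed_relations_vanish by blast
qed

end
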